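(* Let $q=e^{-\mathrm i\theta_0}$ with $0<|\theta_0|<\pi$, and let $A,B$ be self-adjoint operators on a Hilbert space with $\ker A=\ker B=\{0\}$. Suppose that $\mathcal D_q(A,B)$ and $\mathcal D_{-q}(|A|,B)$ are cores for $B$ and $$-qR_{\lambda q}(|A|)B\subseteq BR_{-\lambda}(|A|)\quad\text{for all }\lambda>0.$$ Then the pair $\{A,B\}$ belongs to the class $\mathcal C_1$.
   Context: For self-adjoint $X,Y$ and $p\in\mathbb C$, $\mathcal D_p(X,Y):=\{f\in\mathcal D(YX)\cap\mathcal D(XY): XYf=pYXf\}$. $\theta_1:=\theta_0-\pi$ if $\theta_0>0$, $\theta_1:=\theta_0+\pi$ if $\theta_0<0$. $R_\lambda(T)=(T-\lambda I)^{-1}$; $S\subseteq T$ means $T$ extends $S$. For self-adjoint $T$ with trivial kernel, $T=U_T|T|$ is the polar decomposition. A pair $\{A,B\}$ with $\ker A=\ker B=\{0\}$ belongs to class $\mathcal C_1$ if $|A|^{\mathrm it}B\subseteq e^{\theta_1t}B|A|^{\mathrm it}$ for all $t\in\mathbb R$ and $U_AU_B=-U_BU_A$. *)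

theory Defs
  imports "HOL-Analysis.Analysis" "HOL-Probability.Probability"
begin

class complex_hilbert = real_normed_vector + complete_space +
  fixes scaleC :: "complex \<Rightarrow> 'a \<Rightarrow> 'a"
  fixes cinner :: "'a \<Rightarrow> 'a \<Rightarrow> complex"
  assumes scaleC_add_right: "scaleC a (x + y) = scaleC a x + scaleC a y"
    and scaleC_add_left: "scaleC (a + b) x = scaleC a x + scaleC b x"
    and scaleC_scaleC: "scaleC a (scaleC b x) = scaleC (a * b) x"
    and scaleC_one: "scaleC 1 x = x"
    and scaleR_scaleC: "scaleR r x = scaleC (complex_of_real r) x"
    and cinner_commute: "cinner x y = cnj (cinner y x)"
    and cinner_add_right: "cinner x (y + z) = cinner x y + cinner x z"
    and cinner_scaleC_right: "cinner x (scaleC a y) = a * cinner x y"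
    and cinner_self_norm: "cinner x x = complex_of_real ((norm x)\<^sup>2)"

type_synonym 'a lop = "'a set \<times> ('a \<Rightarrow> 'a)"

definition odom :: "'a lop \<Rightarrow> 'a set" where "odom T = fst T"
definition oap :: "'a lop \<Rightarrow> 'a \<Rightarrow> 'a" where "oap T = snd T"

definition linear_op :: "'a::complex_hilbert lop \<Rightarrow> bool" where
  "linear_op T \<longleftrightarrow> 0 \<in> odom T
     \<and> (\<forall>x\<in>odom T. \<forall>y\<in>odom T. x + y \<in> odom T \<and> oap T (x + y) = oap T x + oap T y)
     \<and> (\<forall>x\<in>odom T. \<forall>c. scaleC c x \<in> odom T \<and> oap T (scaleC c x) = scaleC c (oap T x))"

definition op_eq :: "'a lop \<Rightarrow> 'a lop \<Rightarrow> bool" where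
  "op_eq S T \<longleftrightarrow> odom S = odom T \<and> (\<forall>x\<in>odom S. oap S x = oap T x)"

definition op_sub :: "'a lop \<Rightarrow> 'a lop \<Rightarrow> bool" where
  "op_sub S T \<longleftrightarrow> odom S \<subseteq> odom T \<and> (\<forall>x\<in>odom S. oap S x = oap T x)"

definition adjoint :: "'a::complex_hilbert lop \<Rightarrow> 'a lop" where
  "adjoint T = ({g. \<exists>h. \<forall>f\<in>odom T. cinner (oap T f) g = cinner f h},
     \<lambda>g. THE h. \<forall>f\<in>odom T. cinner (oap T f) g = cinner f h)"

definition self_adjoint :: "'a::complex_hilbert lop \<Rightarrow> bool" where
  "self_adjoint T \<longleftrightarrow> linear_op T \<and> closure (odom T) = UNIV \<and> op_eq T (adjoint T)"

definition okernel :: "'a::complex_hilbert lop \<Rightarrow> 'a set" where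
  "okernel T = {f \<in> odom T. oap T f = 0}"

definition ocomp :: "'a lop \<Rightarrow> 'a lop \<Rightarrow> 'a lop" where
  "ocomp Y X = ({f \<in> odom X. oap X f \<in> odom Y}, \<lambda>f. oap Y (oap X f))"

definition oscale :: "complex \<Rightarrow> 'a::complex_hilbert lop \<Rightarrow> 'a lop" where
  "oscale c T = (odom T, \<lambda>f. scaleC c (oap T f))"

definition Dp :: "complex \<Rightarrow> 'a::complex_hilbert lop \<Rightarrow> 'a lop \<Rightarrow> 'a set" where
  "Dp p X Y = {f \<in> odom (ocomp Y X) \<inter> odom (ocomp X Y).
      oap X (oap Y f) = scaleC p (oap Y (oap X f))}"

definition is_core :: "'a::complex_hilbert set \<Rightarrow> 'a lop \<Rightarrow> bool" where
  "is_core D B \<longleftrightarrow> D \<subseteq> odom B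
     \<and> closure ((\<lambda>f. (f, oap B f)) ` D) = (\<lambda>f. (f, oap B f)) ` odom B"

definition resolvent :: "complex \<Rightarrow> 'a::complex_hilbert lop \<Rightarrow> 'a lop" where
  "resolvent l T = ((\<lambda>f. oap T f - scaleC l f) ` odom T,
     \<lambda>g. THE f. f \<in> odom T \<and> oap T f - scaleC l f = g)"

definition is_pvm :: "(real set \<Rightarrow> 'a::complex_hilbert \<Rightarrow> 'a) \<Rightarrow> bool" where
  "is_pvm E \<longleftrightarrow>
     (\<forall>S. S \<notin> sets borel \<longrightarrow> E S = (\<lambda>_. 0))
   \<and> (\<forall>S\<in>sets borel. (\<forall>x y. E S (x + y) = E S x + E S y)
        \<and> (\<forall>c x. E S (scaleC c x) = scaleC c (E S x))
        \<and> (\<forall>x y. cinner (E S x) y = cinner x (E S y))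
        \<and> (\<forall>x. E S (E S x) = E S x))
   \<and> E UNIV = id
   \<and> (\<forall>S\<in>sets borel. \<forall>T\<in>sets borel. E (S \<inter> T) = E S \<circ> E T)
   \<and> (\<forall>F. range F \<subseteq> sets borel \<longrightarrow> disjoint_family F \<longrightarrow>
        (\<forall>x. (\<lambda>n. \<Sum>k<n. E (F k) x) \<longlonglongrightarrow> E (\<Union>n. F n) x))"

definition smeas :: "(real set \<Rightarrow> 'a::complex_hilbert \<Rightarrow> 'a) \<Rightarrow> 'a \<Rightarrow> real measure" where
  "smeas E x = measure_of UNIV (sets borel) (\<lambda>S. ennreal ((norm (E S x))\<^sup>2))"

text \<open>T is (on its domain) the spectral integral of \<phi> with respect to E:
  D(T) = {x. \<integral>|\<phi>|^2 d\<mu>_x < \<infinity>}, T linear, and <x, Tx> = \<integral> \<phi> d\<mu>_x.\<close>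
definition represents :: "(real set \<Rightarrow> 'a::complex_hilbert \<Rightarrow> 'a) \<Rightarrow> (real \<Rightarrow> complex) \<Rightarrow> 'a lop \<Rightarrow> bool" where
  "represents E \<phi> T \<longleftrightarrow>
     odom T = {x. (\<integral>\<^sup>+ s. ennreal ((cmod (\<phi> s))\<^sup>2) \<partial>smeas E x) < \<infinity>}
   \<and> linear_op T
   \<and> (\<forall>x\<in>odom T. cinner x (oap T x) = (\<integral> s. \<phi> s \<partial>smeas E x))"

definition spectral_resolution :: "'a::complex_hilbert lop \<Rightarrow> (real set \<Rightarrow> 'a \<Rightarrow> 'a)" where
  "spectral_resolution A = (THE E. is_pvm E \<and> represents E (\<lambda>s. complex_of_real s) A)"

definition fcalc :: "'a::complex_hilbert lop \<Rightarrow> (real \<Rightarrow> complex) \<Rightarrow> 'a lop" where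
  "fcalc A \<phi> = (THE T. represents (spectral_resolution A) \<phi> T \<and> (\<forall>x. x \<notin> odom T \<longrightarrow> oap T x = 0))"

definition absop :: "'a::complex_hilbert lop \<Rightarrow> 'a lop" where
  "absop A = fcalc A (\<lambda>s. complex_of_real \<bar>s\<bar>)"

text \<open>Imaginary powers T^{it} of a positive self-adjoint operator T
  (the value of s^{it} at s = 0 is irrelevant when ker T = {0}).\<close>
definition imag_power :: "'a::complex_hilbert lop \<Rightarrow> real \<Rightarrow> 'a lop" where
  "imag_power T t = fcalc T (\<lambda>s. if s > 0 then cis (t * ln s) else 0)"

definition polar_U :: "'a::complex_hilbert lop \<Rightarrow> 'a lop" where
  "polar_U T = (THE U. odom U = UNIV \<and> linear_op U
       \<and> (\<exists>K. \<forall>x. norm (oap U x) \<le> K * norm x)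
       \<and> op_eq T (ocomp U (absop T))
       \<and> okernel U = okernel (absop T))"

definition theta1 :: "real \<Rightarrow> real" where
  "theta1 \<theta>0 = (if \<theta>0 > 0 then \<theta>0 - pi else \<theta>0 + pi)"

definition class_C1 :: "real \<Rightarrow> 'a::complex_hilbert lop \<Rightarrow> 'a lop \<Rightarrow> bool" where
  "class_C1 \<theta>0 A B \<longleftrightarrow> okernel A = {0} \<and> okernel B = {0}
     \<and> (\<forall>t::real. op_sub (ocomp (imag_power (absop A) t) B)
                        (oscale (complex_of_real (exp (theta1 \<theta>0 * t))) (ocomp B (imag_power (absop A) t))))
     \<and> (\<forall>x. oap (polar_U A) (oap (polar_U B) x) = - oap (polar_U B) (oap (polar_U A) x))"

end

theory Submission
  imports Defs
begin

text \<open>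
  Spectral measures come from a weak limit of Fejer densities of the Cayley transform; pairs
  (function, operator) whose moments match form an algebra closed under bounded pointwise limits,
  which yields the Borel functional calculus, and the same closure argument gives uniqueness.

  The resolvent inclusion says that \<open>B\<close> carries \<open>f(absop A)\<close> to \<open>g(absop A)\<close> for \<open>f(x) = 1/(x + l)\<close> and
  \<open>g(x) = f(x exp(i \<theta>1))\<close>. This relation between \<open>f\<close> and \<open>g\<close> is also stable under sums, products and
  bounded pointwise limits, because \<open>B\<close> is closed, and so extends to \<open>f(x) = x powr (i t)\<close>, where
  \<open>g = exp(- \<theta>1 t) f\<close>. On the core \<open>Dp q A B\<close> the two relations \<open>A B = q B A\<close> and
  \<open>absop A B = - q B absop A\<close> combine to \<open>U B = - B U\<close> for \<open>U = polar_U A\<close>; hence \<open>U\<close> maps the spectral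
  measure of \<open>B\<close> to that of \<open>- B\<close> and anticommutes with \<open>polar_U B\<close>.
\<close>

section \<open>Complex Hilbert spaces and bounded operators\<close>

text \<open>The constants \<open>spectral_resolution\<close>, \<open>fcalc\<close> and
  \<open>polar_U\<close> are definite descriptions, so each needs existence and uniqueness before it
  can be computed with; hence a full spectral theorem precedes the commutation argument.
  \<open>represents\<close> prescribes only the diagonal values \<open>cinner x (oap T x)\<close>.
  Therefore operators are identified through polarization, and multiplicativity of a calculus has to
  be earned.

  The angle comes from -q = exp (-\<i> \<theta>1): the operator (|A| - l q)^-1 equals exp (\<i>
  \<theta>1) (exp (\<i> \<theta>1) |A| + l)^-1, and the prefactor -q cancels the phase. As
  |\<theta>1| < pi, the rotated half-line avoids the branch cut, and the principal logarithm on it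
  is ln x + \<i> \<theta>1, which produces the factor exp (-\<theta>1 t). The hypothesis supplies
  resolvents for l > 0 only, not on a contour, so the imaginary power must be assembled from these
  alone.\<close>

lemma cinner_add_left: "cinner (x + y) z = cinner x z + cinner (y::'a::complex_hilbert) z"
  unfolding cinner_commute[of _ z] by (simp add: cinner_add_right)

lemma cinner_scaleC_left: "cinner (scaleC a x) y = cnj a * cinner x (y::'a::complex_hilbert)"
  unfolding cinner_commute[of _ y] by (simp add: cinner_scaleC_right)

lemma scaleC_zero_left [simp]: "scaleC 0 (x::'a::complex_hilbert) = 0"
  using scaleC_add_left[of 0 0 x] by simp

lemma scaleC_zero_right [simp]: "scaleC a (0::'a::complex_hilbert) = 0"
  using scaleC_add_right[of a 0 "0::'a"] by simp

lemma scaleC_minus_left: "scaleC (- a) (x::'a::complex_hilbert) = - scaleC a x"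
  using scaleC_add_left[of a "-a" x] by (simp add: add_eq_0_iff)

lemma scaleC_minus_right: "scaleC a (- x::'a::complex_hilbert) = - scaleC a x"
  using scaleC_add_right[of a x "-x"] by (simp add: add_eq_0_iff)

lemma scaleC_diff_right: "scaleC a (x - y::'a::complex_hilbert) = scaleC a x - scaleC a y"
  using scaleC_add_right[of a x "-y"] by (simp add: scaleC_minus_right)

lemma scaleC_diff_left: "scaleC (a - b) (x::'a::complex_hilbert) = scaleC a x - scaleC b x"
  using scaleC_add_left[of a "-b" x] by (simp add: scaleC_minus_left)

lemma cinner_zero_right [simp]: "cinner (x::'a::complex_hilbert) 0 = 0"
  using cinner_add_right[of x 0 0] by simp

lemma cinner_zero_left [simp]: "cinner 0 (x::'a::complex_hilbert) = 0"
  using cinner_add_left[of 0 0 x] by simp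

lemma cinner_minus_right: "cinner x (- y) = - cinner x (y::'a::complex_hilbert)"
  using cinner_add_right[of x y "-y"] by (simp add: add_eq_0_iff)

lemma cinner_minus_left: "cinner (- x) y = - cinner x (y::'a::complex_hilbert)"
  using cinner_add_left[of x "-x" y] by (simp add: add_eq_0_iff)

lemma cinner_diff_right: "cinner x (y - z) = cinner x y - cinner x (z::'a::complex_hilbert)"
  using cinner_add_right[of x y "-z"] by (simp add: cinner_minus_right)

lemma cinner_diff_left: "cinner (x - y) z = cinner x z - cinner y (z::'a::complex_hilbert)"
  using cinner_add_left[of x "-y" z] by (simp add: cinner_minus_left)

lemma cinner_sum_left: "cinner (\<Sum>i\<in>I. f i) (x::'a::complex_hilbert) = (\<Sum>i\<in>I. cinner (f i) x)"
  by (induction I rule: infinite_finite_induct) (auto simp: cinner_add_left)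

lemma cinner_sum_right: "cinner (x::'a::complex_hilbert) (\<Sum>i\<in>I. f i) = (\<Sum>i\<in>I. cinner x (f i))"
  by (induction I rule: infinite_finite_induct) (auto simp: cinner_add_right)

lemmas cinner_simps = cinner_add_left cinner_add_right cinner_diff_left cinner_diff_right
  cinner_minus_left cinner_minus_right cinner_scaleC_left cinner_scaleC_right

lemma norm_sq_eq_cinner: "(norm (x::'a::complex_hilbert))\<^sup>2 = Re (cinner x x)"
  by (simp add: cinner_self_norm)

lemma cinner_eq_zero_iff: "cinner x x = 0 \<longleftrightarrow> x = (0::'a::complex_hilbert)"
  by (simp add: cinner_self_norm)

lemma norm_scaleC: "norm (scaleC a (x::'a::complex_hilbert)) = cmod a * norm x"
proof -
  have "(norm (scaleC a x))\<^sup>2 = Re ((a * cnj a) * cinner x x)"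
    unfolding norm_sq_eq_cinner by (simp add: cinner_simps mult_ac)
  also have "\<dots> = (cmod a * norm x)\<^sup>2"
    unfolding complex_norm_square[symmetric] cinner_self_norm
    by (simp only: of_real_mult[symmetric] Re_complex_of_real power_mult_distrib)
  finally show ?thesis
    by (rule power2_eq_imp_eq) simp_all
qed

lemma norm_add_sq: "(norm (x + y::'a::complex_hilbert))\<^sup>2 = (norm x)\<^sup>2 + (norm y)\<^sup>2 + 2 * Re (cinner x y)"
proof -
  have "Re (cinner y x) = Re (cinner x y)"
    by (subst cinner_commute) simp
  then show ?thesis
    by (simp add: norm_sq_eq_cinner cinner_simps)
qed

lemma norm_diff_sq: "(norm (x - y::'a::complex_hilbert))\<^sup>2 = (norm x)\<^sup>2 + (norm y)\<^sup>2 - 2 * Re (cinner x y)"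
  using norm_add_sq[of x "-y"] by (simp add: cinner_minus_right)

lemma cauchy_schwarz: "cmod (cinner x y) \<le> norm x * norm (y::'a::complex_hilbert)"
proof (cases "y = 0")
  case False
  define c where "c = cinner y x / complex_of_real ((norm y)\<^sup>2)"
  have ny: "norm y > 0" using False by simp
  have cyx: "cinner y x * cinner x y = complex_of_real ((cmod (cinner x y))\<^sup>2)"
    by (subst cinner_commute) (metis complex_norm_square mult.commute)
  have "0 \<le> (norm (x - scaleC c y))\<^sup>2" by simp
  also have "\<dots> = (norm x)\<^sup>2 + (cmod c * norm y)\<^sup>2 - 2 * Re (c * cinner x y)"
    by (simp add: norm_diff_sq norm_scaleC cinner_simps)
  also have "c * cinner x y = complex_of_real ((cmod (cinner x y))\<^sup>2 / (norm y)\<^sup>2)"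
    unfolding c_def using cyx by simp
  also have "(cmod c * norm y)\<^sup>2 = (cmod (cinner x y))\<^sup>2 / (norm y)\<^sup>2"
  proof -
    have "cmod (cinner y x) = cmod (cinner x y)" by (subst cinner_commute) simp
    then show ?thesis using ny
      by (simp add: c_def norm_divide norm_mult power2_eq_square)
  qed
  finally have "(cmod (cinner x y))\<^sup>2 / (norm y)\<^sup>2 \<le> (norm x)\<^sup>2"
    by simp
  then have "(cmod (cinner x y))\<^sup>2 \<le> (norm x * norm y)\<^sup>2"
    using ny by (simp add: divide_le_eq power_mult_distrib)
  then show ?thesis
    by (rule power2_le_imp_le) simp
qed simp

lemma bounded_bilinear_cinner: "bounded_bilinear (cinner :: 'a::complex_hilbert \<Rightarrow> 'a \<Rightarrow> complex)"
proof
  fix r :: real and a b :: 'a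
  show "cinner (r *\<^sub>R a) b = r *\<^sub>R cinner a b"
    by (simp add: scaleR_scaleC cinner_simps scaleR_conv_of_real)
  show "cinner a (r *\<^sub>R b) = r *\<^sub>R cinner a b"
    by (simp add: scaleR_scaleC cinner_simps scaleR_conv_of_real)
  show "\<exists>K. \<forall>a b::'a. norm (cinner a b) \<le> norm a * norm b * K"
    by (rule exI[of _ 1]) (simp add: cauchy_schwarz)
qed (simp_all add: cinner_simps)

lemma bounded_bilinear_scaleC: "bounded_bilinear (scaleC :: complex \<Rightarrow> 'a::complex_hilbert \<Rightarrow> 'a)"
proof
  fix r :: real and a b :: complex and x y :: 'a
  show "scaleC (r *\<^sub>R a) x = r *\<^sub>R scaleC a x"
    by (simp add: scaleR_scaleC scaleC_scaleC scaleR_conv_of_real)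
  show "scaleC a (r *\<^sub>R x) = r *\<^sub>R scaleC a x"
    by (simp add: scaleR_scaleC scaleC_scaleC mult.commute)
  show "\<exists>K. \<forall>a (x::'a). norm (scaleC a x) \<le> norm a * norm x * K"
    by (rule exI[of _ 1]) (simp add: norm_scaleC)
qed (simp_all add: scaleC_add_left scaleC_add_right)

lemmas tendsto_cinner [tendsto_intros] = bounded_bilinear.tendsto[OF bounded_bilinear_cinner]
lemmas tendsto_scaleC [tendsto_intros] = bounded_bilinear.tendsto[OF bounded_bilinear_scaleC]

section \<open>Complex subspaces, polarization and the projection theorem\<close>

definition csubspace :: "'a::complex_hilbert set \<Rightarrow> bool" where
  "csubspace D \<longleftrightarrow> 0 \<in> D \<and> (\<forall>x\<in>D. \<forall>y\<in>D. x + y \<in> D) \<and> (\<forall>x\<in>D. \<forall>c. scaleC c x \<in> D)"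

lemma csubspaceD:
  assumes "csubspace D"
  shows "0 \<in> D" "x \<in> D \<Longrightarrow> y \<in> D \<Longrightarrow> x + y \<in> D" "x \<in> D \<Longrightarrow> scaleC c x \<in> D"
    "x \<in> D \<Longrightarrow> y \<in> D \<Longrightarrow> x - y \<in> D"
proof -
  show "0 \<in> D" "x \<in> D \<Longrightarrow> y \<in> D \<Longrightarrow> x + y \<in> D" "x \<in> D \<Longrightarrow> scaleC c x \<in> D"
    using assms unfolding csubspace_def by auto
  have "x \<in> D \<Longrightarrow> y \<in> D \<Longrightarrow> x + scaleC (-1) y \<in> D"
    using assms unfolding csubspace_def by auto
  then show "x \<in> D \<Longrightarrow> y \<in> D \<Longrightarrow> x - y \<in> D"
    by (simp add: scaleC_minus_left scaleC_one)
qed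

lemma csubspace_UNIV [simp]: "csubspace UNIV"
  by (simp add: csubspace_def)

lemma linear_op_csubspace: "linear_op T \<Longrightarrow> csubspace (odom T)"
  unfolding linear_op_def csubspace_def by auto

lemma linear_opD:
  assumes "linear_op T"
  shows "x \<in> odom T \<Longrightarrow> y \<in> odom T \<Longrightarrow> oap T (x + y) = oap T x + oap T y"
    "x \<in> odom T \<Longrightarrow> oap T (scaleC c x) = scaleC c (oap T x)"
    "oap T 0 = 0"
    "x \<in> odom T \<Longrightarrow> y \<in> odom T \<Longrightarrow> oap T (x - y) = oap T x - oap T y"
proof -
  show 1: "x \<in> odom T \<Longrightarrow> y \<in> odom T \<Longrightarrow> oap T (x + y) = oap T x + oap T y"
    and 2: "x \<in> odom T \<Longrightarrow> oap T (scaleC c x) = scaleC c (oap T x)" for x y c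
    using assms unfolding linear_op_def by auto
  show "oap T 0 = 0"
    using 2[of 0 0] assms unfolding linear_op_def by simp
  assume xy: "x \<in> odom T" "y \<in> odom T"
  have "scaleC (-1) y \<in> odom T" using assms xy unfolding linear_op_def by auto
  from 1[OF xy(1) this] 2[OF xy(2), of "-1"] show "oap T (x - y) = oap T x - oap T y"
    by (simp add: scaleC_minus_left scaleC_one)
qed

text \<open>Polarization: a sesquilinear form that vanishes on the diagonal vanishes, as seen at
  \<open>x + y\<close> and at \<open>x + scaleC \<i> y\<close>. It is stated on a subspace so that
  it also serves for unbounded operators on a common domain.\<close>

lemma form_eq_imp_cinner_eq:
  fixes F G :: "'a::complex_hilbert \<Rightarrow> 'a"
  assumes D: "csubspace D"
    and F: "\<And>x y. x \<in> D \<Longrightarrow> y \<in> D \<Longrightarrow> F (x + y) = F x + F y"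
           "\<And>x c. x \<in> D \<Longrightarrow> F (scaleC c x) = scaleC c (F x)"
    and G: "\<And>x y. x \<in> D \<Longrightarrow> y \<in> D \<Longrightarrow> G (x + y) = G x + G y"
           "\<And>x c. x \<in> D \<Longrightarrow> G (scaleC c x) = scaleC c (G x)"
    and eq: "\<And>x. x \<in> D \<Longrightarrow> cinner x (F x) = cinner x (G x)"
    and xy: "x \<in> D" "y \<in> D"
  shows "cinner x (F y) = cinner x (G y)"
proof -
  define H where "H u v = cinner u (F v) - cinner u (G v)" for u v
  have H0: "H u u = 0" if "u \<in> D" for u using eq[OF that] by (simp add: H_def)
  have iy: "scaleC \<i> y \<in> D" using csubspaceD(3)[OF D xy(2)] .
  have "H (x + y) (x + y) = H x x + H x y + H y x + H y y"
    using xy by (simp add: H_def F G cinner_simps algebra_simps)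
  then have 1: "H x y + H y x = 0"
    using H0 xy csubspaceD(2)[OF D] by simp
  have "H (x + scaleC \<i> y) (x + scaleC \<i> y) = H x x + \<i> * H x y - \<i> * H y x + H y y"
    using xy iy by (simp add: H_def F G cinner_simps algebra_simps)
  then have 2: "\<i> * (H x y - H y x) = 0"
    using H0 xy iy csubspaceD(2)[OF D] by (simp add: algebra_simps)
  from 1 2 have "H x y = 0" by simp
  then show ?thesis by (simp add: H_def)
qed

lemma cinner_ext:
  assumes "\<And>z. cinner z x = cinner z (y::'a::complex_hilbert)"
  shows "x = y"
proof -
  have "cinner (x - y) (x - y) = 0"
    using assms by (simp add: cinner_diff_right)
  then show ?thesis by (simp add: cinner_eq_zero_iff)
qed

lemma cinner_ext_dense:
  assumes D: "closure D = UNIV" and eq: "\<And>z. z \<in> D \<Longrightarrow> cinner z x = cinner z (y::'a::complex_hilbert)"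
  shows "x = y"
proof (rule cinner_ext)
  fix z
  obtain f where f: "\<And>n. f n \<in> D" "f \<longlonglongrightarrow> z"
    using D closure_sequential[of z D] by auto
  have "(\<lambda>n. cinner (f n) x) \<longlonglongrightarrow> cinner z x" "(\<lambda>n. cinner (f n) y) \<longlonglongrightarrow> cinner z y"
    by (intro tendsto_intros f)+
  then show "cinner z x = cinner z y"
    using eq f(1) by (auto intro: LIMSEQ_unique)
qed

text \<open>The projection theorem: a point of \<open>V\<close> nearest to \<open>y\<close> exists
  by completeness, and the remainder is orthogonal to \<open>V\<close>, hence zero.\<close>

lemma closed_csubspace_orthogonal:
  fixes V :: "'a::complex_hilbert set"
  assumes V: "csubspace V" "closed V" and perp: "\<And>z. (\<And>v. v \<in> V \<Longrightarrow> cinner v z = 0) \<Longrightarrow> z = 0"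
  shows "V = UNIV"
proof -
  have "y \<in> V" for y
  proof -
    define d where "d = (INF v\<in>V. (norm (y - v))\<^sup>2)"
    have bdd: "bdd_below ((\<lambda>v. (norm (y - v))\<^sup>2) ` V)"
      by (rule bdd_belowI[of _ 0]) auto
    have dle: "d \<le> (norm (y - v))\<^sup>2" if "v \<in> V" for v
      unfolding d_def by (rule cINF_lower[OF bdd that])
    have "\<exists>v\<in>V. (norm (y - v))\<^sup>2 < d + 1 / real (Suc n)" for n
    proof (rule ccontr)
      assume "\<not> ?thesis"
      then have "d + 1 / real (Suc n) \<le> d"
        unfolding d_def using csubspaceD(1)[OF V(1)]
        by (intro cINF_greatest) (auto simp: not_less d_def)
      then show False by (simp add: divide_le_0_iff)
    qed
    then obtain f where f: "\<And>n. f n \<in> V" "\<And>n. (norm (y - f n))\<^sup>2 < d + 1 / real (Suc n)"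
      by metis
    have key: "(norm (f m - f n))\<^sup>2 \<le> 2 / real (Suc m) + 2 / real (Suc n)" for m n
    proof -
      \<comment> \<open>The midpoint lies in \<open>V\<close>, so its squared distance to
        \<open>y\<close> is at least \<open>d\<close>; the parallelogram law then forces
        \<open>f m\<close> and \<open>f n\<close> together.\<close>
      define w where "w = scaleR (1/2) (f m + f n)"
      have wV: "w \<in> V"
        unfolding w_def scaleR_scaleC using f V(1) by (auto intro: csubspaceD)
      have e: "(y - f m) + (y - f n) = scaleR 2 (y - w)"
        by (simp add: w_def algebra_simps scaleR_2)
      have "(norm (f m - f n))\<^sup>2 + (norm ((y - f m) + (y - f n)))\<^sup>2
          = 2 * (norm (y - f m))\<^sup>2 + 2 * (norm (y - f n))\<^sup>2"
        using norm_diff_sq[of "y - f n" "y - f m"] norm_add_sq[of "y - f n" "y - f m"]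
        by (simp add: algebra_simps)
      moreover have "(norm ((y - f m) + (y - f n)))\<^sup>2 = 4 * (norm (y - w))\<^sup>2"
        unfolding e by (simp add: power_mult_distrib)
      ultimately show ?thesis
        using f(2)[of m] f(2)[of n] dle[OF wV] by (simp add: algebra_simps)
    qed
    have "Cauchy f"
    proof (rule metric_CauchyI)
      fix e :: real assume e: "e > 0"
      obtain N where N: "4 / real (Suc N) < e\<^sup>2"
        using reals_Archimedean[of "e\<^sup>2 / 4"] e by (auto simp: field_simps)
      have "dist (f m) (f n) < e" if "m \<ge> N" "n \<ge> N" for m n
      proof -
        have "2 / real (Suc m) \<le> 2 / real (Suc N)" "2 / real (Suc n) \<le> 2 / real (Suc N)"
          using that by (auto intro!: divide_left_mono)
        then have "(norm (f m - f n))\<^sup>2 < e\<^sup>2" using key[of m n] N by simp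
        then show ?thesis using e by (simp add: dist_norm power2_less_imp_less)
      qed
      then show "\<exists>M. \<forall>m\<ge>M. \<forall>n\<ge>M. dist (f m) (f n) < e" by blast
    qed
    then obtain v where v: "f \<longlonglongrightarrow> v" using Cauchy_convergent convergent_def by blast
    have vV: "v \<in> V" using closed_sequentially[OF V(2)] f(1) v by blast
    have vd: "(norm (y - v))\<^sup>2 = d"
    proof (rule antisym[OF _ dle[OF vV]])
      have 1: "(\<lambda>n. (norm (y - f n))\<^sup>2) \<longlonglongrightarrow> (norm (y - v))\<^sup>2"
        by (intro tendsto_intros v)
      have 2: "(\<lambda>n. d + 1 / real (Suc n)) \<longlonglongrightarrow> d + 0"
        by (intro tendsto_intros LIMSEQ_inverse_real_of_nat[unfolded inverse_eq_divide])
      show "(norm (y - v))\<^sup>2 \<le> d"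
        using LIMSEQ_le[OF 1 2] f(2) by (auto intro: less_imp_le)
    qed
    have orth: "cinner w (y - v) = 0" if w: "w \<in> V" for w
    proof (rule ccontr)
      assume ne: "cinner w (y - v) \<noteq> 0"
      define p where "p = cinner w (y - v)"
      have w0: "norm w > 0" using ne by auto
      \<comment> \<open>Coefficient of the projection of \<open>y - v\<close> onto \<open>w\<close>:
        moving \<open>v\<close> along it would push the squared distance below the infimum
        \<open>d\<close> by |p|^2 / |w|^2.\<close>
      define c where "c = p / complex_of_real ((norm w)\<^sup>2)"
      have "v + scaleC c w \<in> V" using w vV V(1) by (auto intro: csubspaceD)
      from dle[OF this] have "d \<le> (norm ((y - v) - scaleC c w))\<^sup>2" by (simp add: algebra_simps)
      also have "\<dots> = d + (cmod c * norm w)\<^sup>2 - 2 * Re (cinner (y - v) (scaleC c w))"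
        by (simp add: norm_diff_sq[of "y - v"] vd norm_scaleC)
      also have "cinner (y - v) (scaleC c w) = c * cnj p"
        by (simp add: cinner_scaleC_right p_def cinner_commute[of "y - v" w])
      also have "c * cnj p = complex_of_real ((cmod p)\<^sup>2 / (norm w)\<^sup>2)"
        unfolding c_def by (simp flip: complex_norm_square)
      also have "(cmod c * norm w)\<^sup>2 = (cmod p)\<^sup>2 / (norm w)\<^sup>2"
        using w0 by (simp add: c_def norm_divide norm_mult power2_eq_square)
      finally have "(cmod p)\<^sup>2 / (norm w)\<^sup>2 \<le> 0" by simp
      then show False using ne w0 by (simp add: p_def divide_le_0_iff)
    qed
    have "y - v = 0" by (rule perp) (rule orth)
    then show "y \<in> V" using vV by simp
  qed
  then show ?thesis by auto
qed

section \<open>Bounded operators and adjoint pairs\<close>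

definition bop :: "('a::complex_hilbert \<Rightarrow> 'a) \<Rightarrow> bool" where
  "bop F \<longleftrightarrow> (\<forall>x y. F (x + y) = F x + F y) \<and> (\<forall>c x. F (scaleC c x) = scaleC c (F x))
     \<and> (\<exists>C. \<forall>x. norm (F x) \<le> C * norm x)"

lemma bop_add: "bop F \<Longrightarrow> F (x + y) = F x + F y"
  and bop_scaleC: "bop F \<Longrightarrow> F (scaleC c x) = scaleC c (F x)"
  unfolding bop_def by auto

lemma bop_zero: "bop F \<Longrightarrow> F 0 = 0"
  using bop_scaleC[of F 0 0] by simp

lemma bop_minus: "bop F \<Longrightarrow> F (- x) = - F x"
  using bop_scaleC[of F "-1" x] by (simp add: scaleC_minus_left scaleC_one)

lemma bop_diff: "bop F \<Longrightarrow> F (x - y) = F x - F y"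
  using bop_add[of F x "-y"] by (simp add: bop_minus)

lemma bop_bounded_linear: "bop F \<Longrightarrow> bounded_linear F"
proof -
  assume F: "bop F"
  then obtain C where "\<forall>x. norm (F x) \<le> C * norm x" unfolding bop_def by auto
  then show ?thesis
    using F by (intro bounded_linear_intro[of F C]) (auto simp: bop_add bop_scaleC scaleR_scaleC mult.commute)
qed

lemma bop_tendsto: "bop F \<Longrightarrow> (f \<longlongrightarrow> x) net \<Longrightarrow> ((\<lambda>n. F (f n)) \<longlongrightarrow> F x) net"
  using bounded_linear.tendsto[OF bop_bounded_linear] .

lemma bop_sum: "bop F \<Longrightarrow> F (\<Sum>i\<in>I. f i) = (\<Sum>i\<in>I. F (f i))"
  using linear_sum[OF bounded_linear.linear[OF bop_bounded_linear]] .

lemma bop_id [simp]: "bop id" "bop (\<lambda>x. x)"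
  unfolding bop_def by (auto intro: exI[of _ 1])

lemma bop_comp: assumes "bop F" "bop G" shows "bop (\<lambda>x. F (G x))"
proof -
  have "bounded_linear (\<lambda>x. F (G x))"
    using bounded_linear_compose[OF bop_bounded_linear[OF assms(1)] bop_bounded_linear[OF assms(2)]] .
  then obtain C where "\<And>x. norm (F (G x)) \<le> norm x * C"
    using bounded_linear.bounded by blast
  then show ?thesis
    using assms unfolding bop_def[of "\<lambda>x. F (G x)"]
    by (auto simp: bop_add bop_scaleC intro!: exI[of _ C] simp: mult.commute)
qed

lemma bop_lin_comb: assumes "bop F" "bop G" shows "bop (\<lambda>x. scaleC a (F x) + scaleC b (G x))"
proof -
  obtain C D where "\<And>x. norm (F x) \<le> C * norm x" "\<And>x. norm (G x) \<le> D * norm x"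
    using assms unfolding bop_def by metis
  then have "norm (scaleC a (F x) + scaleC b (G x)) \<le> (cmod a * C + cmod b * D) * norm x" for x
    by (intro order.trans[OF norm_triangle_ineq])
       (simp add: norm_scaleC distrib_right mult.assoc add_mono mult_left_mono)
  then show ?thesis
    using assms unfolding bop_def[of "\<lambda>x. scaleC a (F x) + scaleC b (G x)"]
    by (auto simp: bop_add bop_scaleC scaleC_add_right scaleC_scaleC ac_simps
        intro!: exI[of _ "cmod a * C + cmod b * D"])
qed

lemma bop_pow: "bop F \<Longrightarrow> bop (F ^^ n)"
  by (induction n) (simp_all add: bop_comp comp_def)

text \<open>Polarization for bounded operators. Integrals against scalar spectral measures only see
  diagonal values, so this is how identities of measures become identities of operators.\<close>

lemma bop_eqI:
  assumes "bop F" "bop G" "\<And>x. cinner x (F x) = cinner x (G x)"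
  shows "F = G"
proof
  fix x
  show "F x = G x"
  proof (rule cinner_ext)
    fix z show "cinner z (F x) = cinner z (G x)"
      by (rule form_eq_imp_cinner_eq[of UNIV F G, OF csubspace_UNIV]) (simp_all add: assms bop_add bop_scaleC)
  qed
qed

text \<open>A relation, so that no adjoint has to be constructed: an explicit candidate is at hand
  wherever one is used.\<close>

definition adj :: "('a::complex_hilbert \<Rightarrow> 'a) \<Rightarrow> ('a \<Rightarrow> 'a) \<Rightarrow> bool" where
  "adj F F' \<longleftrightarrow> (\<forall>x y. cinner (F x) y = cinner x (F' y))"

lemma adjD: "adj F F' \<Longrightarrow> cinner (F x) y = cinner x (F' y)"
  unfolding adj_def by auto

lemma adj_sym: "adj F F' \<Longrightarrow> adj F' F"
  unfolding adj_def
proof (intro allI)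
  fix x y
  assume "\<forall>x y. cinner (F x) y = cinner x (F' y)"
  then have "cnj (cinner (F y) x) = cnj (cinner y (F' x))" by simp
  then show "cinner (F' x) y = cinner x (F y)"
    by (simp only: cinner_commute[symmetric])
qed

section \<open>Functional calculus from prescribed moments\<close>

definition bounded_borel :: "(real \<Rightarrow> complex) \<Rightarrow> bool" where
  "bounded_borel f \<longleftrightarrow> f \<in> borel_measurable borel \<and> (\<exists>C. \<forall>s. cmod (f s) \<le> C)"

lemma bounded_borelI:
  "f \<in> borel_measurable borel \<Longrightarrow> (\<And>s. cmod (f s) \<le> C) \<Longrightarrow> bounded_borel f"
  unfolding bounded_borel_def by blast

lemma bounded_borel_measurable [measurable_dest]: "bounded_borel f \<Longrightarrow> f \<in> borel_measurable borel"
  unfolding bounded_borel_def by blast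

lemma bounded_borelE:
  assumes "bounded_borel f"
  obtains C where "C \<ge> 0" "\<And>s. cmod (f s) \<le> C"
proof -
  from assms obtain C where C: "\<And>s. cmod (f s) \<le> C" unfolding bounded_borel_def by blast
  from order.trans[OF norm_ge_zero C[of 0]] C show thesis using that by blast
qed

lemma bounded_borel_const [intro, simp]: "bounded_borel (\<lambda>_. c)"
  unfolding bounded_borel_def by auto

lemma bounded_borel_mult [intro]:
  assumes "bounded_borel f" "bounded_borel g"
  shows "bounded_borel (\<lambda>s. f s * g s)"
proof -
  obtain C where C: "C \<ge> 0" "\<And>s. cmod (f s) \<le> C"
    using bounded_borelE[OF assms(1)] by blast
  obtain D where D: "\<And>s. cmod (g s) \<le> D"
    using bounded_borelE[OF assms(2)] by blast
  have "cmod (f s * g s) \<le> C * D" for s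
    unfolding norm_mult using C D by (intro mult_mono) auto
  then show ?thesis
    using assms by (intro bounded_borelI[of _ "C * D"]) (auto dest!: bounded_borel_measurable)
qed

lemma bounded_borel_add [intro]:
  assumes "bounded_borel f" "bounded_borel g"
  shows "bounded_borel (\<lambda>s. f s + g s)"
proof -
  obtain C where C: "\<And>s. cmod (f s) \<le> C"
    using bounded_borelE[OF assms(1)] by blast
  obtain D where D: "\<And>s. cmod (g s) \<le> D"
    using bounded_borelE[OF assms(2)] by blast
  have "cmod (f s + g s) \<le> C + D" for s
    using norm_triangle_mono[OF C D] .
  then show ?thesis
    using assms by (intro bounded_borelI[of _ "C + D"]) (auto dest!: bounded_borel_measurable)
qed

lemma bounded_borel_cnj [intro]:
  assumes "bounded_borel f"
  shows "bounded_borel (\<lambda>s. cnj (f s))"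
proof -
  have [measurable]: "f \<in> borel_measurable borel" using assms by (rule bounded_borel_measurable)
  have "(\<lambda>s. cnj (f s)) \<in> borel_measurable borel"
    by (rule borel_measurable_continuous_on[where f = cnj]) (auto intro: continuous_intros)
  then show ?thesis
    using assms unfolding bounded_borel_def by simp
qed

lemma bounded_borel_diff [intro]:
  assumes "bounded_borel f" "bounded_borel g"
  shows "bounded_borel (\<lambda>s. f s - g s)"
  using bounded_borel_add[OF assms(1) bounded_borel_mult[OF bounded_borel_const[of "-1"] assms(2)]] by simp

lemma bounded_borel_indicator [intro]: "S \<in> sets borel \<Longrightarrow> bounded_borel (indicator S)"
  by (rule bounded_borelI[of _ 1]) (auto simp: indicator_def)

lemma bounded_borel_integrable:
  assumes "finite_measure M" "sets M = sets borel" "bounded_borel f"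
  shows "integrable M f"
proof -
  interpret finite_measure M by fact
  obtain C where "\<And>s. cmod (f s) \<le> C" using bounded_borelE[OF assms(3)] by blast
  moreover have "f \<in> borel_measurable M"
    using bounded_borel_measurable[OF assms(3)] assms(2) by (simp cong: measurable_cong_sets)
  ultimately show ?thesis
    by (intro integrable_const_bound[of _ C]) auto
qed

lemma bounded_borel_integral_tendsto:
  assumes M: "finite_measure M" "sets M = sets borel"
    and f: "\<And>n. bounded_borel (f n)" and bound: "\<And>n s. cmod (f n s) \<le> C"
    and lim: "\<And>s. (\<lambda>n. f n s) \<longlonglongrightarrow> g s"
  shows "(\<lambda>n. \<integral>s. f n s \<partial>M) \<longlonglongrightarrow> (\<integral>s. g s \<partial>M)" and "bounded_borel g"
proof -
  interpret finite_measure M by fact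
  have g: "g \<in> borel_measurable borel"
    using bounded_borel_measurable[OF f] lim by (rule borel_measurable_LIMSEQ_metric)
  have gC: "cmod (g s) \<le> C" for s
    using Lim_bounded[OF tendsto_norm[OF lim[of s]], of 0] bound by auto
  show "bounded_borel g" using g gC by (rule bounded_borelI)
  have meas: "h \<in> borel_measurable M" if "h \<in> borel_measurable borel" for h :: "real \<Rightarrow> complex"
    using that M(2) by (simp cong: measurable_cong_sets)
  show "(\<lambda>n. \<integral>s. f n s \<partial>M) \<longlonglongrightarrow> (\<integral>s. g s \<partial>M)"
  proof (rule integral_dominated_convergence[where w = "\<lambda>_. C"])
    show "AE x in M. (\<lambda>n. f n x) \<longlonglongrightarrow> g x" "\<And>n. AE x in M. norm (f n x) \<le> C"
      using lim bound by auto
  qed (auto intro!: meas g bounded_borel_measurable f)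
qed

text \<open>Moments of the measures in \<open>K x\<close> against the \<open>*\<close>-closed multiplicative family \<open>gens\<close>
  are prescribed by operators. The multipliers of the set of all pairs \<open>(w, W)\<close> having this
  property form an algebra which is stable under bounded pointwise limits, so that the
  correspondence extends from \<open>gens\<close> to a functional calculus.\<close>

locale op_calculus =
  fixes gens :: "((real \<Rightarrow> complex) \<times> ('a::complex_hilbert \<Rightarrow> 'a)) set"
    and K :: "'a \<Rightarrow> real measure set"
  assumes K_nonempty: "K x \<noteq> {}"
    and K_finite: "M \<in> K x \<Longrightarrow> finite_measure M"
    and K_sets: "M \<in> K x \<Longrightarrow> sets M = sets borel"
    and gens_one: "(\<lambda>_. 1, \<lambda>x. x) \<in> gens"
    and gens_mult: "(e, V) \<in> gens \<Longrightarrow> (e', V') \<in> gens \<Longrightarrow> (\<lambda>s. e s * e' s, \<lambda>x. V (V' x)) \<in> gens"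
    and gens_adj: "(e, V) \<in> gens \<Longrightarrow> \<exists>V'. (\<lambda>s. cnj (e s), V') \<in> gens \<and> adj V V'"
    and gens_bounded: "(e, V) \<in> gens \<Longrightarrow> bounded_borel e"
    and gens_bop: "(e, V) \<in> gens \<Longrightarrow> bop V"
    and gens_repr: "(e, V) \<in> gens \<Longrightarrow> M \<in> K x \<Longrightarrow> (\<integral>s. e s \<partial>M) = cinner x (V x)"
begin

definition test :: "(real \<Rightarrow> complex) \<Rightarrow> ('a \<Rightarrow> 'a) \<Rightarrow> bool" where
  "test w W \<longleftrightarrow> bounded_borel w \<and> bop W \<and>
     (\<forall>e V x M. (e, V) \<in> gens \<longrightarrow> M \<in> K x \<longrightarrow> (\<integral>s. w s * e s \<partial>M) = cinner x (W (V x)))"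

text \<open>Matching moments, as in \<open>test\<close>, is not visibly stable under products.
  Multipliers of \<open>test\<close> are stable by construction, and they match moments themselves
  because the identity generator is a test pair (\<open>multiplier_repr\<close>).\<close>

definition multiplier :: "(real \<Rightarrow> complex) \<Rightarrow> ('a \<Rightarrow> 'a) \<Rightarrow> bool" where
  "multiplier f F \<longleftrightarrow> bounded_borel f \<and> bop F \<and>
     (\<forall>w W. test w W \<longrightarrow> test (\<lambda>s. w s * f s) (\<lambda>x. W (F x)))"

text \<open>The condition on the conjugate provides an adjoint inside the same calculus; this is
  what turns |f|^2 into the norm identity \<open>good_norm\<close>.\<close>

definition good :: "(real \<Rightarrow> complex) \<Rightarrow> ('a \<Rightarrow> 'a) \<Rightarrow> bool" where
  "good f F \<longleftrightarrow> multiplier f F \<and> (\<exists>F'. adj F F' \<and> multiplier (\<lambda>s. cnj (f s)) F')"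

lemma integrable: "M \<in> K x \<Longrightarrow> bounded_borel f \<Longrightarrow> integrable M f"
  using bounded_borel_integrable K_finite K_sets by blast

lemma measure_K: "M \<in> K x \<Longrightarrow> measure M (space M) = (norm x)\<^sup>2"
  using gens_repr[OF gens_one, of M x]
  by (simp add: cinner_self_norm scaleR_conv_of_real del: of_real_power)

lemma
  assumes "test w W"
  shows test_bounded: "bounded_borel w" and test_bop: "bop W"
    and test_repr: "(e, V) \<in> gens \<Longrightarrow> M \<in> K x \<Longrightarrow> (\<integral>s. w s * e s \<partial>M) = cinner x (W (V x))"
  using assms unfolding test_def by auto

lemma
  assumes "multiplier f F"
  shows multiplier_bounded: "bounded_borel f" and multiplier_bop: "bop F"
    and multiplier_test: "test w W \<Longrightarrow> test (\<lambda>s. w s * f s) (\<lambda>x. W (F x))"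
  using assms unfolding multiplier_def by auto

lemma test_gen: "(e, V) \<in> gens \<Longrightarrow> test e V"
  unfolding test_def using gens_bounded gens_bop gens_repr[OF gens_mult] by auto

lemma multiplier_gen: "(e, V) \<in> gens \<Longrightarrow> multiplier e V"
  unfolding multiplier_def
proof (intro conjI allI impI)
  fix w W assume e: "(e, V) \<in> gens" and W: "test w W"
  show "test (\<lambda>s. w s * e s) (\<lambda>x. W (V x))"
    unfolding test_def
  proof (intro conjI allI impI)
    fix e' V' x M assume e': "(e', V') \<in> gens" and M: "M \<in> K x"
    show "(\<integral>s. w s * e s * e' s \<partial>M) = cinner x (W (V (V' x)))"
      using W gens_mult[OF e e'] M unfolding test_def by (auto simp: mult.assoc)
  qed (use test_bounded[OF W] test_bop[OF W] gens_bounded[OF e] gens_bop[OF e] in \<open>auto intro: bop_comp\<close>)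
qed (use gens_bounded gens_bop in auto)

lemma multiplier_lin_comb:
  assumes "multiplier f F" "multiplier g G"
  shows "multiplier (\<lambda>s. a * f s + b * g s) (\<lambda>x. scaleC a (F x) + scaleC b (G x))"
  unfolding multiplier_def
proof (intro conjI allI impI)
  fix w W assume w: "test w W"
  have 1: "test (\<lambda>s. w s * f s) (\<lambda>x. W (F x))" "test (\<lambda>s. w s * g s) (\<lambda>x. W (G x))"
    using multiplier_test[OF assms(1) w] multiplier_test[OF assms(2) w] .
  note bds = test_bounded[OF w] multiplier_bounded[OF assms(1)] multiplier_bounded[OF assms(2)]
  show "test (\<lambda>s. w s * (a * f s + b * g s)) (\<lambda>x. W (scaleC a (F x) + scaleC b (G x)))"
    unfolding test_def
  proof (intro conjI allI impI)
    fix e V x M assume e: "(e, V) \<in> gens" and M: "M \<in> K x"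
    have i: "integrable M (\<lambda>s. a * (w s * f s * e s))" "integrable M (\<lambda>s. b * (w s * g s * e s))"
      by (intro integrable[OF M] bounded_borel_mult bounded_borel_const bds gens_bounded[OF e])+
    have "(\<integral>s. w s * (a * f s + b * g s) * e s \<partial>M)
        = (\<integral>s. a * (w s * f s * e s) + b * (w s * g s * e s) \<partial>M)"
      by (simp add: algebra_simps)
    also have "\<dots> = a * (\<integral>s. w s * f s * e s \<partial>M) + b * (\<integral>s. w s * g s * e s \<partial>M)"
      using i by simp
    also have "\<dots> = cinner x (W (scaleC a (F (V x)) + scaleC b (G (V x))))"
      using test_repr[OF 1(1) e M] test_repr[OF 1(2) e M]
      by (simp add: bop_add[OF test_bop[OF w]] bop_scaleC[OF test_bop[OF w]] cinner_simps)
    finally show "(\<integral>s. w s * (a * f s + b * g s) * e s \<partial>M)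
        = cinner x (W (scaleC a (F (V x)) + scaleC b (G (V x))))" .
  next
    show "bounded_borel (\<lambda>s. w s * (a * f s + b * g s))"
      by (intro bounded_borel_mult bounded_borel_add bounded_borel_const bds)
    show "bop (\<lambda>x. W (scaleC a (F x) + scaleC b (G x)))"
      by (intro bop_comp[OF test_bop[OF w]] bop_lin_comb multiplier_bop[OF assms(1)] multiplier_bop[OF assms(2)])
  qed
next
  show "bounded_borel (\<lambda>s. a * f s + b * g s)"
    by (intro bounded_borel_mult bounded_borel_add bounded_borel_const multiplier_bounded[OF assms(1)]
        multiplier_bounded[OF assms(2)])
  show "bop (\<lambda>x. scaleC a (F x) + scaleC b (G x))"
    by (intro bop_lin_comb multiplier_bop[OF assms(1)] multiplier_bop[OF assms(2)])
qed

lemma multiplier_mult: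
  assumes "multiplier f F" "multiplier g G"
  shows "multiplier (\<lambda>s. f s * g s) (\<lambda>x. F (G x))"
  unfolding multiplier_def
proof (intro conjI allI impI)
  fix w W assume "test w W"
  then have "test (\<lambda>s. w s * f s * g s) (\<lambda>x. W (F (G x)))"
    using assms unfolding multiplier_def by blast
  then show "test (\<lambda>s. w s * (f s * g s)) (\<lambda>x. W (F (G x)))"
    by (simp add: mult.assoc)
next
  show "bounded_borel (\<lambda>s. f s * g s)"
    by (intro bounded_borel_mult assms[THEN multiplier_bounded])
  show "bop (\<lambda>x. F (G x))"
    by (rule bop_comp[OF assms[THEN multiplier_bop]])
qed

lemma multiplier_repr:
  assumes "multiplier f F" "M \<in> K x"
  shows "(\<integral>s. f s \<partial>M) = cinner x (F x)"
proof -
  have "test (\<lambda>s. 1 * f s) (\<lambda>x. F x)"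
    using assms(1) test_gen[OF gens_one] unfolding multiplier_def by blast
  then show ?thesis
    using gens_one assms(2) unfolding test_def by fastforce
qed

text \<open>Dominated convergence handles the integrals, strong convergence the operators. Existence
  of the strong limit is assumed here and established in \<open>good_limit\<close>.\<close>

lemma multiplier_limit:
  assumes f: "\<And>n. multiplier (f n) (F n)" and bound: "\<And>n s. cmod (f n s) \<le> C"
    and lim: "\<And>s. (\<lambda>n. f n s) \<longlonglongrightarrow> g s" and G: "bop G" "\<And>x. (\<lambda>n. F n x) \<longlonglongrightarrow> G x"
  shows "multiplier g G"
  unfolding multiplier_def
proof (intro conjI allI impI)
  have fb: "bounded_borel (f n)" for n using f unfolding multiplier_def by blast
  obtain M0 where M0: "M0 \<in> K 0" using K_nonempty by blast
  show g: "bounded_borel g"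
    using bounded_borel_integral_tendsto(2)[OF K_finite[OF M0] K_sets[OF M0] fb bound lim] .
  fix w W assume w: "test w W"
  have wb: "bounded_borel w" and W: "bop W" using w unfolding test_def by auto
  show "test (\<lambda>s. w s * g s) (\<lambda>x. W (G x))"
    unfolding test_def
  proof (intro conjI allI impI)
    fix e V x M assume e: "(e, V) \<in> gens" and M: "M \<in> K x"
    obtain D where D: "D \<ge> 0" "\<And>s. cmod (w s * e s) \<le> D"
      using bounded_borelE[OF bounded_borel_mult[OF wb gens_bounded[OF e]]] by blast
    have "(\<lambda>n. \<integral>s. w s * f n s * e s \<partial>M) \<longlonglongrightarrow> (\<integral>s. w s * g s * e s \<partial>M)"
    proof (rule bounded_borel_integral_tendsto(1)[OF K_finite[OF M] K_sets[OF M]])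
      fix n s
      show "bounded_borel (\<lambda>s. w s * f n s * e s)"
        by (intro bounded_borel_mult wb fb gens_bounded[OF e])
      have "cmod (w s * e s) * cmod (f n s) \<le> D * C"
        using D bound by (intro mult_mono) auto
      then show "cmod (w s * f n s * e s) \<le> D * C"
        by (simp add: norm_mult mult_ac)
      show "(\<lambda>n. w s * f n s * e s) \<longlonglongrightarrow> w s * g s * e s"
        by (intro tendsto_intros lim)
    qed
    moreover have "(\<integral>s. w s * f n s * e s \<partial>M) = cinner x (W (F n (V x)))" for n
      by (rule test_repr[OF multiplier_test[OF f w] e M])
    moreover have "(\<lambda>n. cinner x (W (F n (V x)))) \<longlonglongrightarrow> cinner x (W (G (V x)))"
      by (intro tendsto_intros bop_tendsto[OF W] G)
    ultimately show "(\<integral>s. w s * g s * e s \<partial>M) = cinner x (W (G (V x)))"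
      using LIMSEQ_unique by auto
  next
    show "bounded_borel (\<lambda>s. w s * g s)" by (intro bounded_borel_mult wb g)
    show "bop (\<lambda>x. W (G x))" by (rule bop_comp[OF W G(1)])
  qed
qed (use G in auto)

lemma good_bounded: "good f F \<Longrightarrow> bounded_borel f" and good_bop: "good f F \<Longrightarrow> bop F"
  unfolding good_def multiplier_def by auto

lemma good_gen: "(e, V) \<in> gens \<Longrightarrow> good e V"
  unfolding good_def using multiplier_gen gens_adj by blast

lemma good_lin_comb:
  assumes "good f F" "good g G"
  shows "good (\<lambda>s. a * f s + b * g s) (\<lambda>x. scaleC a (F x) + scaleC b (G x))"
proof -
  obtain F' G' where "adj F F'" "adj G G'" "multiplier (\<lambda>s. cnj (f s)) F'" "multiplier (\<lambda>s. cnj (g s)) G'"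
    using assms unfolding good_def by blast
  then show ?thesis
    using assms multiplier_lin_comb unfolding good_def
    by (auto intro!: exI[of _ "\<lambda>x. scaleC (cnj a) (F' x) + scaleC (cnj b) (G' x)"]
        simp: adj_def cinner_simps)
qed

lemma good_mult:
  assumes "good f F" "good g G"
  shows "good (\<lambda>s. f s * g s) (\<lambda>x. F (G x))"
proof -
  obtain F' G' where F': "adj F F'" "multiplier (\<lambda>s. cnj (f s)) F'"
    and G': "adj G G'" "multiplier (\<lambda>s. cnj (g s)) G'"
    using assms unfolding good_def by blast
  have "multiplier (\<lambda>s. cnj (f s * g s)) (\<lambda>x. G' (F' x))"
    using multiplier_mult[OF G'(2) F'(2)] by (simp add: mult.commute)
  moreover have "adj (\<lambda>x. F (G x)) (\<lambda>x. G' (F' x))"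
    using F' G' unfolding adj_def by simp
  ultimately show ?thesis
    using assms multiplier_mult unfolding good_def by blast
qed

lemma good_cnj:
  assumes "good f F"
  obtains F' where "adj F F'" "good (\<lambda>s. cnj (f s)) F'"
proof -
  from assms obtain F' where F': "adj F F'" "multiplier (\<lambda>s. cnj (f s)) F'" and f: "multiplier f F"
    unfolding good_def by blast
  have "good (\<lambda>s. cnj (f s)) F'"
    unfolding good_def using F' f by (auto intro!: exI[of _ F] adj_sym)
  then show thesis using that F' by blast
qed

lemma good_repr: "good f F \<Longrightarrow> M \<in> K x \<Longrightarrow> (\<integral>s. f s \<partial>M) = cinner x (F x)"
  unfolding good_def using multiplier_repr by blast

lemma good_unique: "good f F \<Longrightarrow> good f G \<Longrightarrow> F = G"
proof (rule bop_eqI)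
  assume FG: "good f F" "good f G"
  fix x
  obtain M where M: "M \<in> K x" using K_nonempty by blast
  show "cinner x (F x) = cinner x (G x)"
    using good_repr[OF FG(1) M] good_repr[OF FG(2) M] by simp
qed (auto dest: good_bop)

text \<open>The L2 isometry: the same \<open>F'\<close> is the adjoint of \<open>F\<close> and the
  operator of the conjugate function, so |f|^2 corresponds to \<open>F'\<close> after
  \<open>F\<close>.\<close>

lemma good_norm:
  assumes f: "good f F" and M: "M \<in> K x"
  shows "(\<integral>s. (cmod (f s))\<^sup>2 \<partial>M) = (norm (F x))\<^sup>2"
proof -
  obtain F' where F': "adj F F'" "good (\<lambda>s. cnj (f s)) F'" using good_cnj[OF f] .
  have "complex_of_real (\<integral>s. (cmod (f s))\<^sup>2 \<partial>M) = (\<integral>s. cnj (f s) * f s \<partial>M)"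
    by (subst integral_complex_of_real[symmetric]) (simp only: complex_norm_square mult.commute)
  also have "\<dots> = cinner x (F' (F x))"
    using good_repr[OF good_mult[OF F'(2) f] M] .
  also have "\<dots> = complex_of_real ((norm (F x))\<^sup>2)"
    using adjD[OF F'(1), of x "F x"] by (simp only: cinner_self_norm[symmetric])
  finally show ?thesis by (simp only: of_real_eq_iff)
qed

lemma good_norm_le:
  assumes f: "good f F" and C: "\<And>s. cmod (f s) \<le> C"
  shows "norm (F x) \<le> C * norm x"
proof -
  have C0: "0 \<le> C" using order.trans[OF norm_ge_zero C] .
  obtain M where M: "M \<in> K x" using K_nonempty by blast
  interpret finite_measure M using K_finite[OF M] .
  have "(norm (F x))\<^sup>2 = (\<integral>s. (cmod (f s))\<^sup>2 \<partial>M)" using good_norm[OF f M] ..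
  also have "\<dots> \<le> (\<integral>s. C\<^sup>2 \<partial>M)"
  proof (rule integral_mono_AE')
    show "AE s in M. (cmod (f s))\<^sup>2 \<le> C\<^sup>2" using C by (auto intro!: power_mono)
  qed auto
  also have "\<dots> = (C * norm x)\<^sup>2"
    using measure_K[OF M] by (simp add: power_mult_distrib)
  finally show ?thesis
    by (rule power2_le_imp_le) (simp add: C0)
qed

text \<open>Bounded pointwise convergence is convergence in L2 of each finite measure in
  \<open>K x\<close>, and by the isometry \<open>good_norm\<close> the vectors \<open>F n x\<close>
  then form a Cauchy sequence.\<close>

lemma good_limit:
  assumes f: "\<And>n. good (f n) (F n)" and bound: "\<And>n s. cmod (f n s) \<le> C"
    and lim: "\<And>s. (\<lambda>n. f n s) \<longlonglongrightarrow> g s"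
  obtains G where "good g G" "\<And>x. (\<lambda>n. F n x) \<longlonglongrightarrow> G x"
proof -
  have conv: "\<exists>H. bop H \<and> (\<forall>x. (\<lambda>n. G n x) \<longlonglongrightarrow> H x)"
    if g: "\<And>n. good (g n) (G n)" and bound: "\<And>n s. cmod (g n s) \<le> C"
      and lim: "\<And>s. (\<lambda>n. g n s) \<longlonglongrightarrow> h s" for g G h
  proof -
    have gb: "bounded_borel (g n)" for n using good_bounded[OF g] .
    have "\<exists>y. (\<lambda>n. G n x) \<longlonglongrightarrow> y" for x
    proof -
      obtain M where M: "M \<in> K x" using K_nonempty by blast
      have hb: "bounded_borel h"
        using bounded_borel_integral_tendsto(2)[OF K_finite[OF M] K_sets[OF M] gb bound lim] .
      have hC: "cmod (h s) \<le> C" for s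
        using Lim_bounded[OF tendsto_norm[OF lim[of s]], of 0] bound by auto
      \<comment> \<open>This is |g n - h|^2, written as a complex product so that the closure rules
        for bounded Borel functions apply.\<close>
      define u where "u n s = cnj (g n s - h s) * (g n s - h s)" for n s
      have ub: "bounded_borel (u n)" for n
        unfolding u_def by (intro bounded_borel_mult bounded_borel_cnj bounded_borel_diff gb hb)
      have un: "u n s = complex_of_real ((cmod (g n s - h s))\<^sup>2)" for n s
        unfolding u_def by (simp only: complex_norm_square mult.commute)
      have ulim: "(\<lambda>n. \<integral>s. u n s \<partial>M) \<longlonglongrightarrow> (\<integral>s. 0 \<partial>M)"
      proof (rule bounded_borel_integral_tendsto(1)[OF K_finite[OF M] K_sets[OF M] ub])
        fix n s
        have "cmod (g n s - h s) \<le> 2 * C"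
          using norm_triangle_ineq4[of "g n s" "h s"] bound[of n s] hC[of s] by simp
        then show "cmod (u n s) \<le> (2 * C)\<^sup>2"
          unfolding un norm_of_real abs_power2 by (intro power_mono) auto
        have "(\<lambda>n. cnj (g n s - h s) * (g n s - h s)) \<longlonglongrightarrow> cnj (h s - h s) * (h s - h s)"
          by (intro tendsto_intros lim)
        then show "(\<lambda>n. u n s) \<longlonglongrightarrow> 0" unfolding u_def by simp
      qed
      define a where "a n = (\<integral>s. (cmod (g n s - h s))\<^sup>2 \<partial>M)" for n
      have a_cmplx: "(\<integral>s. u n s \<partial>M) = complex_of_real (a n)" for n
        unfolding un a_def by (rule integral_complex_of_real)
      have a0: "a \<longlonglongrightarrow> 0"
        using tendsto_Re[OF ulim] unfolding a_cmplx by simp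
      have int: "integrable M (\<lambda>s. (cmod (g n s - h s))\<^sup>2)" for n
        using integrable[OF M ub[of n]] unfolding un complex_of_real_integrable_eq .
      \<comment> \<open>No operator belongs to \<open>h\<close> yet, so the isometry is available
        only for \<open>g n - g m\<close>; its L2 norm is then compared through \<open>h\<close>
        using (x + y)^2 \<le> 2 x^2 + 2 y^2.\<close>
      have key: "(norm (G n x - G m x))\<^sup>2 \<le> 2 * a n + 2 * a m" for m n
      proof -
        have gd: "good (\<lambda>s. 1 * g n s + (-1) * g m s) (\<lambda>x. scaleC 1 (G n x) + scaleC (-1) (G m x))"
          by (rule good_lin_comb[OF g g])
        have "(norm (G n x - G m x))\<^sup>2 = (\<integral>s. (cmod (g n s - g m s))\<^sup>2 \<partial>M)"
          using good_norm[OF gd M] by (simp add: scaleC_one scaleC_minus_left)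
        also have "\<dots> \<le> (\<integral>s. 2 * (cmod (g n s - h s))\<^sup>2 + 2 * (cmod (g m s - h s))\<^sup>2 \<partial>M)"
        proof (rule integral_mono_AE')
          show "integrable M (\<lambda>s. 2 * (cmod (g n s - h s))\<^sup>2 + 2 * (cmod (g m s - h s))\<^sup>2)"
            using int by auto
          have "(cmod (g n s - g m s))\<^sup>2 \<le> 2 * (cmod (g n s - h s))\<^sup>2 + 2 * (cmod (g m s - h s))\<^sup>2" for s
          proof -
            have "cmod (g n s - g m s) \<le> cmod (g n s - h s) + cmod (g m s - h s)"
              using norm_triangle_ineq4[of "g n s - h s" "g m s - h s"] by simp
            then have "(cmod (g n s - g m s))\<^sup>2 \<le> (cmod (g n s - h s) + cmod (g m s - h s))\<^sup>2"
              by (intro power_mono) auto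
            also have "\<dots> \<le> 2 * (cmod (g n s - h s))\<^sup>2 + 2 * (cmod (g m s - h s))\<^sup>2"
              using sum_squares_bound[of "cmod (g n s - h s)" "cmod (g m s - h s)"]
              by (simp add: power2_sum)
            finally show ?thesis .
          qed
          then show "AE s in M. (cmod (g n s - g m s))\<^sup>2
              \<le> 2 * (cmod (g n s - h s))\<^sup>2 + 2 * (cmod (g m s - h s))\<^sup>2" by simp
        qed auto
        also have "\<dots> = 2 * a n + 2 * a m"
          using int unfolding a_def by simp
        finally show ?thesis .
      qed
      have "Cauchy (\<lambda>n. G n x)"
      proof (rule metric_CauchyI)
        fix \<epsilon> :: real assume e: "\<epsilon> > 0"
        have "\<forall>\<^sub>F n in sequentially. a n < \<epsilon>\<^sup>2 / 4"
          using order_tendstoD(2)[OF a0, of "\<epsilon>\<^sup>2 / 4"] e by simp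
        then obtain N where N: "\<And>n. n \<ge> N \<Longrightarrow> a n < \<epsilon>\<^sup>2 / 4"
          unfolding eventually_sequentially by blast
        have "dist (G m x) (G n x) < \<epsilon>" if "m \<ge> N" "n \<ge> N" for m n
        proof -
          have "(norm (G m x - G n x))\<^sup>2 < \<epsilon>\<^sup>2"
            using key[where m = n and n = m] N[OF that(1)] N[OF that(2)] by simp
          then show ?thesis using e by (simp add: dist_norm power2_less_imp_less)
        qed
        then show "\<exists>N. \<forall>m\<ge>N. \<forall>n\<ge>N. dist (G m x) (G n x) < \<epsilon>" by blast
      qed
      then show ?thesis using Cauchy_convergent convergent_def by blast
    qed
    then obtain H where H: "\<And>x. (\<lambda>n. G n x) \<longlonglongrightarrow> H x" by metis
    have "bop H"
      unfolding bop_def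
    proof (intro conjI allI exI)
      fix x y :: 'a and c :: complex
      have "(\<lambda>n. G n x + G n y) \<longlonglongrightarrow> H x + H y" by (intro tendsto_intros H)
      then show "H (x + y) = H x + H y"
        using LIMSEQ_unique[OF H[of "x + y"]] by (simp add: bop_add[OF good_bop[OF g]])
      have "(\<lambda>n. scaleC c (G n x)) \<longlonglongrightarrow> scaleC c (H x)" by (intro tendsto_intros H)
      then show "H (scaleC c x) = scaleC c (H x)"
        using LIMSEQ_unique[OF H[of "scaleC c x"]] by (simp add: bop_scaleC[OF good_bop[OF g]])
      show "norm (H x) \<le> C * norm x"
        by (rule Lim_bounded[OF tendsto_norm[OF H], of 0]) (auto intro!: good_norm_le[OF g bound])
    qed
    then show ?thesis using H by blast
  qed
  obtain G where G: "bop G" "\<And>x. (\<lambda>n. F n x) \<longlonglongrightarrow> G x"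
    using conv[OF f bound lim] by blast
  \<comment> \<open>The convergence argument is repeated for the conjugate functions, since the
    limit also needs an adjoint; the adjoint relation passes to the limit.\<close>
  have "\<exists>F'. adj (F n) F' \<and> good (\<lambda>s. cnj (f n s)) F'" for n
    using good_cnj[OF f[of n]] by blast
  then have "\<exists>F'. \<forall>n. adj (F n) (F' n) \<and> good (\<lambda>s. cnj (f n s)) (F' n)"
    by (intro choice allI)
  then obtain F' where F': "\<And>n. adj (F n) (F' n)" "\<And>n. good (\<lambda>s. cnj (f n s)) (F' n)" by blast
  have clim: "(\<lambda>n. cnj (f n s)) \<longlonglongrightarrow> cnj (g s)" for s by (intro tendsto_intros lim)
  obtain G' where G': "bop G'" "\<And>x. (\<lambda>n. F' n x) \<longlonglongrightarrow> G' x"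
    using conv[OF F'(2) _ clim] bound by auto
  have "adj G G'"
    unfolding adj_def
  proof (intro allI)
    fix x y
    have "(\<lambda>n. cinner (F n x) y) \<longlonglongrightarrow> cinner (G x) y" "(\<lambda>n. cinner x (F' n y)) \<longlonglongrightarrow> cinner x (G' y)"
      by (intro tendsto_intros G G')+
    then show "cinner (G x) y = cinner x (G' y)"
      using adjD[OF F'(1)] LIMSEQ_unique by auto
  qed
  moreover have "multiplier g G"
    using f by (intro multiplier_limit[OF _ bound lim G]) (auto simp: good_def)
  moreover have "multiplier (\<lambda>s. cnj (g s)) G'"
    using F'(2) bound by (intro multiplier_limit[OF _ _ clim G', where C = C]) (auto simp: good_def)
  ultimately have "good g G" unfolding good_def by blast
  then show thesis by (rule that[OF _ G(2)])
qed

lemma good_sum: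
  assumes "finite I" "\<And>i. i \<in> I \<Longrightarrow> \<exists>F. good (f i) F"
  shows "\<exists>F. good (\<lambda>s. \<Sum>i\<in>I. a i * f i s) F"
  using assms
proof (induction I rule: finite_induct)
  case empty
  show ?case using good_lin_comb[OF good_gen[OF gens_one] good_gen[OF gens_one], of 0 0] by auto
next
  case (insert i I)
  then obtain F G where "good (f i) F" "good (\<lambda>s. \<Sum>i\<in>I. a i * f i s) G" by blast
  from good_lin_comb[OF this, of "a i" 1] insert show ?case by auto
qed

lemma good_bounded_borel:
  assumes ind: "\<And>S. S \<in> sets borel \<Longrightarrow> \<exists>F. good (indicator S) F" and f: "bounded_borel f"
  shows "\<exists>F. good f F"
proof -
  obtain C where C: "C \<ge> 0" "\<And>s. cmod (f s) \<le> C" using bounded_borelE[OF f] by blast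
  obtain u where u: "\<And>i. simple_function borel (u i)" "\<And>s. (\<lambda>i. u i s) \<longlonglongrightarrow> f s"
    "\<And>i s. dist (u i s) 0 \<le> 2 * dist (f s) 0"
    using borel_measurable_implies_sequence_metric[OF bounded_borel_measurable[OF f], of 0] by auto
  have "\<exists>F. good (u i) F" for i
  proof -
    have "\<exists>F. good (\<lambda>s. \<Sum>y\<in>range (u i). y * indicator (u i -` {y}) s) F"
      using u(1)[of i] unfolding simple_function_def
      by (intro good_sum ind) auto
    moreover have "(\<Sum>y\<in>range (u i). y * indicator (u i -` {y}) s) = u i s" for s
    proof -
      have "(\<Sum>y\<in>range (u i). y * indicator (u i -` {y}) s) = (\<Sum>y\<in>{u i s}. y * indicator (u i -` {y}) s)"
        using u(1)[of i] unfolding simple_function_def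
        by (intro sum.mono_neutral_right) (auto simp: indicator_def)
      then show ?thesis by simp
    qed
    ultimately show ?thesis by simp
  qed
  then obtain F where "\<And>i. good (u i) (F i)" by metis
  moreover have "cmod (u i s) \<le> 2 * C" for i s
    using u(3)[of i s] C(2)[of s] by simp
  ultimately show ?thesis
    using good_limit[of u F "2 * C" f] u(2) by metis
qed

end

section \<open>Spectral integrals\<close>

locale pvm =
  fixes E :: "real set \<Rightarrow> 'a::complex_hilbert \<Rightarrow> 'a"
  assumes is_pvm: "is_pvm E"
begin

lemma E_add: "S \<in> sets borel \<Longrightarrow> E S (x + y) = E S x + E S y"
  and E_scaleC: "S \<in> sets borel \<Longrightarrow> E S (scaleC c x) = scaleC c (E S x)"
  and E_sym: "S \<in> sets borel \<Longrightarrow> cinner (E S x) y = cinner x (E S y)"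
  and E_idem: "S \<in> sets borel \<Longrightarrow> E S (E S x) = E S x"
  and E_UNIV: "E UNIV = id"
  and E_Int: "S \<in> sets borel \<Longrightarrow> T \<in> sets borel \<Longrightarrow> E (S \<inter> T) x = E S (E T x)"
  using is_pvm unfolding is_pvm_def by auto

lemma E_sums: "range F \<subseteq> sets borel \<Longrightarrow> disjoint_family F \<Longrightarrow>
    (\<lambda>n. \<Sum>k<n. E (F k) x) \<longlonglongrightarrow> E (\<Union>n. F n) x"
  using is_pvm unfolding is_pvm_def by blast

lemma E_norm_sq: "S \<in> sets borel \<Longrightarrow> (norm (E S x))\<^sup>2 = Re (cinner x (E S x))"
  by (simp add: norm_sq_eq_cinner E_sym E_idem)

lemma E_norm_sq_complex: "S \<in> sets borel \<Longrightarrow> complex_of_real ((norm (E S x))\<^sup>2) = cinner x (E S x)"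
  by (simp only: cinner_self_norm[symmetric] E_sym E_idem)

lemma E_norm_le: "S \<in> sets borel \<Longrightarrow> norm (E S x) \<le> norm x"
proof -
  assume S: "S \<in> sets borel"
  have "(norm (E S x))\<^sup>2 \<le> norm x * norm (E S x)"
    using E_norm_sq[OF S, of x] order.trans[OF complex_Re_le_cmod cauchy_schwarz[of x "E S x"]] by simp
  then show ?thesis
    by (cases "norm (E S x) = 0") (simp_all add: power2_eq_square)
qed

lemma bop_E: "S \<in> sets borel \<Longrightarrow> bop (E S)"
  unfolding bop_def using E_add E_scaleC E_norm_le by (auto intro!: exI[of _ 1])

text \<open>The sequence of empty sets is disjoint with empty union; its partial sums converge, so
  their constant increment vanishes.\<close>

lemma E_empty: "E {} x = 0"
proof -
  have "(\<lambda>n. \<Sum>k<n. E {} x) \<longlonglongrightarrow> E {} x"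
    using E_sums[of "\<lambda>_. {}" x] by (simp add: disjoint_family_on_def)
  then have "(\<lambda>n. (\<Sum>k<Suc n. E {} x) - (\<Sum>k<n. E {} x)) \<longlonglongrightarrow> E {} x - E {} x"
    by (intro tendsto_diff LIMSEQ_Suc)
  then show ?thesis by (simp add: LIMSEQ_const_iff)
qed

lemma sets_smeas [simp, measurable_cong]: "sets (smeas E x) = sets borel"
  unfolding smeas_def by (simp add: sigma_algebra.sigma_sets_eq sets.sigma_algebra_axioms
      flip: space_borel)

lemma space_smeas [simp]: "space (smeas E x) = UNIV"
  unfolding smeas_def by (rule space_measure_of) simp

text \<open>\<open>measure_of\<close> takes the prescribed values only for a countably additive set
  function. Additivity comes from pairing the vector series with \<open>x\<close>, because the
  squared norm of \<open>E S x\<close> is the linear quantity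
  \<open>cinner x (E S x)\<close>.\<close>

lemma emeasure_smeas:
  assumes S: "S \<in> sets borel"
  shows "emeasure (smeas E x) S = ennreal ((norm (E S x))\<^sup>2)"
proof -
  have "sigma_algebra UNIV (sets (borel :: real measure))"
    using sets.sigma_algebra_axioms[of "borel :: real measure"] by simp
  moreover have "positive (sets borel) (\<lambda>S. ennreal ((norm (E S x))\<^sup>2))"
    unfolding positive_def by (simp add: E_empty)
  moreover have "countably_additive (sets borel) (\<lambda>S. ennreal ((norm (E S x))\<^sup>2))"
  proof (rule countably_additiveI)
    fix F :: "nat \<Rightarrow> real set"
    assume F: "range F \<subseteq> sets borel" "disjoint_family F"
    have "(\<lambda>n. Re (cinner x (\<Sum>k<n. E (F k) x))) \<longlonglongrightarrow> Re (cinner x (E (\<Union>n. F n) x))"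
      by (intro tendsto_intros E_sums F)
    then have "(\<lambda>k. (norm (E (F k) x))\<^sup>2) sums (norm (E (\<Union>n. F n) x))\<^sup>2"
      using F unfolding sums_def by (simp add: E_norm_sq cinner_sum_right Re_sum image_subset_iff)
    then show "(\<Sum>i. ennreal ((norm (E (F i) x))\<^sup>2)) = ennreal ((norm (E (\<Union>i. F i) x))\<^sup>2)"
      by (intro suminf_ennreal_eq) auto
  qed
  ultimately show ?thesis
    unfolding smeas_def using S by (rule emeasure_measure_of_sigma)
qed

lemma finite_smeas: "finite_measure (smeas E x)"
  by (rule finite_measureI) (simp add: emeasure_smeas)

lemma measure_smeas: "S \<in> sets borel \<Longrightarrow> measure (smeas E x) S = (norm (E S x))\<^sup>2"
  unfolding measure_def by (simp add: emeasure_smeas)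

lemma integral_indicator_smeas:
  assumes S: "S \<in> sets borel"
  shows "(\<integral>s. indicator S s \<partial>smeas E x) = cinner x (E S x)"
proof -
  interpret finite_measure "smeas E x" by (rule finite_smeas)
  have "(\<integral>s. indicator S s \<partial>smeas E x) = (\<integral>s. complex_of_real (indicator S s) \<partial>smeas E x)"
    by (simp add: of_real_indicator)
  also have "\<dots> = complex_of_real (measure (smeas E x) S)"
    using S by (subst integral_complex_of_real) simp
  finally show ?thesis
    using measure_smeas[OF S] E_norm_sq_complex[OF S] by simp
qed

text \<open>Indicators generate, and each \<open>K x\<close> is the single measure
  \<open>smeas E x\<close>; every bounded Borel function then becomes good through simple
  functions.\<close>

sublocale op_calculus "{(indicator S, E S) | S. S \<in> sets borel}" "\<lambda>x. {smeas E x}"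
proof (rule op_calculus.intro, goal_cases)
  case (5 e V e' V')
  then obtain S S' where S: "S \<in> sets borel" "e = indicator S" "V = E S"
    and S': "S' \<in> sets borel" "e' = indicator S'" "V' = E S'" by blast
  have "(\<lambda>s. e s * e' s) = indicator (S \<inter> S')" "(\<lambda>x. V (V' x)) = E (S \<inter> S')"
    unfolding S S' by (auto simp: indicator_def E_Int[OF S(1) S'(1)])
  then show ?case using S S' by blast
next
  case (6 e V)
  then obtain S where S: "S \<in> sets borel" "e = indicator S" "V = E S" by auto
  have "(\<lambda>s. cnj (e s)) = e" unfolding S by (auto simp: indicator_def)
  moreover have "adj V V" using S E_sym unfolding adj_def by simp
  ultimately show ?case using 6 by (intro exI[of _ V]) simp
next
  case 4
  show ?case
    by (rule CollectI, rule exI[of _ UNIV]) (auto simp: E_UNIV)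
next
  case (8 e V)
  then show ?case by (auto intro: bop_E)
next
  case (9 e V M x)
  then show ?case using integral_indicator_smeas by auto
next
  case (2 M x)
  then show ?case using finite_smeas by simp
next
  case (3 M x)
  then show ?case by simp
next
  case (7 e V)
  then show ?case using bounded_borel_indicator by auto
qed simp

section \<open>Bounded Borel calculus of a projection-valued measure\<close>

definition Phi :: "(real \<Rightarrow> complex) \<Rightarrow> 'a \<Rightarrow> 'a" where
  "Phi f = (THE F. good f F)"

lemma Phi_eqI: "good f F \<Longrightarrow> Phi f = F"
  unfolding Phi_def by (rule the_equality) (auto intro: good_unique)

lemma good_indicator: "S \<in> sets borel \<Longrightarrow> good (indicator S) (E S)"
  by (rule good_gen) auto

lemma Phi_indicator: "S \<in> sets borel \<Longrightarrow> Phi (indicator S) = E S"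
  by (rule Phi_eqI[OF good_indicator])

lemma good_Phi:
  assumes "bounded_borel f"
  shows "good f (Phi f)"
proof -
  obtain F where "good f F"
    using good_bounded_borel[OF _ assms] good_indicator by blast
  then show ?thesis using Phi_eqI[of f F] by simp
qed

lemma bop_Phi: "bounded_borel f \<Longrightarrow> bop (Phi f)"
  by (rule good_bop[OF good_Phi])

lemma Phi_repr: "bounded_borel f \<Longrightarrow> (\<integral>s. f s \<partial>smeas E x) = cinner x (Phi f x)"
  by (rule good_repr[OF good_Phi]) auto

lemma Phi_norm: "bounded_borel f \<Longrightarrow> (\<integral>s. (cmod (f s))\<^sup>2 \<partial>smeas E x) = (norm (Phi f x))\<^sup>2"
  by (rule good_norm[OF good_Phi]) auto

lemma Phi_lin_comb:
  assumes "bounded_borel f" "bounded_borel g"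
  shows "Phi (\<lambda>s. a * f s + b * g s) x = scaleC a (Phi f x) + scaleC b (Phi g x)"
  by (rule fun_cong[OF Phi_eqI[OF good_lin_comb[OF assms[THEN good_Phi]]]])

lemma Phi_add: "bounded_borel f \<Longrightarrow> bounded_borel g \<Longrightarrow> Phi (\<lambda>s. f s + g s) x = Phi f x + Phi g x"
  using Phi_lin_comb[of f g 1 1 x] by (simp add: scaleC_one)

lemma Phi_diff: "bounded_borel f \<Longrightarrow> bounded_borel g \<Longrightarrow> Phi (\<lambda>s. f s - g s) x = Phi f x - Phi g x"
  using Phi_lin_comb[of f g 1 "-1" x] by (simp add: scaleC_one scaleC_minus_left)

lemma Phi_scale: "bounded_borel f \<Longrightarrow> Phi (\<lambda>s. a * f s) x = scaleC a (Phi f x)"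
  using Phi_lin_comb[of f f a 0 x] by simp

lemma Phi_mult: 
  assumes "bounded_borel f" "bounded_borel g"
  shows "Phi (\<lambda>s. f s * g s) x = Phi f (Phi g x)"
  by (rule fun_cong[OF Phi_eqI[OF good_mult[OF assms[THEN good_Phi]]]])

lemma Phi_one: "Phi (\<lambda>_. 1) x = x"
  by (rule fun_cong[OF Phi_eqI[OF good_gen[OF gens_one]]])

lemma Phi_const: "Phi (\<lambda>_. c) x = scaleC c x"
  using Phi_scale[of "\<lambda>_. 1" c x] by (simp add: Phi_one)

lemma Phi_zero: "Phi (\<lambda>_. 0) x = 0"
  using Phi_const[of 0 x] by simp

lemma Phi_adj:
  assumes "bounded_borel f"
  shows "adj (Phi f) (Phi (\<lambda>s. cnj (f s)))"
proof -
  obtain F' where "adj (Phi f) F'" "good (\<lambda>s. cnj (f s)) F'"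
    using good_cnj[OF good_Phi[OF assms]] .
  then show ?thesis using Phi_eqI[of "\<lambda>s. cnj (f s)" F'] by simp
qed

lemma Phi_limit:
  assumes f: "\<And>n. bounded_borel (f n)" and C: "\<And>n s. cmod (f n s) \<le> C"
    and lim: "\<And>s. (\<lambda>n. f n s) \<longlonglongrightarrow> g s"
  shows "(\<lambda>n. Phi (f n) x) \<longlonglongrightarrow> Phi g x"
proof -
  obtain G where G: "good g G" "\<And>x. (\<lambda>n. Phi (f n) x) \<longlonglongrightarrow> G x"
    using good_limit[OF good_Phi[OF f] C lim] by blast
  then show ?thesis using Phi_eqI[OF G(1)] by simp
qed

text \<open>Multiplying by the indicator of \<open>S\<close> changes neither operator, since that
  indicator is sent to the identity.\<close>

lemma Phi_cong_off_null:
  assumes S: "S \<in> sets borel" "E S = id" and f: "bounded_borel f" "bounded_borel g"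
    and eq: "\<And>s. s \<in> S \<Longrightarrow> f s = g s"
  shows "Phi f = Phi g"
proof
  fix x
  have "(\<lambda>s. f s * indicator S s) = (\<lambda>s. g s * indicator S s)"
    using eq by (auto simp: indicator_def)
  then have "Phi f (Phi (indicator S) x) = Phi g (Phi (indicator S) x)"
    using Phi_mult[OF f(1) bounded_borel_indicator[OF S(1)]] Phi_mult[OF f(2) bounded_borel_indicator[OF S(1)]]
    by simp
  then show "Phi f x = Phi g x" using S by (simp add: Phi_indicator)
qed

section \<open>Unbounded spectral integrals by truncation\<close>

text \<open>Large values are replaced by 0 and not clipped to modulus \<open>n\<close>. Two
  truncations then agree wherever the smaller one is nonzero, so the squared modulus of their
  difference is the difference of their squared moduli.\<close>

definition trunc :: "(real \<Rightarrow> complex) \<Rightarrow> nat \<Rightarrow> real \<Rightarrow> complex" where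
  "trunc \<phi> n s = (if cmod (\<phi> s) \<le> real n then \<phi> s else 0)"

definition sdom :: "(real \<Rightarrow> complex) \<Rightarrow> 'a set" where
  "sdom \<phi> = {x. (\<integral>\<^sup>+ s. ennreal ((cmod (\<phi> s))\<^sup>2) \<partial>smeas E x) < \<infinity>}"

definition sint :: "(real \<Rightarrow> complex) \<Rightarrow> 'a \<Rightarrow> 'a" where
  "sint \<phi> x = lim (\<lambda>n. Phi (trunc \<phi> n) x)"

lemma bounded_borel_trunc [intro]:
  assumes [measurable]: "\<phi> \<in> borel_measurable borel"
  shows "bounded_borel (trunc \<phi> n)"
proof (rule bounded_borelI[of _ "real n"])
  show "trunc \<phi> n \<in> borel_measurable borel"
    unfolding trunc_def[abs_def] by measurable
qed (auto simp: trunc_def)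

lemma cmod_trunc_le: "cmod (trunc \<phi> n s) \<le> cmod (\<phi> s)"
  unfolding trunc_def by auto

lemma trunc_eventually: "\<forall>\<^sub>F n in sequentially. trunc \<phi> n s = \<phi> s"
proof -
  obtain N :: nat where "cmod (\<phi> s) \<le> real N" using real_arch_simple by blast
  then show ?thesis
    unfolding trunc_def by (intro eventually_sequentiallyI[of N]) (auto intro: order.trans)
qed

lemma trunc_tendsto: "(\<lambda>n. trunc \<phi> n s) \<longlonglongrightarrow> \<phi> s"
  using trunc_eventually by (rule tendsto_eventually)

text \<open>Monotone convergence: the integral of |\<phi>|^2 is the supremum of the squared norms of
  the truncated vectors.\<close>

lemma sdom_iff:
  assumes \<phi> [measurable]: "\<phi> \<in> borel_measurable borel"
  shows "x \<in> sdom \<phi> \<longleftrightarrow> (\<exists>C. \<forall>n. norm (Phi (trunc \<phi> n) x) \<le> C)"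
proof -
  have [measurable]: "trunc \<phi> n \<in> borel_measurable borel" for n
    using bounded_borel_trunc[OF \<phi>] by (rule bounded_borel_measurable)
  have norm_eq: "(\<integral>\<^sup>+ s. ennreal ((cmod (trunc \<phi> n s))\<^sup>2) \<partial>smeas E x) = ennreal ((norm (Phi (trunc \<phi> n) x))\<^sup>2)" for n
  proof -
    interpret finite_measure "smeas E x" by (rule finite_smeas)
    have "integrable (smeas E x) (\<lambda>s. (cmod (trunc \<phi> n s))\<^sup>2)"
      by (rule integrable_const_bound[of _ "(real n)\<^sup>2"]) (auto simp: trunc_def intro!: power_mono)
    then show ?thesis
      by (subst nn_integral_eq_integral) (auto simp: Phi_norm bounded_borel_trunc[OF \<phi>])
  qed
  have sup: "(SUP n. ennreal ((cmod (trunc \<phi> n s))\<^sup>2)) = ennreal ((cmod (\<phi> s))\<^sup>2)" for s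
  proof (rule LIMSEQ_unique[OF LIMSEQ_SUP])
    show "incseq (\<lambda>n. ennreal ((cmod (trunc \<phi> n s))\<^sup>2))"
      by (auto simp: incseq_def trunc_def)
    show "(\<lambda>n. ennreal ((cmod (trunc \<phi> n s))\<^sup>2)) \<longlonglongrightarrow> ennreal ((cmod (\<phi> s))\<^sup>2)"
      by (intro tendsto_intros trunc_tendsto)
  qed
  have "(\<integral>\<^sup>+ s. ennreal ((cmod (\<phi> s))\<^sup>2) \<partial>smeas E x)
      = (SUP n. \<integral>\<^sup>+ s. ennreal ((cmod (trunc \<phi> n s))\<^sup>2) \<partial>smeas E x)"
    unfolding sup[symmetric]
    by (intro nn_integral_monotone_convergence_SUP) (auto simp: incseq_def le_fun_def trunc_def)
  then have eq: "(\<integral>\<^sup>+ s. ennreal ((cmod (\<phi> s))\<^sup>2) \<partial>smeas E x)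
      = (SUP n. ennreal ((norm (Phi (trunc \<phi> n) x))\<^sup>2))"
    unfolding norm_eq .
  show ?thesis
  proof
    assume "x \<in> sdom \<phi>"
    then have "(SUP n. ennreal ((norm (Phi (trunc \<phi> n) x))\<^sup>2)) < \<infinity>"
      using eq by (simp add: sdom_def)
    then obtain r where r: "(SUP n. ennreal ((norm (Phi (trunc \<phi> n) x))\<^sup>2)) = ennreal r" "r \<ge> 0"
      by (cases "SUP n. ennreal ((norm (Phi (trunc \<phi> n) x))\<^sup>2)") auto
    have "norm (Phi (trunc \<phi> n) x) \<le> sqrt r" for n
    proof -
      have "ennreal ((norm (Phi (trunc \<phi> n) x))\<^sup>2) \<le> ennreal r"
        unfolding r(1)[symmetric] by (rule SUP_upper) simp
      then show ?thesis using r(2) by (auto simp: ennreal_le_iff intro: real_le_rsqrt)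
    qed
    then show "\<exists>C. \<forall>n. norm (Phi (trunc \<phi> n) x) \<le> C" by blast
  next
    assume "\<exists>C. \<forall>n. norm (Phi (trunc \<phi> n) x) \<le> C"
    then obtain C where C: "\<And>n. norm (Phi (trunc \<phi> n) x) \<le> C" by blast
    have "(SUP n. ennreal ((norm (Phi (trunc \<phi> n) x))\<^sup>2)) \<le> ennreal (C\<^sup>2)"
      using C by (intro SUP_least ennreal_leI power_mono) auto
    also have "\<dots> < \<infinity>" by simp
    finally show "x \<in> sdom \<phi>" using eq by (simp add: sdom_def)
  qed
qed

text \<open>The squared norms \<open>a n\<close> increase and are bounded, and by \<open>key\<close>
  their increments are exactly the squared distances of the truncated vectors.\<close>

lemma sint_tendsto:
  assumes \<phi> [measurable]: "\<phi> \<in> borel_measurable borel" and x: "x \<in> sdom \<phi>"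
  shows "(\<lambda>n. Phi (trunc \<phi> n) x) \<longlonglongrightarrow> sint \<phi> x"
proof -
  have tb: "bounded_borel (trunc \<phi> n)" for n using bounded_borel_trunc[OF \<phi>] .
  define a where "a n = (norm (Phi (trunc \<phi> n) x))\<^sup>2" for n
  have key: "(norm (Phi (trunc \<phi> n) x - Phi (trunc \<phi> m) x))\<^sup>2 = a n - a m" if "m \<le> n" for m n
  proof -
    have i: "integrable (smeas E x) (\<lambda>s. (cmod (trunc \<phi> k s))\<^sup>2)" for k
    proof -
      have "bounded_borel (\<lambda>s. trunc \<phi> k s * cnj (trunc \<phi> k s))"
        by (intro bounded_borel_mult bounded_borel_cnj tb)
      then have "integrable (smeas E x) (\<lambda>s. complex_of_real ((cmod (trunc \<phi> k s))\<^sup>2))"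
        unfolding complex_norm_square by (intro integrable) auto
      then show ?thesis unfolding complex_of_real_integrable_eq .
    qed
    have pt: "(cmod (trunc \<phi> n s - trunc \<phi> m s))\<^sup>2 = (cmod (trunc \<phi> n s))\<^sup>2 - (cmod (trunc \<phi> m s))\<^sup>2" for s
      using that unfolding trunc_def by auto
    have "(norm (Phi (trunc \<phi> n) x - Phi (trunc \<phi> m) x))\<^sup>2
        = (\<integral>s. (cmod (trunc \<phi> n s - trunc \<phi> m s))\<^sup>2 \<partial>smeas E x)"
      using Phi_norm[OF bounded_borel_diff[OF tb[of n] tb[of m]], of x] by (simp add: Phi_diff tb)
    also have "\<dots> = a n - a m"
      unfolding pt using i by (simp add: a_def Phi_norm tb)
    finally show ?thesis .
  qed
  obtain C where C: "\<And>n. norm (Phi (trunc \<phi> n) x) \<le> C" using x sdom_iff[OF \<phi>] by blast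
  have "convergent a"
  proof (rule Bseq_monoseq_convergent)
    show "Bseq a"
      using C by (intro BseqI'[of _ "C\<^sup>2"]) (auto simp: a_def intro!: power_mono)
    show "monoseq a"
      using key by (intro monoI1) (metis diff_ge_0_iff_ge zero_le_power2)
  qed
  then have "Cauchy a" by (rule convergent_Cauchy)
  have "Cauchy (\<lambda>n. Phi (trunc \<phi> n) x)"
  proof (rule metric_CauchyI)
    fix e :: real assume e: "e > 0"
    then have "e\<^sup>2 > 0" by simp
    from metric_CauchyD[OF \<open>Cauchy a\<close> this] obtain N
      where N: "\<And>m n. m \<ge> N \<Longrightarrow> n \<ge> N \<Longrightarrow> dist (a m) (a n) < e\<^sup>2" by blast
    have *: "dist (Phi (trunc \<phi> n) x) (Phi (trunc \<phi> m) x) < e" if "m \<ge> N" "n \<ge> N" "m \<le> n" for m n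
    proof -
      have "(norm (Phi (trunc \<phi> n) x - Phi (trunc \<phi> m) x))\<^sup>2 < e\<^sup>2"
        using key[OF that(3)] N[OF that(2,1)] by (simp add: dist_real_def)
      then show ?thesis using e by (simp add: dist_norm power2_less_imp_less)
    qed
    have "dist (Phi (trunc \<phi> m) x) (Phi (trunc \<phi> n) x) < e" if "m \<ge> N" "n \<ge> N" for m n
      using *[OF that] *[OF that(2,1)] by (cases "m \<le> n") (simp_all add: dist_commute)
    then show "\<exists>N. \<forall>m\<ge>N. \<forall>n\<ge>N. dist (Phi (trunc \<phi> m) x) (Phi (trunc \<phi> n) x) < e" by blast
  qed
  then show ?thesis
    unfolding sint_def using Cauchy_convergent convergent_LIMSEQ_iff by blast
qed

text \<open>A convergent sequence is bounded, so convergence of the truncations already forces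
  membership in the domain. Closure properties of \<open>sdom\<close> thus come together with the
  values of \<open>sint\<close>.\<close>

lemma sint_eqI:
  assumes \<phi>: "\<phi> \<in> borel_measurable borel" and lim: "(\<lambda>n. Phi (trunc \<phi> n) x) \<longlonglongrightarrow> y"
  shows "x \<in> sdom \<phi>" "sint \<phi> x = y"
proof -
  show "x \<in> sdom \<phi>"
    unfolding sdom_iff[OF \<phi>] using convergent_imp_Bseq[OF convergentI[OF lim]]
    unfolding Bseq_def by blast
  show "sint \<phi> x = y"
    unfolding sint_def using lim by (rule limI)
qed

text \<open>On a finite measure 1 + |\<phi>|^2 is an integrable majorant of every truncation, so
  square integrability suffices for the first moment.\<close>

lemma sint_repr:
  assumes \<phi> [measurable]: "\<phi> \<in> borel_measurable borel" and x: "x \<in> sdom \<phi>"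
  shows "cinner x (sint \<phi> x) = (\<integral>s. \<phi> s \<partial>smeas E x)"
proof (rule LIMSEQ_unique)
  interpret finite_measure "smeas E x" by (rule finite_smeas)
  show "(\<lambda>n. cinner x (Phi (trunc \<phi> n) x)) \<longlonglongrightarrow> cinner x (sint \<phi> x)"
    by (intro tendsto_intros sint_tendsto \<phi> x)
  have [measurable]: "trunc \<phi> n \<in> borel_measurable borel" for n
    using bounded_borel_trunc[OF \<phi>] by (rule bounded_borel_measurable)
  have sq: "integrable (smeas E x) (\<lambda>s. (cmod (\<phi> s))\<^sup>2)"
    using x unfolding sdom_def by (intro integrableI_bounded) auto
  have w: "integrable (smeas E x) (\<lambda>s. 1 + (cmod (\<phi> s))\<^sup>2)"
    using sq by simp
  have le: "cmod (trunc \<phi> n s) \<le> 1 + (cmod (\<phi> s))\<^sup>2" for n s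
  proof -
    have "cmod (trunc \<phi> n s) \<le> cmod (\<phi> s)" by (rule cmod_trunc_le)
    also have "\<dots> \<le> 1 + (cmod (\<phi> s))\<^sup>2"
      using sum_squares_bound[of "cmod (\<phi> s)" 1] norm_ge_zero[of "\<phi> s"] by (simp del: norm_ge_zero)
    finally show ?thesis .
  qed
  have "(\<lambda>n. \<integral>s. trunc \<phi> n s \<partial>smeas E x) \<longlonglongrightarrow> (\<integral>s. \<phi> s \<partial>smeas E x)"
    using w le trunc_tendsto by (intro integral_dominated_convergence[where w = "\<lambda>s. 1 + (cmod (\<phi> s))\<^sup>2"]) auto
  then show "(\<lambda>n. cinner x (Phi (trunc \<phi> n) x)) \<longlonglongrightarrow> (\<integral>s. \<phi> s \<partial>smeas E x)"
    by (simp add: Phi_repr bounded_borel_trunc[OF \<phi>])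
qed

lemma sint_add:
  assumes \<phi>: "\<phi> \<in> borel_measurable borel" and xy: "x \<in> sdom \<phi>" "y \<in> sdom \<phi>"
  shows "x + y \<in> sdom \<phi>" "sint \<phi> (x + y) = sint \<phi> x + sint \<phi> y"
proof -
  have "(\<lambda>n. Phi (trunc \<phi> n) x + Phi (trunc \<phi> n) y) \<longlonglongrightarrow> sint \<phi> x + sint \<phi> y"
    by (intro tendsto_intros sint_tendsto \<phi> xy)
  then have "(\<lambda>n. Phi (trunc \<phi> n) (x + y)) \<longlonglongrightarrow> sint \<phi> x + sint \<phi> y"
    by (simp add: bop_add[OF bop_Phi[OF bounded_borel_trunc[OF \<phi>]]])
  then show "x + y \<in> sdom \<phi>" "sint \<phi> (x + y) = sint \<phi> x + sint \<phi> y"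
    by (rule sint_eqI[OF \<phi>])+
qed

lemma sint_scaleC:
  assumes \<phi>: "\<phi> \<in> borel_measurable borel" and x: "x \<in> sdom \<phi>"
  shows "scaleC c x \<in> sdom \<phi>" "sint \<phi> (scaleC c x) = scaleC c (sint \<phi> x)"
proof -
  have "(\<lambda>n. scaleC c (Phi (trunc \<phi> n) x)) \<longlonglongrightarrow> scaleC c (sint \<phi> x)"
    by (intro tendsto_intros sint_tendsto \<phi> x)
  then have "(\<lambda>n. Phi (trunc \<phi> n) (scaleC c x)) \<longlonglongrightarrow> scaleC c (sint \<phi> x)"
    by (simp add: bop_scaleC[OF bop_Phi[OF bounded_borel_trunc[OF \<phi>]]])
  then show "scaleC c x \<in> sdom \<phi>" "sint \<phi> (scaleC c x) = scaleC c (sint \<phi> x)"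
    by (rule sint_eqI[OF \<phi>])+
qed

lemma zero_in_sdom:
  assumes "\<phi> \<in> borel_measurable borel"
  shows "0 \<in> sdom \<phi>"
  by (rule sint_eqI[OF assms, of _ 0])
     (simp add: bop_zero[OF bop_Phi[OF bounded_borel_trunc[OF assms]]])

lemma csubspace_sdom: "\<phi> \<in> borel_measurable borel \<Longrightarrow> csubspace (sdom \<phi>)"
  unfolding csubspace_def by (simp add: zero_in_sdom sint_add(1) sint_scaleC(1))

lemma Phi_sint:
  assumes \<phi>: "\<phi> \<in> borel_measurable borel" and x: "x \<in> sdom \<phi>"
    and g: "bounded_borel g" "bounded_borel (\<lambda>s. g s * \<phi> s)"
  shows "Phi g (sint \<phi> x) = Phi (\<lambda>s. g s * \<phi> s) x"
proof (rule LIMSEQ_unique)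
  have tb: "bounded_borel (trunc \<phi> n)" for n using bounded_borel_trunc[OF \<phi>] .
  show "(\<lambda>n. Phi g (Phi (trunc \<phi> n) x)) \<longlonglongrightarrow> Phi g (sint \<phi> x)"
    by (rule bop_tendsto[OF bop_Phi[OF g(1)] sint_tendsto[OF \<phi> x]])
  obtain C where C: "\<And>s. cmod (g s * \<phi> s) \<le> C" using bounded_borelE[OF g(2)] by blast
  have "(\<lambda>n. Phi (\<lambda>s. g s * trunc \<phi> n s) x) \<longlonglongrightarrow> Phi (\<lambda>s. g s * \<phi> s) x"
  proof (rule Phi_limit)
    fix n s
    show "bounded_borel (\<lambda>s. g s * trunc \<phi> n s)" by (rule bounded_borel_mult[OF g(1) tb])
    have "cmod (g s * trunc \<phi> n s) \<le> cmod (g s * \<phi> s)"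
      unfolding norm_mult using cmod_trunc_le by (intro mult_left_mono) auto
    with C[of s] show "cmod (g s * trunc \<phi> n s) \<le> C" by simp
    show "(\<lambda>n. g s * trunc \<phi> n s) \<longlonglongrightarrow> g s * \<phi> s"
      by (intro tendsto_intros trunc_tendsto)
  qed
  then show "(\<lambda>n. Phi g (Phi (trunc \<phi> n) x)) \<longlonglongrightarrow> Phi (\<lambda>s. g s * \<phi> s) x"
    by (simp add: Phi_mult g tb)
qed

text \<open>Here \<open>y\<close> is arbitrary: the factor \<open>g\<close> absorbs the growth of
  \<open>\<phi>\<close>. This is the source of domain vectors, resolvents and
  regularizations.\<close>

lemma sint_Phi:
  assumes \<phi>: "\<phi> \<in> borel_measurable borel"
    and g: "bounded_borel g" "bounded_borel (\<lambda>s. g s * \<phi> s)"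
  shows "Phi g y \<in> sdom \<phi>" "sint \<phi> (Phi g y) = Phi (\<lambda>s. g s * \<phi> s) y"
proof -
  have tb: "bounded_borel (trunc \<phi> n)" for n using bounded_borel_trunc[OF \<phi>] .
  obtain C where C: "\<And>s. cmod (g s * \<phi> s) \<le> C" using bounded_borelE[OF g(2)] by blast
  have "(\<lambda>n. Phi (\<lambda>s. trunc \<phi> n s * g s) y) \<longlonglongrightarrow> Phi (\<lambda>s. g s * \<phi> s) y"
  proof (rule Phi_limit)
    fix n s
    show "bounded_borel (\<lambda>s. trunc \<phi> n s * g s)" by (rule bounded_borel_mult[OF tb g(1)])
    have "cmod (trunc \<phi> n s * g s) \<le> cmod (\<phi> s * g s)"
      unfolding norm_mult using cmod_trunc_le by (intro mult_right_mono) auto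
    with C[of s] show "cmod (trunc \<phi> n s * g s) \<le> C" by (simp add: mult.commute)
    have "(\<lambda>n. trunc \<phi> n s * g s) \<longlonglongrightarrow> \<phi> s * g s"
      by (intro tendsto_intros trunc_tendsto)
    then show "(\<lambda>n. trunc \<phi> n s * g s) \<longlonglongrightarrow> g s * \<phi> s" by (simp add: mult.commute)
  qed
  then have "(\<lambda>n. Phi (trunc \<phi> n) (Phi g y)) \<longlonglongrightarrow> Phi (\<lambda>s. g s * \<phi> s) y"
    by (simp add: Phi_mult g tb)
  then show "Phi g y \<in> sdom \<phi>" "sint \<phi> (Phi g y) = Phi (\<lambda>s. g s * \<phi> s) y"
    by (rule sint_eqI[OF \<phi>])+
qed

lemma dense_sdom:
  assumes \<phi> [measurable]: "\<phi> \<in> borel_measurable borel"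
  shows "closure (sdom \<phi>) = UNIV"
proof -
  have "y \<in> closure (sdom \<phi>)" for y
  proof -
    \<comment> \<open>Indicator of the set where |\<phi>| is at most \<open>n\<close>: on its range
      the integral is bounded, and these projections increase to the identity.\<close>
    define g where "g n s = (if cmod (\<phi> s) \<le> real n then 1 else 0 :: complex)" for n s
    have g: "bounded_borel (g n)" for n
      unfolding g_def by (rule bounded_borelI[of _ 1]) auto
    have "(\<lambda>s. g n s * \<phi> s) = trunc \<phi> n" for n
      by (auto simp: g_def trunc_def)
    then have "Phi (g n) y \<in> sdom \<phi>" for n
      using sint_Phi(1)[OF \<phi> g[of n]] bounded_borel_trunc[OF \<phi>, of n] by simp
    moreover have "(\<lambda>n. Phi (g n) y) \<longlonglongrightarrow> Phi (\<lambda>_. 1) y"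
    proof (rule Phi_limit[OF g, where C = 1])
      fix n s show "cmod (g n s) \<le> 1" by (simp add: g_def)
      obtain N :: nat where "cmod (\<phi> s) \<le> real N" using real_arch_simple by blast
      then have "\<forall>\<^sub>F n in sequentially. g n s = 1"
        unfolding g_def by (intro eventually_sequentiallyI[of N]) (auto intro: order.trans)
      then show "(\<lambda>n. g n s) \<longlonglongrightarrow> 1" by (rule tendsto_eventually)
    qed
    ultimately show ?thesis
      unfolding closure_sequential Phi_one by (intro exI[of _ "\<lambda>n. Phi (g n) y"]) simp
  qed
  then show ?thesis by auto
qed

section \<open>Operators represented by a spectral measure\<close>

text \<open>The diagonal values fix the operator: polarization on the common domain extends them to
  \<open>cinner z (oap T x)\<close>, and the domain is dense.\<close>

lemma represents_imp:
  assumes \<phi>: "\<phi> \<in> borel_measurable borel" and T: "represents E \<phi> T"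
  shows "odom T = sdom \<phi>" "x \<in> sdom \<phi> \<Longrightarrow> oap T x = sint \<phi> x"
proof -
  show dom: "odom T = sdom \<phi>" using T unfolding represents_def sdom_def by blast
  assume x: "x \<in> sdom \<phi>"
  have lin: "linear_op T" using T unfolding represents_def by blast
  show "oap T x = sint \<phi> x"
  proof (rule cinner_ext_dense[OF dense_sdom[OF \<phi>]])
    fix z assume z: "z \<in> sdom \<phi>"
    show "cinner z (oap T x) = cinner z (sint \<phi> x)"
    proof (rule form_eq_imp_cinner_eq[OF csubspace_sdom[OF \<phi>] _ _ _ _ _ z x])
      fix u assume u: "u \<in> sdom \<phi>"
      show "cinner u (oap T u) = cinner u (sint \<phi> u)"
        using T u sint_repr[OF \<phi> u] unfolding represents_def dom by simp
    qed (use lin dom in \<open>auto simp: linear_opD sint_add(2)[OF \<phi>] sint_scaleC(2)[OF \<phi>]\<close>)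
  qed
qed

lemma representsI:
  assumes \<phi>: "\<phi> \<in> borel_measurable borel" and dom: "odom T = sdom \<phi>"
    and eq: "\<And>x. x \<in> sdom \<phi> \<Longrightarrow> oap T x = sint \<phi> x"
  shows "represents E \<phi> T"
  unfolding represents_def
proof (intro conjI ballI)
  show "linear_op T"
    unfolding linear_op_def dom
    using zero_in_sdom[OF \<phi>] sint_add[OF \<phi>] sint_scaleC[OF \<phi>] by (auto simp: eq)
  fix x assume "x \<in> odom T"
  then show "cinner x (oap T x) = (\<integral>s. \<phi> s \<partial>smeas E x)"
    using sint_repr[OF \<phi>] by (simp add: dom eq)
qed (simp add: dom sdom_def)

lemma represents_sint:
  assumes \<phi>: "\<phi> \<in> borel_measurable borel"
  shows "represents E \<phi> (sdom \<phi>, \<lambda>x. if x \<in> sdom \<phi> then sint \<phi> x else 0)"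
  by (rule representsI[OF \<phi>]) (simp_all add: odom_def oap_def)

text \<open>The prescribed value 0 off the domain makes the definite description denote one pair of
  a set and a total function, not merely one operator.\<close>

lemma fcalc_eqI:
  assumes E: "spectral_resolution A = E" and \<phi>: "\<phi> \<in> borel_measurable borel"
  shows "fcalc A \<phi> = (sdom \<phi>, \<lambda>x. if x \<in> sdom \<phi> then sint \<phi> x else 0)"
  unfolding fcalc_def E
proof (rule the_equality)
  fix T assume T: "represents E \<phi> T \<and> (\<forall>x. x \<notin> odom T \<longrightarrow> oap T x = 0)"
  have "fst T = sdom \<phi>" using represents_imp(1)[OF \<phi>] T unfolding odom_def by blast
  moreover have "snd T = (\<lambda>x. if x \<in> sdom \<phi> then sint \<phi> x else 0)"
  proof
    fix x
    show "snd T x = (if x \<in> sdom \<phi> then sint \<phi> x else 0)"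
      using represents_imp(1)[OF \<phi> conjunct1[OF T]] represents_imp(2)[OF \<phi> conjunct1[OF T], of x] conjunct2[OF T] unfolding oap_def by simp
  qed
  ultimately show "T = (sdom \<phi>, \<lambda>x. if x \<in> sdom \<phi> then sint \<phi> x else 0)"
    by (simp add: prod_eq_iff)
qed (use represents_sint[OF \<phi>] in \<open>auto simp: odom_def oap_def\<close>)

lemma represents_fcalc:
  assumes "spectral_resolution A = E" "\<phi> \<in> borel_measurable borel"
  shows "represents E \<phi> (fcalc A \<phi>)"
  unfolding fcalc_eqI[OF assms] by (rule represents_sint[OF assms(2)])

lemma bounded_sint:
  assumes \<phi>: "bounded_borel \<phi>"
  shows "sdom \<phi> = UNIV" "sint \<phi> x = Phi \<phi> x"
proof -
  have m: "\<phi> \<in> borel_measurable borel" using \<phi> by (rule bounded_borel_measurable)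
  have "y \<in> sdom \<phi> \<and> sint \<phi> y = Phi \<phi> y" for y
    using sint_Phi[OF m, of "\<lambda>_. 1" y] \<phi> by (simp add: Phi_one)
  then show "sdom \<phi> = UNIV" "sint \<phi> x = Phi \<phi> x" by auto
qed

end

section \<open>Uniqueness of spectral measures\<close>

text \<open>Maps the line onto the unit circle without 1. It trades the unbounded coordinate for a
  bounded function whose conjugate is its inverse, so that all its moments exist.\<close>

definition cay :: "real \<Rightarrow> complex" where
  "cay s = (complex_of_real s - \<i>) / (complex_of_real s + \<i>)"

lemma real_plus_i_nonzero [simp]: "complex_of_real s + \<i> \<noteq> 0" "\<i> + complex_of_real s \<noteq> 0"
  "complex_of_real s \<noteq> \<i>" "\<i> \<noteq> complex_of_real s"
  by (simp_all add: complex_eq_iff)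

lemma cay_eq: "cay s = 1 + (- 2 * \<i>) * (1 / (complex_of_real s + \<i>))"
proof -
  have "cay s = (complex_of_real s + \<i> - 2 * \<i>) / (complex_of_real s + \<i>)"
    by (simp add: cay_def)
  also have "\<dots> = 1 - 2 * \<i> / (complex_of_real s + \<i>)"
    by (simp only: diff_divide_distrib) simp
  finally show ?thesis by simp
qed

lemma cnj_cay: "cnj (cay s) = (complex_of_real s + \<i>) / (complex_of_real s - \<i>)"
  by (simp add: cay_def)

lemma cay_mult_cnj [simp]: "cay s * cnj (cay s) = 1" "cnj (cay s) * cay s = 1"
  unfolding cnj_cay unfolding cay_def by simp_all

lemma cmod_cay [simp]: "cmod (cay s) = 1"
proof -
  have "cmod (complex_of_real s - \<i>) = cmod (complex_of_real s + \<i>)"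
    by (simp add: cmod_def)
  then show ?thesis by (simp add: cay_def norm_divide)
qed

lemma bounded_borel_cay [simp, intro]: "bounded_borel cay"
proof (rule bounded_borelI[of _ 1])
  show "cay \<in> borel_measurable borel" unfolding cay_def[abs_def] by simp
qed simp

definition res_i :: "real \<Rightarrow> complex" where
  "res_i s = 1 / (complex_of_real s + \<i>)"

lemma cmod_res_i: "cmod (res_i s) \<le> 1" "cmod (res_i s * complex_of_real s) \<le> 1"
proof -
  have c: "cmod (complex_of_real s + \<i>) = sqrt (s\<^sup>2 + 1)" by (simp add: cmod_def)
  have "1 \<le> sqrt (s\<^sup>2 + 1)" "\<bar>s\<bar> \<le> sqrt (s\<^sup>2 + 1)" by (auto intro: real_le_rsqrt)
  then show "cmod (res_i s) \<le> 1" "cmod (res_i s * complex_of_real s) \<le> 1"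
    unfolding res_i_def norm_mult norm_divide c by (auto simp: divide_le_eq add_nonneg_pos)
qed

lemma bounded_borel_res_i [simp, intro]:
  "bounded_borel res_i" "bounded_borel (\<lambda>s. res_i s * complex_of_real s)"
proof -
  have [measurable]: "res_i \<in> borel_measurable borel" unfolding res_i_def[abs_def] by simp
  show "bounded_borel res_i" "bounded_borel (\<lambda>s. res_i s * complex_of_real s)"
    by (rule bounded_borelI[OF _ cmod_res_i(1)], simp) (rule bounded_borelI[OF _ cmod_res_i(2)], simp)
qed

lemma adj_pow:
  assumes "adj F G"
  shows "adj (F ^^ n) (G ^^ n)"
proof (induction n)
  case (Suc n)
  then show ?case using assms unfolding adj_def by (simp add: funpow_swap1)
qed (simp add: adj_def)

section \<open>The sign function as a limit of polynomials\<close>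

text \<open>The Newton-Schulz iteration for the sign. It is a polynomial map preserving [-1, 1], so
  an algebra closed under bounded pointwise limits that contains a real f with values there also
  contains sgn f.\<close>

definition newton_sgn :: "real \<Rightarrow> real" where
  "newton_sgn x = x * (3 - x\<^sup>2) / 2"

lemma newton_sgn_minus: "(newton_sgn ^^ n) (- x) = - (newton_sgn ^^ n) x"
  by (induction n) (simp_all add: newton_sgn_def)

lemma newton_sgn_bounds:
  assumes "0 \<le> x" "x \<le> 1"
  shows "x \<le> newton_sgn x" "newton_sgn x \<le> 1"
proof -
  have "x * x\<^sup>2 \<le> x * 1" using assms by (intro mult_left_mono) (auto simp: power_le_one)
  then show "x \<le> newton_sgn x" by (simp add: newton_sgn_def algebra_simps)
  have "1 - newton_sgn x = (1 - x)\<^sup>2 * (2 + x) / 2"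
    by (simp add: newton_sgn_def power2_eq_square field_simps)
  also have "\<dots> \<ge> 0" using assms by simp
  finally show "newton_sgn x \<le> 1" by simp
qed

lemma newton_sgn_pow_bounds: "0 \<le> x \<Longrightarrow> x \<le> 1 \<Longrightarrow> x \<le> (newton_sgn ^^ n) x \<and> (newton_sgn ^^ n) x \<le> 1"
proof (induction n)
  case (Suc n)
  then show ?case
    using newton_sgn_bounds[of "(newton_sgn ^^ n) x"] by auto
qed simp

lemma abs_newton_sgn_pow_le:
  assumes "\<bar>x\<bar> \<le> 1"
  shows "\<bar>(newton_sgn ^^ n) x\<bar> \<le> 1"
proof (cases "x \<ge> 0")
  case True
  then show ?thesis using newton_sgn_pow_bounds[of x n] assms by auto
next
  case False
  then show ?thesis
    using newton_sgn_pow_bounds[of "- x" n] assms unfolding newton_sgn_minus by auto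
qed

text \<open>The iterates increase and stay below 1, so they converge to a positive fixed point, and
  1 is the only one.\<close>

lemma newton_sgn_tendsto_pos:
  assumes "0 < x" "x \<le> 1"
  shows "(\<lambda>n. (newton_sgn ^^ n) x) \<longlonglongrightarrow> 1"
proof -
  let ?f = "\<lambda>n. (newton_sgn ^^ n) x"
  have b: "x \<le> ?f n" "?f n \<le> 1" for n using newton_sgn_pow_bounds[of x n] assms by auto
  have "incseq ?f"
  proof (rule incseq_SucI)
    fix n
    show "?f n \<le> ?f (Suc n)"
      using newton_sgn_bounds(1)[of "?f n"] b[of n] assms by simp
  qed
  then obtain L where L: "?f \<longlonglongrightarrow> L"
    by (rule incseq_convergent[of ?f 1]) (use b in auto)
  have "isCont newton_sgn L"
    unfolding newton_sgn_def[abs_def] by (intro continuous_intros) auto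
  then have "(\<lambda>n. newton_sgn (?f n)) \<longlonglongrightarrow> newton_sgn L"
    using L by (rule isCont_tendsto_compose)
  moreover have "(\<lambda>n. newton_sgn (?f n)) \<longlonglongrightarrow> L"
    using LIMSEQ_Suc[OF L] by simp
  ultimately have eq: "newton_sgn L = L" by (rule LIMSEQ_unique)
  have "x \<le> L" by (rule Lim_bounded2[OF L, of 0]) (auto simp: b)
  then have "L > 0" using assms by simp
  from eq have "L * (1 - L\<^sup>2) = 0" by (simp add: newton_sgn_def algebra_simps)
  with \<open>L > 0\<close> have "L\<^sup>2 = 1\<^sup>2" by simp
  then have "L = 1" by (rule power2_eq_imp_eq) (use \<open>L > 0\<close> in auto)
  then show ?thesis using L by simp
qed

lemma newton_sgn_tendsto:
  assumes "\<bar>x\<bar> \<le> 1"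
  shows "(\<lambda>n. (newton_sgn ^^ n) x) \<longlonglongrightarrow> sgn x"
proof (cases x "0::real" rule: linorder_cases)
  case less
  then have "(\<lambda>n. - (newton_sgn ^^ n) (- x)) \<longlonglongrightarrow> - 1"
    using assms by (intro tendsto_minus newton_sgn_tendsto_pos) auto
  then show ?thesis using less by (simp add: newton_sgn_minus)
next
  case equal
  have "(newton_sgn ^^ n) 0 = 0" for n by (induction n) (auto simp: newton_sgn_def)
  then show ?thesis using equal by simp
next
  case greater
  then show ?thesis using newton_sgn_tendsto_pos[of x] assms by simp
qed

section \<open>Rebuilding a spectral measure from Cayley moments\<close>

text \<open>A set of measures, because neither existence nor uniqueness of a measure with these
  moments is known at this point.\<close>

definition cay_measures :: "('a::complex_hilbert \<Rightarrow> 'a) \<Rightarrow> ('a \<Rightarrow> 'a) \<Rightarrow> 'a \<Rightarrow> real measure set" where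
  "cay_measures U U' x = {M. finite_measure M \<and> sets M = sets borel \<and>
     (\<forall>m n. (\<integral>s. cay s ^ m * cnj (cay s) ^ n \<partial>M) = cinner x ((U ^^ m) ((U' ^^ n) x)))}"

text \<open>Serves twice: for uniqueness, with \<open>U\<close> taken from a given spectral measure,
  and for existence, with \<open>U\<close> the Cayley transform of an operator.\<close>

locale cayley =
  fixes U U' :: "'a::complex_hilbert \<Rightarrow> 'a"
  assumes bop_U: "bop U" and bop_U': "bop U'" and adj_U: "adj U U'"
    and UU': "U (U' x) = x" and U'U: "U' (U x) = x"
    and K_ne: "cay_measures U U' x \<noteq> {}"
begin

abbreviation K :: "'a \<Rightarrow> real measure set" where "K \<equiv> cay_measures U U'"

lemmas K_def = cay_measures_def

lemma pow_commute: "(U' ^^ n) ((U ^^ m) x) = (U ^^ m) ((U' ^^ n) x)"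
proof (induction n arbitrary: x)
  case (Suc n)
  have "U' ((U ^^ m) x) = (U ^^ m) (U' x)" for x
  proof (induction m)
    case (Suc m)
    have "(U ^^ m) x = (U ^^ m) (U (U' x))" by (simp add: UU')
    also have "\<dots> = U ((U ^^ m) (U' x))" by (simp add: funpow_swap1)
    finally show ?case by (simp add: U'U)
  qed simp
  then show ?case by (simp only: funpow_Suc_right o_apply Suc)
qed simp

sublocale op_calculus "{(\<lambda>s. cay s ^ m * cnj (cay s) ^ n, \<lambda>x. (U ^^ m) ((U' ^^ n) x)) | m n. True}" K
proof (rule op_calculus.intro, goal_cases)
  case (1 x)
  show ?case by (rule K_ne)
next
  case (2 M x)
  then show ?case by (simp add: K_def)
next
  case (3 M x)
  then show ?case by (simp add: K_def)
next
  case 4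
  show ?case by (rule CollectI, rule exI[of _ 0], rule exI[of _ 0]) simp
next
  case (5 e V e' V')
  then obtain m n m' n' where e: "e = (\<lambda>s. cay s ^ m * cnj (cay s) ^ n)" "V = (\<lambda>x. (U ^^ m) ((U' ^^ n) x))"
    and e': "e' = (\<lambda>s. cay s ^ m' * cnj (cay s) ^ n')" "V' = (\<lambda>x. (U ^^ m') ((U' ^^ n') x))"
    by blast
  have "(\<lambda>s. e s * e' s) = (\<lambda>s. cay s ^ (m + m') * cnj (cay s) ^ (n + n'))"
    unfolding e e' by (simp add: power_add mult_ac)
  moreover have "(\<lambda>x. V (V' x)) = (\<lambda>x. (U ^^ (m + m')) ((U' ^^ (n + n')) x))"
    unfolding e e' by (simp add: funpow_add pow_commute)
  ultimately show ?case by (intro CollectI exI[of _ "m + m'"] exI[of _ "n + n'"]) simp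
next
  case (6 e V)
  then obtain m n where e: "e = (\<lambda>s. cay s ^ m * cnj (cay s) ^ n)" "V = (\<lambda>x. (U ^^ m) ((U' ^^ n) x))"
    by blast
  have "adj V (\<lambda>x. (U ^^ n) ((U' ^^ m) x))"
    unfolding e using adj_pow[OF adj_U, of m] adj_pow[OF adj_sym[OF adj_U], of n]
    by (simp add: adj_def)
  moreover have "(\<lambda>s. cnj (e s)) = (\<lambda>s. cay s ^ n * cnj (cay s) ^ m)"
    unfolding e by (simp add: mult.commute)
  ultimately show ?case
    by (intro exI[of _ "\<lambda>x. (U ^^ n) ((U' ^^ m) x)"] conjI CollectI exI[of _ n] exI[of _ m]) simp_all
next
  case (7 e V)
  then obtain m n where e: "e = (\<lambda>s. cay s ^ m * cnj (cay s) ^ n)" by blast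
  have [measurable]: "cay \<in> borel_measurable borel"
    by (rule bounded_borel_measurable[OF bounded_borel_cay])
  have [measurable]: "(\<lambda>s. cnj (cay s)) \<in> borel_measurable borel"
    by (rule bounded_borel_measurable[OF bounded_borel_cnj[OF bounded_borel_cay]])
  show ?case
    unfolding e by (rule bounded_borelI[of _ 1]) (auto simp: norm_mult norm_power)
next
  case (8 e V)
  then show ?case using bop_comp[OF bop_pow[OF bop_U] bop_pow[OF bop_U']] by auto
next
  case (9 e V M x)
  then show ?case by (auto simp: K_def)
qed

lemma good_one: "good (\<lambda>_. 1) (\<lambda>x. x)"
  by (rule good_gen[OF gens_one])

lemma good_cay: "good cay U"
  by (rule good_gen, rule CollectI, rule exI[of _ 1], rule exI[of _ 0]) auto

lemma good_res_i: "\<exists>F. good res_i F"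
proof -
  have "res_i = (\<lambda>s. (- \<i> / 2) * 1 + (\<i> / 2) * cay s)"
    by (rule ext, unfold cay_eq, fold res_i_def) (simp add: algebra_simps)
  then show ?thesis using good_lin_comb[OF good_one good_cay, of "- \<i> / 2" "\<i> / 2"] by metis
qed

lemma good_newton:
  assumes "good (\<lambda>s. complex_of_real (f s)) F"
  shows "\<exists>G. good (\<lambda>s. complex_of_real ((newton_sgn ^^ n) (f s))) G"
proof (induction n)
  case (Suc n)
  let ?g = "\<lambda>s. complex_of_real ((newton_sgn ^^ n) (f s))"
  from Suc obtain G where G: "good ?g G" by blast
  have "(\<lambda>s. complex_of_real ((newton_sgn ^^ Suc n) (f s))) = (\<lambda>s. (3/2) * ?g s + (-1/2) * (?g s * (?g s * ?g s)))"
    by (simp add: newton_sgn_def power2_eq_square algebra_simps diff_divide_distrib)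
  then show ?case
    using good_lin_comb[OF G good_mult[OF G good_mult[OF G G]], of "3/2" "-1/2"] by metis
qed (use assms in auto)

text \<open>The function \<open>sgn (s - a)\<close> is a limit of Newton iterates of a function in
  the span of \<open>res_i\<close> and its conjugate, and the indicator is a polynomial in that
  sign.\<close>

lemma good_greaterThan: "\<exists>F. good (indicator {a<..}) F"
proof -
  obtain F where F: "good res_i F" using good_res_i by blast
  obtain F' where F': "good (\<lambda>s. cnj (res_i s)) F'" using good_cnj[OF F] by blast
  \<comment> \<open>\<open>p\<close> has the sign of \<open>s - a\<close>. The factor 1 + s^2 is the
    product of the denominators of \<open>res_i s\<close> and its conjugate; 1 + |a| brings the
    values into [-1, 1].\<close>
  define p where "p s = (s - a) / ((1 + s\<^sup>2) * (1 + \<bar>a\<bar>))" for s :: real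
  \<comment> \<open>Partial fraction coefficients of \<open>p\<close> at its poles -\<i> and
    \<i>.\<close>
  define \<alpha> \<beta> where "\<alpha> = (1 / 2 - \<i> * a / 2) / complex_of_real (1 + \<bar>a\<bar>)"
    and "\<beta> = (1 / 2 + \<i> * a / 2) / complex_of_real (1 + \<bar>a\<bar>)"
  have p: "complex_of_real (p s) = \<alpha> * res_i s + \<beta> * cnj (res_i s)" for s
  proof -
    define N where "N = (complex_of_real s + \<i>) * (complex_of_real s - \<i>)"
    define A where "A = complex_of_real (1 + \<bar>a\<bar>)"
    have "complex_of_real (1 + s\<^sup>2) = N"
      unfolding N_def by (simp add: algebra_simps power2_eq_square)
    then have "complex_of_real (p s) = (complex_of_real s - a) / (N * A)"
      unfolding p_def A_def by (simp del: of_real_add)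
    also have "complex_of_real s - a
        = (1 / 2 - \<i> * a / 2) * (complex_of_real s - \<i>) + (1 / 2 + \<i> * a / 2) * (complex_of_real s + \<i>)"
      by (simp add: field_simps)
    also have "\<dots> / (N * A) = \<alpha> * ((complex_of_real s - \<i>) / N) + \<beta> * ((complex_of_real s + \<i>) / N)"
      unfolding \<alpha>_def \<beta>_def A_def[symmetric] by (simp only: times_divide_times_eq mult.commute[of N A] add_divide_distrib[symmetric])
    also have "\<dots> = \<alpha> * res_i s + \<beta> * cnj (res_i s)"
      unfolding N_def res_i_def by simp
    finally show ?thesis .
  qed
  have p1: "\<bar>p s\<bar> \<le> 1" for s
  proof -
    have "\<bar>s\<bar> \<le> 1 + s\<^sup>2" using sum_squares_bound[of "\<bar>s\<bar>" 1] by simp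
    moreover have "0 \<le> s\<^sup>2 * \<bar>a\<bar>" by simp
    ultimately have "\<bar>s - a\<bar> \<le> (1 + s\<^sup>2) * (1 + \<bar>a\<bar>)"
      unfolding distrib_left distrib_right by linarith
    moreover have "0 < (1 + s\<^sup>2) * (1 + \<bar>a\<bar>)"
      by (intro mult_pos_pos add_pos_nonneg) auto
    ultimately show ?thesis unfolding p_def abs_divide by (simp add: divide_le_eq)
  qed
  have sgn_p: "sgn (p s) = sgn (s - a)" for s
    unfolding p_def by (simp add: sgn_divide sgn_mult add_pos_nonneg)
  have "(\<lambda>s. complex_of_real (p s)) = (\<lambda>s. \<alpha> * res_i s + \<beta> * cnj (res_i s))"
    using p by auto
  then have "good (\<lambda>s. complex_of_real (p s)) (\<lambda>x. scaleC \<alpha> (F x) + scaleC \<beta> (F' x))"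
    using good_lin_comb[OF F F', of \<alpha> \<beta>] by simp
  then have "\<exists>G. good (\<lambda>s. complex_of_real ((newton_sgn ^^ n) (p s))) G" for n
    by (rule good_newton)
  then have "\<exists>G. \<forall>n. good (\<lambda>s. complex_of_real ((newton_sgn ^^ n) (p s))) (G n)"
    by (intro choice allI)
  then obtain G where G: "\<And>n. good (\<lambda>s. complex_of_real ((newton_sgn ^^ n) (p s))) (G n)" by blast
  have "\<exists>H. good (\<lambda>s. complex_of_real (sgn (s - a))) H"
  proof (rule good_limit[OF G, where C = 1])
    fix n s
    show "cmod (complex_of_real ((newton_sgn ^^ n) (p s))) \<le> 1"
      using abs_newton_sgn_pow_le[OF p1] by simp
    show "(\<lambda>n. complex_of_real ((newton_sgn ^^ n) (p s))) \<longlonglongrightarrow> complex_of_real (sgn (s - a))"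
      using newton_sgn_tendsto[OF p1] unfolding sgn_p[symmetric] by (intro tendsto_of_real)
  qed (rule exI)
  then obtain H where H: "good (\<lambda>s. complex_of_real (sgn (s - a))) H" by blast
  \<comment> \<open>The polynomial (x + x^2) / 2 sends -1, 0, 1 to 0, 0, 1, which leaves out the
    point \<open>a\<close> itself.\<close>
  have "(\<lambda>s. (1/2) * complex_of_real (sgn (s - a)) + (1/2) * (complex_of_real (sgn (s - a)) * complex_of_real (sgn (s - a))))
      = indicator {a<..}"
    by (auto simp: sgn_if indicator_def)
  then show ?thesis
    using good_lin_comb[OF H good_mult[OF H H], of "1/2" "1/2"] by metis
qed

text \<open>As products are available, the sets with a good indicator form a sigma-algebra outright:
  finite unions by inclusion and exclusion, countable ones by bounded limits.\<close>

lemma good_indicator_ex: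
  assumes "S \<in> sets borel"
  shows "\<exists>F. good (indicator S) F"
proof -
  have "S \<in> sigma_sets UNIV (range greaterThan)"
  proof -
    have "sets (borel :: real measure) = sigma_sets UNIV (range greaterThan)"
      by (subst borel_Ioi) simp
    with assms show ?thesis by simp
  qed
  then show ?thesis
  proof induction
    case (Basic S)
    then show ?case using good_greaterThan by blast
  next
    case Empty
    have "(\<lambda>s. 0 * 1 + 0 * 1) = (indicator {} :: real \<Rightarrow> complex)" by auto
    then show ?case using good_lin_comb[OF good_one good_one, of 0 0] by metis
  next
    case (Compl S)
    then obtain F where F: "good (indicator S) F" by blast
    have "(\<lambda>s. 1 * 1 + (-1) * indicator S s) = (indicator (UNIV - S) :: real \<Rightarrow> complex)"
      by (auto simp: indicator_def)
    then show ?case using good_lin_comb[OF good_one F, of 1 "-1"] by metis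
  next
    case (Union A)
    have fin: "\<exists>F. good (indicator (\<Union>i<n. A i)) F" for n :: nat
    proof (induction n)
      case 0
      have "(\<lambda>s. 0 * 1 + 0 * 1) = (indicator (\<Union>i<0::nat. A i) :: real \<Rightarrow> complex)" by auto
      then show ?case using good_lin_comb[OF good_one good_one, of 0 0] by metis
    next
      case (Suc n)
      then obtain F G where FG: "good (indicator (\<Union>i<n. A i)) F" "good (indicator (A n)) G"
        using Union.IH by blast
      have "(\<lambda>s. 1 * (1 * indicator (\<Union>i<n. A i) s + 1 * indicator (A n) s)
            + (-1) * (indicator (\<Union>i<n. A i) s * indicator (A n) s))
          = (indicator (\<Union>i<Suc n. A i) :: real \<Rightarrow> complex)"
        by (auto simp: indicator_def less_Suc_eq fun_eq_iff)
      then show ?case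
        using good_lin_comb[OF good_lin_comb[OF FG, of 1 1] good_mult[OF FG], of 1 "-1"] by metis
    qed
    have "\<exists>F. \<forall>n. good (indicator (\<Union>i<n. A i)) (F n)"
      by (intro choice allI fin)
    then obtain F where F: "\<And>n. good (indicator (\<Union>i<n. A i)) (F n)" by blast
    show ?case
    proof (rule good_limit[OF F, where C = 1])
      fix n s
      show "cmod (indicator (\<Union>i<n. A i) s) \<le> 1" by (simp add: indicator_def)
      show "(\<lambda>n. indicator (\<Union>i<n. A i) s) \<longlonglongrightarrow> (indicator (\<Union>i. A i) s :: complex)"
        by (rule LIMSEQ_indicator_UN)
    qed (rule exI)
  qed
qed

text \<open>The zero value off the Borel sets matches \<open>is_pvm\<close>, where it makes a
  spectral measure unique as a function on all sets.\<close>

definition E :: "real set \<Rightarrow> 'a \<Rightarrow> 'a" where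
  "E S = (if S \<in> sets borel then (THE F. good (indicator S) F) else (\<lambda>_. 0))"

lemma good_E: "S \<in> sets borel \<Longrightarrow> good (indicator S) (E S)"
proof -
  assume S: "S \<in> sets borel"
  then obtain F where F: "good (indicator S) F" using good_indicator_ex by blast
  have "(THE F. good (indicator S) F) = F"
    by (rule the_equality) (rule F, rule good_unique[OF _ F])
  then show ?thesis using F S unfolding E_def by simp
qed

lemma E_eqI: "S \<in> sets borel \<Longrightarrow> good (indicator S) F \<Longrightarrow> E S = F"
  by (rule good_unique[OF good_E])

lemma is_pvm_E: "is_pvm E"
  unfolding is_pvm_def
proof (intro conjI allI ballI impI)
  fix S :: "real set" assume "S \<notin> sets borel"
  then show "E S = (\<lambda>_. 0)" by (simp add: E_def)
next
  fix S :: "real set" and x y c assume S: "S \<in> sets borel"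
  show "E S (x + y) = E S x + E S y" "E S (scaleC c x) = scaleC c (E S x)"
    using bop_add[OF good_bop[OF good_E[OF S]]] bop_scaleC[OF good_bop[OF good_E[OF S]]] by auto
  obtain F' where F': "adj (E S) F'" "good (\<lambda>s. cnj (indicator S s)) F'"
    using good_cnj[OF good_E[OF S]] .
  have "(\<lambda>s. cnj (indicator S s)) = indicator S" by (auto simp: indicator_def)
  then have "F' = E S" using F'(2) E_eqI[OF S] by simp
  then show "cinner (E S x) y = cinner x (E S y)" using adjD[OF F'(1)] by simp
  have "(\<lambda>s. indicator S s * indicator S s) = (indicator S :: real \<Rightarrow> complex)"
    by (auto simp: indicator_def)
  then have "E S = (\<lambda>x. E S (E S x))"
    using good_mult[OF good_E[OF S] good_E[OF S]] by (intro E_eqI[OF S]) simp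
  then show "E S (E S x) = E S x" by (rule fun_cong[OF sym])
next
  have "(\<lambda>_. 1) = (indicator UNIV :: real \<Rightarrow> complex)" by auto
  then have "E UNIV = (\<lambda>x. x)" using good_one by (intro E_eqI) auto
  then show "E UNIV = id" by auto
next
  fix S T :: "real set" assume S: "S \<in> sets borel" and T: "T \<in> sets borel"
  have "(\<lambda>s. indicator S s * indicator T s) = (indicator (S \<inter> T) :: real \<Rightarrow> complex)"
    by (auto simp: indicator_def)
  then have "E (S \<inter> T) = (\<lambda>x. E S (E T x))"
    using good_mult[OF good_E[OF S] good_E[OF T]] S T by (intro E_eqI) auto
  then show "E (S \<inter> T) = E S \<circ> E T" by (simp add: comp_def)
next
  fix F :: "nat \<Rightarrow> real set" and x assume F: "range F \<subseteq> sets borel" "disjoint_family F"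
  have Fb: "F n \<in> sets borel" for n using F by auto
  have good_sum: "good (indicator (\<Union>k<n. F k)) (\<lambda>x. \<Sum>k<n. E (F k) x)" for n
  proof (induction n)
    case 0
    have "(\<lambda>s. 0 * 1 + 0 * 1) = (indicator (\<Union>k<0::nat. F k) :: real \<Rightarrow> complex)" by auto
    then show ?case using good_lin_comb[OF good_one good_one, of 0 0] by simp
  next
    case (Suc n)
    have "(\<lambda>s. 1 * indicator (\<Union>k<n. F k) s + 1 * indicator (F n) s)
        = (indicator (\<Union>k<Suc n. F k) :: real \<Rightarrow> complex)"
    proof
      fix s
      have "s \<notin> F n" if "k < n" "s \<in> F k" for k
      proof -
        have "F k \<inter> F n = {}" by (rule disjoint_family_onD[OF F(2)]) (use that in auto)
        then show ?thesis using that(2) by blast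
      qed
      then have "s \<in> (\<Union>k<n. F k) \<Longrightarrow> s \<notin> F n" by blast
      then show "1 * indicator (\<Union>k<n. F k) s + 1 * indicator (F n) s
          = (indicator (\<Union>k<Suc n. F k) s :: complex)"
        unfolding lessThan_Suc UN_insert
        by (cases "s \<in> F n"; cases "s \<in> (\<Union>k<n. F k)") (simp_all add: indicator_def del: UN_iff)
    qed
    then show ?case
      using good_lin_comb[OF Suc good_E[OF Fb], of 1 1 n] by (simp add: scaleC_one)
  qed
  obtain G where G: "good (indicator (\<Union>n. F n)) G" "\<And>x. (\<lambda>n. \<Sum>k<n. E (F k) x) \<longlonglongrightarrow> G x"
  proof (rule good_limit[OF good_sum, where C = 1])
    fix n s
    show "cmod (indicator (\<Union>i<n. F i) s) \<le> 1" by (simp add: indicator_def)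
    show "(\<lambda>n. indicator (\<Union>i<n. F i) s) \<longlonglongrightarrow> (indicator (\<Union>i. F i) s :: complex)"
      by (rule LIMSEQ_indicator_UN)
  qed (rule that)
  have "E (\<Union>n. F n) = G" using Fb by (intro E_eqI G) auto
  then show "(\<lambda>n. \<Sum>k<n. E (F k) x) \<longlonglongrightarrow> E (\<Union>n. F n) x" using G(2) by simp
qed

lemma cinner_E_eq_measure:
  assumes M: "M \<in> K x" and S: "S \<in> sets borel"
  shows "cinner x (E S x) = complex_of_real (measure M S)"
proof -
  interpret finite_measure M using M by (simp add: K_def)
  have [simp]: "sets M = sets borel" using M by (simp add: K_def)
  have "cinner x (E S x) = (\<integral>s. complex_of_real (indicator S s) \<partial>M)"
    using good_repr[OF good_E[OF S] M] by (simp add: of_real_indicator)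
  also have "\<dots> = complex_of_real (measure M S)"
    using S by (subst integral_complex_of_real) simp
  finally show ?thesis .
qed

lemma pvm_E: "pvm E"
  by (rule pvm.intro) (rule is_pvm_E)

text \<open>\<open>E\<close> was built without choosing a measure, yet every member of
  \<open>K x\<close> computes it. Hence Cayley moments determine a finite measure.\<close>

lemma smeas_E:
  assumes M: "M \<in> K x"
  shows "smeas E x = M"
proof (rule measure_eqI)
  interpret finite_measure M using M by (simp add: K_def)
  show "sets (smeas E x) = sets M" using M by (simp add: K_def pvm.sets_smeas[OF pvm_E])
  fix S assume "S \<in> sets (smeas E x)"
  then have S: "S \<in> sets borel" by (simp add: pvm.sets_smeas[OF pvm_E])
  have "complex_of_real ((norm (E S x))\<^sup>2) = complex_of_real (measure M S)"
    using pvm.E_norm_sq_complex[OF pvm_E S] cinner_E_eq_measure[OF M S] by simp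
  then have "(norm (E S x))\<^sup>2 = measure M S" by (simp only: of_real_eq_iff)
  then show "emeasure (smeas E x) S = emeasure M S"
    by (simp add: pvm.emeasure_smeas[OF pvm_E S] emeasure_eq_measure)
qed

lemma Phi_E_cay: "pvm.Phi E cay = U"
proof (rule bop_eqI[OF pvm.bop_Phi[OF pvm_E] bop_U])
  fix x
  obtain M where M: "M \<in> K x" using K_ne by blast
  show "cinner x (pvm.Phi E cay x) = cinner x (U x)"
    using pvm.Phi_repr[OF pvm_E bounded_borel_cay, of x] good_repr[OF good_cay M] unfolding smeas_E[OF M] by simp
qed simp

end

section \<open>Uniqueness of the spectral measure of an operator\<close>

lemma adj_unique: "adj F G \<Longrightarrow> adj F H \<Longrightarrow> G = H"
proof
  fix x assume "adj F G" "adj F H"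
  then show "G x = H x" unfolding adj_def by (intro cinner_ext) metis
qed

lemma (in pvm) Phi_cay_inverse:
  "Phi cay (Phi (\<lambda>s. cnj (cay s)) x) = x" "Phi (\<lambda>s. cnj (cay s)) (Phi cay x) = x"
  using Phi_mult[OF bounded_borel_cay bounded_borel_cnj[OF bounded_borel_cay], of x]
    Phi_mult[OF bounded_borel_cnj[OF bounded_borel_cay] bounded_borel_cay, of x]
  by (simp_all add: Phi_one)

lemma (in pvm) Phi_power:
  assumes "bounded_borel f"
  shows "bounded_borel (\<lambda>s. f s ^ n) \<and> Phi (\<lambda>s. f s ^ n) = Phi f ^^ n"
proof (induction n)
  case 0
  show ?case using Phi_one by (auto simp: id_def)
next
  case (Suc n)
  have "Phi (\<lambda>s. f s * f s ^ n) x = (Phi f ^^ Suc n) x" for x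
    using Phi_mult[OF assms conjunct1[OF Suc]] Suc by simp
  then show ?case using bounded_borel_mult[OF assms conjunct1[OF Suc]] by auto
qed

lemma (in pvm) cay_moments:
  "(\<integral>s. cay s ^ m * cnj (cay s) ^ n \<partial>smeas E x)
    = cinner x ((Phi cay ^^ m) ((Phi (\<lambda>s. cnj (cay s)) ^^ n) x))"
proof -
  note 1 = Phi_power[OF bounded_borel_cay, of m]
  note 2 = Phi_power[OF bounded_borel_cnj[OF bounded_borel_cay], of n]
  have "Phi (\<lambda>s. cay s ^ m * cnj (cay s) ^ n) x = (Phi cay ^^ m) ((Phi (\<lambda>s. cnj (cay s)) ^^ n) x)"
    using Phi_mult[OF conjunct1[OF 1] conjunct1[OF 2], of x] 1 2 by simp
  then show ?thesis
    using Phi_repr[OF bounded_borel_mult[OF conjunct1[OF 1] conjunct1[OF 2]], of x] by simp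
qed

text \<open>Equal Cayley operators give equal Cayley moments, so both scalar measures lie in one
  \<open>cay_measures\<close> set and coincide by \<open>smeas_E\<close>; polarization recovers the
  projections.\<close>

lemma pvm_eqI:
  assumes "is_pvm E1" "is_pvm E2" and eq: "pvm.Phi E1 cay = pvm.Phi E2 cay"
  shows "E1 = E2"
proof -
  interpret P1: pvm E1 by (rule pvm.intro) fact
  interpret P2: pvm E2 by (rule pvm.intro) fact
  \<comment> \<open>The operators of \<open>cnj (cay s)\<close> are the adjoints, so they agree as
    soon as the Cayley operators do.\<close>
  have eq': "P1.Phi (\<lambda>s. cnj (cay s)) = P2.Phi (\<lambda>s. cnj (cay s))"
    using P1.Phi_adj[OF bounded_borel_cay] P2.Phi_adj[OF bounded_borel_cay] adj_unique unfolding eq by blast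
  let ?K = "cay_measures (P1.Phi cay) (P1.Phi (\<lambda>s. cnj (cay s)))"
  have in1: "smeas E1 x \<in> ?K x" for x
    unfolding cay_measures_def using P1.finite_smeas P1.cay_moments by simp
  have in2: "smeas E2 x \<in> ?K x" for x
    unfolding cay_measures_def eq eq' using P2.finite_smeas P2.cay_moments by simp
  interpret C: cayley "P1.Phi cay" "P1.Phi (\<lambda>s. cnj (cay s))"
  proof
    fix x show "?K x \<noteq> {}" using in1 by blast
  qed (simp_all add: P1.bop_Phi P1.Phi_adj P1.Phi_cay_inverse bounded_borel_cnj)
  show ?thesis
  proof
    fix S
    show "E1 S = E2 S"
    proof (cases "S \<in> sets borel")
      case True
      show ?thesis
      proof (rule bop_eqI[OF P1.bop_E[OF True] P2.bop_E[OF True]])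
        fix x
        have "smeas E1 x = smeas E2 x"
          using C.smeas_E[OF in1] C.smeas_E[OF in2] by simp
        then show "cinner x (E1 S x) = cinner x (E2 S x)"
          using P1.measure_smeas[OF True, of x] P2.measure_smeas[OF True, of x]
            P1.E_norm_sq_complex[OF True, of x] P2.E_norm_sq_complex[OF True, of x] by simp
      qed
    next
      case False
      then show ?thesis using assms(1,2) unfolding is_pvm_def by simp
    qed
  qed
qed

lemma borel_measurable_of_real: "complex_of_real \<in> borel_measurable borel"
  by simp

lemma (in pvm) Phi_cay_eq: "Phi cay x = x - scaleC (2 * \<i>) (Phi res_i x)"
proof -
  have "cay = (\<lambda>s. 1 * 1 + (- 2 * \<i>) * res_i s)" by (auto simp: cay_eq res_i_def)
  then have "Phi cay x = Phi (\<lambda>s. 1 * 1 + (- 2 * \<i>) * res_i s) x" by simp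
  also have "\<dots> = x - scaleC (2 * \<i>) (Phi res_i x)"
    by (subst Phi_lin_comb) (auto simp: Phi_one scaleC_one scaleC_minus_left)
  finally show ?thesis .
qed

text \<open>\<open>Phi res_i\<close> is a two-sided inverse of T + \<i>. Such an inverse depends on
  the operator only, not on the spectral measure it was computed from.\<close>

lemma (in pvm) res_i_inverse:
  assumes T: "represents E complex_of_real T"
  shows "Phi res_i y \<in> odom T" "oap T (Phi res_i y) + scaleC \<i> (Phi res_i y) = y"
    "x \<in> odom T \<Longrightarrow> Phi res_i (oap T x + scaleC \<i> x) = x"
proof -
  note dom = represents_imp(1)[OF borel_measurable_of_real T]
  note ap = represents_imp(2)[OF borel_measurable_of_real T]
  note S = sint_Phi[OF borel_measurable_of_real bounded_borel_res_i, of y]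
  have sum: "(\<lambda>s. res_i s * complex_of_real s + \<i> * res_i s) = (\<lambda>_. 1)"
    by (rule ext) (simp add: res_i_def flip: add_divide_distrib)
  have key: "Phi (\<lambda>s. res_i s * complex_of_real s) z + scaleC \<i> (Phi res_i z) = z" for z
  proof -
    have "Phi (\<lambda>s. 1 * (res_i s * complex_of_real s) + \<i> * res_i s) z = z"
      using sum by (simp add: Phi_one)
    then show ?thesis
      by (subst (asm) Phi_lin_comb) (auto simp: scaleC_one)
  qed
  show "Phi res_i y \<in> odom T" using S(1) dom by simp
  show "oap T (Phi res_i y) + scaleC \<i> (Phi res_i y) = y"
    using ap[OF S(1)] S(2) key by simp
  assume "x \<in> odom T"
  then have x: "x \<in> sdom complex_of_real" by (simp add: dom)
  show "Phi res_i (oap T x + scaleC \<i> x) = x"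
    using Phi_sint[OF borel_measurable_of_real x bounded_borel_res_i] key[of x]
    by (simp add: ap[OF x] bop_add[OF bop_Phi] bop_scaleC[OF bop_Phi])
qed

text \<open>The operator fixes its resolvent \<open>Phi res_i\<close>, and \<open>Phi cay\<close> is
  an affine expression in it.\<close>

theorem spectral_measure_unique:
  assumes E: "is_pvm E1" "is_pvm E2"
    and T: "represents E1 complex_of_real T" "represents E2 complex_of_real T"
  shows "E1 = E2"
proof (rule pvm_eqI[OF E])
  interpret P1: pvm E1 by (rule pvm.intro) fact
  interpret P2: pvm E2 by (rule pvm.intro) fact
  have "P1.Phi res_i y = P2.Phi res_i y" for y
    using P1.res_i_inverse(3)[OF T(1) P2.res_i_inverse(1)[OF T(2)], of y]
      P2.res_i_inverse(2)[OF T(2), of y] by simp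
  then show "P1.Phi cay = P2.Phi cay"
    by (auto simp: P1.Phi_cay_eq P2.Phi_cay_eq)
qed

lemma spectral_resolution_eqI:
  assumes "is_pvm E" "represents E complex_of_real T"
  shows "spectral_resolution T = E"
  unfolding spectral_resolution_def
  by (rule the_equality) (use assms spectral_measure_unique in blast)+

section \<open>Cayley transform of a self-adjoint operator\<close>

lemma self_adjoint_linear: "self_adjoint T \<Longrightarrow> linear_op T"
  and self_adjoint_dense: "self_adjoint T \<Longrightarrow> closure (odom T) = UNIV"
  unfolding self_adjoint_def by auto

lemma adjoint_value:
  assumes dense: "closure (odom T) = UNIV" and h: "\<And>f. f \<in> odom T \<Longrightarrow> cinner (oap T f) g = cinner f h"
  shows "g \<in> odom (adjoint T)" "oap (adjoint T) g = h"
proof -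
  show "g \<in> odom (adjoint T)" using h unfolding adjoint_def odom_def by auto
  have "(THE h. \<forall>f\<in>odom T. cinner (oap T f) g = cinner f h) = h"
  proof (rule the_equality)
    show "\<forall>f\<in>odom T. cinner (oap T f) g = cinner f h" using h by blast
    fix h' assume h': "\<forall>f\<in>odom T. cinner (oap T f) g = cinner f h'"
    show "h' = h"
      by (rule cinner_ext_dense[OF dense]) (use h h' in auto)
  qed
  then show "oap (adjoint T) g = h" unfolding adjoint_def by (simp add: oap_def)
qed

text \<open>Maximality: a vector that pairs like a member of the adjoint domain already lies in
  \<open>odom T\<close>. Closedness, surjectivity of T + w and the anticommutation with
  \<open>J\<close> all rest on this membership test.\<close>

lemma self_adjoint_intro:
  assumes T: "self_adjoint T" and h: "\<And>f. f \<in> odom T \<Longrightarrow> cinner (oap T f) g = cinner f h"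
  shows "g \<in> odom T" "oap T g = h"
proof -
  note adj = adjoint_value[of T g h, OF self_adjoint_dense[OF T] h]
  have eq: "odom T = odom (adjoint T)" "\<And>x. x \<in> odom T \<Longrightarrow> oap T x = oap (adjoint T) x"
    using T unfolding self_adjoint_def op_eq_def by auto
  show g: "g \<in> odom T" using adj(1) eq(1) by simp
  show "oap T g = h" using eq(2)[OF g] adj(2) by simp
qed

lemma self_adjoint_sym:
  assumes T: "self_adjoint T" and xy: "x \<in> odom T" "y \<in> odom T"
  shows "cinner (oap T x) y = cinner x (oap T y)"
proof -
  have eq: "odom T = odom (adjoint T)" "oap T y = oap (adjoint T) y"
    using T xy unfolding self_adjoint_def op_eq_def by auto
  have "y \<in> odom (adjoint T)" using eq(1) xy(2) by simp
  then have "\<exists>h. \<forall>f\<in>odom T. cinner (oap T f) y = cinner f h"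
    unfolding adjoint_def odom_def by simp
  then obtain h where h: "\<And>f. f \<in> odom T \<Longrightarrow> cinner (oap T f) y = cinner f h" by blast
  show ?thesis
    using h[OF xy(1)] adjoint_value(2)[OF self_adjoint_dense[OF T] h] eq(2) by simp
qed

lemma self_adjoint_closed:
  assumes T: "self_adjoint T" and f: "\<And>n. f n \<in> odom T" "f \<longlonglongrightarrow> x" "(\<lambda>n. oap T (f n)) \<longlonglongrightarrow> y"
  shows "x \<in> odom T" "oap T x = y"
proof -
  have "cinner (oap T u) x = cinner u y" if u: "u \<in> odom T" for u
  proof (rule LIMSEQ_unique)
    show "(\<lambda>n. cinner (oap T u) (f n)) \<longlonglongrightarrow> cinner (oap T u) x" by (intro tendsto_intros f)
    have "(\<lambda>n. cinner u (oap T (f n))) \<longlonglongrightarrow> cinner u y" by (intro tendsto_intros f)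
    then show "(\<lambda>n. cinner (oap T u) (f n)) \<longlonglongrightarrow> cinner u y"
      by (simp add: self_adjoint_sym[OF T u f(1)])
  qed
  from self_adjoint_intro[OF T this] show "x \<in> odom T" "oap T x = y" by simp_all
qed

section \<open>Resolvents at \<i> and -\<i> and the Cayley transform\<close>

locale self_adjoint_op =
  fixes T :: "'a::complex_hilbert lop"
  assumes sa: "self_adjoint T"
begin

lemma lin: "linear_op T"
  by (rule self_adjoint_linear[OF sa])

lemma dom_sub: "csubspace (odom T)"
  by (rule linear_op_csubspace[OF lin])

text \<open>The number \<open>cinner (oap T x) x\<close> is real, so the cross term is purely
  imaginary. The identity gives injectivity of T + w, its closed range and a contractive
  inverse.\<close>

lemma norm_plus_i:
  assumes x: "x \<in> odom T" and w: "w = \<i> \<or> w = - \<i>"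
  shows "(norm (oap T x + scaleC w x))\<^sup>2 = (norm (oap T x))\<^sup>2 + (norm x)\<^sup>2"
proof -
  have "cinner (oap T x) x = cnj (cinner (oap T x) x)"
    using self_adjoint_sym[OF sa x x] cinner_commute[of x "oap T x"] by simp
  then have "Im (cinner (oap T x) x) = 0" by (metis Im_complex_of_real Reals_cnj_iff complex_is_Real_iff)
  then have "Re (cinner (oap T x) (scaleC w x)) = 0"
    using w by (auto simp: cinner_scaleC_right)
  moreover have "norm (scaleC w x) = norm x" using w by (auto simp: norm_scaleC)
  ultimately show ?thesis by (simp add: norm_add_sq)
qed

text \<open>The range is closed by \<open>norm_plus_i\<close>. A vector orthogonal to it would be an
  eigenvector of \<open>T\<close> for the nonreal number \<open>w\<close>, hence zero.\<close>

lemma plus_i_surj: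
  assumes w: "w = \<i> \<or> w = - \<i>"
  shows "\<exists>x\<in>odom T. oap T x + scaleC w x = y"
proof -
  define V where "V = (\<lambda>x. oap T x + scaleC w x) ` odom T"
  have "V = UNIV"
  proof (rule closed_csubspace_orthogonal)
    show "csubspace V"
      unfolding csubspace_def
    proof (intro conjI ballI allI)
      show "0 \<in> V" unfolding V_def using csubspaceD(1)[OF dom_sub] linear_opD(3)[OF lin]
        by (intro image_eqI[of _ _ 0]) auto
      fix a assume "a \<in> V"
      then obtain x where x: "x \<in> odom T" "a = oap T x + scaleC w x" unfolding V_def by auto
      have "scaleC c a = oap T (scaleC c x) + scaleC w (scaleC c x)" for c
        using x by (simp add: linear_opD[OF lin] scaleC_add_right scaleC_scaleC mult.commute)
      then show "scaleC c a \<in> V" for c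
        unfolding V_def using csubspaceD(3)[OF dom_sub x(1)] by blast
      fix b assume "b \<in> V"
      then obtain y where y: "y \<in> odom T" "b = oap T y + scaleC w y" unfolding V_def by auto
      have "a + b = oap T (x + y) + scaleC w (x + y)"
        using x y by (simp add: linear_opD[OF lin] scaleC_add_right)
      then show "a + b \<in> V"
        unfolding V_def using csubspaceD(2)[OF dom_sub x(1) y(1)] by blast
    qed
    show "closed V"
      unfolding closed_sequential_limits
    proof (intro allI impI, elim conjE)
      fix a l assume a: "\<forall>n. a n \<in> V" and l: "a \<longlonglongrightarrow> l"
      then have "\<forall>n. \<exists>x. x \<in> odom T \<and> a n = oap T x + scaleC w x" unfolding V_def by auto
      from choice[OF this] obtain x where x: "\<And>n. x n \<in> odom T" "\<And>n. a n = oap T (x n) + scaleC w (x n)"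
        by blast
      have le: "norm (x m - x n) \<le> norm (a m - a n)" for m n
      proof -
        have d: "x m - x n \<in> odom T" using csubspaceD(4)[OF dom_sub x(1) x(1)] .
        have "a m - a n = oap T (x m - x n) + scaleC w (x m - x n)"
          using x by (simp add: linear_opD[OF lin] scaleC_diff_right)
        then have "(norm (a m - a n))\<^sup>2 = (norm (oap T (x m - x n)))\<^sup>2 + (norm (x m - x n))\<^sup>2"
          using norm_plus_i[OF d w] by simp
        then have "(norm (x m - x n))\<^sup>2 \<le> (norm (a m - a n))\<^sup>2" by simp
        then show ?thesis by (rule power2_le_imp_le) simp
      qed
      have "Cauchy a" using l by (rule LIMSEQ_imp_Cauchy)
      have "Cauchy x"
      proof (rule metric_CauchyI)
        fix e :: real assume "e > 0"
        from metric_CauchyD[OF \<open>Cauchy a\<close> this] obtain N where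
          N: "\<And>m n. m \<ge> N \<Longrightarrow> n \<ge> N \<Longrightarrow> dist (a m) (a n) < e" by blast
        have "dist (x m) (x n) < e" if "m \<ge> N" "n \<ge> N" for m n
          using le[of m n] N[OF that] by (simp add: dist_norm)
        then show "\<exists>N. \<forall>m\<ge>N. \<forall>n\<ge>N. dist (x m) (x n) < e" by blast
      qed
      then obtain z where z: "x \<longlonglongrightarrow> z" using Cauchy_convergent convergent_def by blast
      have "(\<lambda>n. a n - scaleC w (x n)) \<longlonglongrightarrow> l - scaleC w z"
        by (intro tendsto_intros l z)
      then have "(\<lambda>n. oap T (x n)) \<longlonglongrightarrow> l - scaleC w z" using x(2) by simp
      from self_adjoint_closed[OF sa x(1) z this] have "z \<in> odom T" "l = oap T z + scaleC w z" by auto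
      then show "l \<in> V" unfolding V_def by blast
    qed
    fix z assume perp: "\<And>v. v \<in> V \<Longrightarrow> cinner v z = 0"
    have cw: "cnj w = - w" using w by auto
    have "cinner (oap T f) z = cinner f (scaleC w z)" if "f \<in> odom T" for f
    proof -
      have "cinner (oap T f + scaleC w f) z = 0" using that by (intro perp) (auto simp: V_def)
      then show ?thesis by (simp add: cinner_simps cw add_eq_0_iff)
    qed
    from self_adjoint_intro[OF sa this] have z: "z \<in> odom T" "oap T z = scaleC w z" by simp_all
    have "- w * cinner z z = w * cinner z z"
      using self_adjoint_sym[OF sa z(1) z(1)] unfolding z(2) by (simp add: cinner_simps cw)
    then have "cinner z z = 0" using w by auto
    then show "z = 0" by (simp add: cinner_eq_zero_iff)
  qed
  then have "y \<in> V" by simp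
  then show ?thesis unfolding V_def by auto
qed

definition R :: "complex \<Rightarrow> 'a \<Rightarrow> 'a" where
  "R w y = (SOME x. x \<in> odom T \<and> oap T x + scaleC w x = y)"

lemma R:
  assumes w: "w = \<i> \<or> w = - \<i>"
  shows "R w y \<in> odom T" "oap T (R w y) + scaleC w (R w y) = y"
    "x \<in> odom T \<Longrightarrow> R w (oap T x + scaleC w x) = x"
proof -
  have *: "R w y \<in> odom T \<and> oap T (R w y) + scaleC w (R w y) = y" for y
    unfolding R_def by (rule someI_ex) (use plus_i_surj[OF w, of y] in auto)
  show "R w y \<in> odom T" "oap T (R w y) + scaleC w (R w y) = y" using * by auto
  assume x: "x \<in> odom T"
  define z where "z = R w (oap T x + scaleC w x)"
  have z: "z \<in> odom T" "oap T z + scaleC w z = oap T x + scaleC w x" using * unfolding z_def by auto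
  have "oap T (z - x) + scaleC w (z - x) = 0"
    using z x by (simp add: linear_opD[OF lin] scaleC_diff_right algebra_simps)
  then have "(norm (z - x))\<^sup>2 \<le> 0"
    using norm_plus_i[OF csubspaceD(4)[OF dom_sub z(1) x] w] by simp
  then show "z = x" by simp
qed

lemma bop_R:
  assumes w: "w = \<i> \<or> w = - \<i>"
  shows "bop (R w)"
  unfolding bop_def
proof (intro conjI allI exI)
  fix x y c
  note Rx = R(1,2)[OF w, of x] and Ry = R(1,2)[OF w, of y]
  have "oap T (R w x + R w y) + scaleC w (R w x + R w y) = x + y"
    using Rx Ry by (simp add: linear_opD[OF lin] scaleC_add_right algebra_simps)
  then show "R w (x + y) = R w x + R w y"
    using R(3)[OF w csubspaceD(2)[OF dom_sub Rx(1) Ry(1)]] by simp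
  have "oap T (scaleC c (R w x)) + scaleC w (scaleC c (R w x)) = scaleC c (oap T (R w x) + scaleC w (R w x))"
    using Rx(1) by (simp add: linear_opD[OF lin] scaleC_add_right scaleC_scaleC mult.commute)
  then show "R w (scaleC c x) = scaleC c (R w x)"
    using R(3)[OF w csubspaceD(3)[OF dom_sub Rx(1)], of c] Rx by simp
  have "(norm (R w x))\<^sup>2 \<le> (norm x)\<^sup>2"
    using norm_plus_i[OF Rx(1) w] Rx(2) by simp
  then have "norm (R w x) \<le> norm x" by (rule power2_le_imp_le) simp
  then show "norm (R w x) \<le> 1 * norm x" by simp
qed

lemma adj_R: "adj (R \<i>) (R (- \<i>))"
  unfolding adj_def
proof (intro allI)
  fix x y
  note Rx = R(1,2)[of \<i> x, simplified] and Ry = R(1,2)[of "- \<i>" y, simplified]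
  have "cinner (R \<i> x) y = cinner (R \<i> x) (oap T (R (- \<i>) y) + scaleC (- \<i>) (R (- \<i>) y))"
    using Ry(2) by simp
  also have "\<dots> = cinner (oap T (R \<i> x) + scaleC \<i> (R \<i> x)) (R (- \<i>) y)"
    using self_adjoint_sym[OF sa Rx(1) Ry(1)] by (simp add: cinner_simps)
  finally show "cinner (R \<i> x) y = cinner x (R (- \<i>) y)" using Rx(2) by simp
qed

text \<open>The Cayley transform in the form affine in the resolvent, as in \<open>cay_eq\<close>:
  boundedness is immediate, and \<open>U_eq\<close> recovers (T - \<i>) (T + \<i>)^-1.\<close>

definition U :: "'a \<Rightarrow> 'a" where "U x = x - scaleC (2 * \<i>) (R \<i> x)"
definition U' :: "'a \<Rightarrow> 'a" where "U' x = x + scaleC (2 * \<i>) (R (- \<i>) x)"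

lemma bop_U: "bop U" and bop_U': "bop U'"
proof -
  have "bop (\<lambda>x. scaleC 1 (id x) + scaleC (- (2 * \<i>)) (R \<i> x))"
    "bop (\<lambda>x. scaleC 1 (id x) + scaleC (2 * \<i>) (R (- \<i>) x))"
    by (rule bop_lin_comb[OF bop_id(1) bop_R], simp)+
  then show "bop U" "bop U'"
    by (simp_all add: U_def[abs_def] U'_def[abs_def] scaleC_one scaleC_minus_left)
qed

lemma adj_U: "adj U U'"
  using adj_R unfolding adj_def U_def U'_def by (simp add: cinner_simps)

lemma U_eq: "U x = oap T (R \<i> x) + scaleC (- \<i>) (R \<i> x)"
proof -
  have "oap T (R \<i> x) + scaleC \<i> (R \<i> x) = x" by (rule R(2)) simp
  then have "U x = oap T (R \<i> x) + scaleC \<i> (R \<i> x) - scaleC (2 * \<i>) (R \<i> x)"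
    by (simp add: U_def)
  also have "\<dots> = oap T (R \<i> x) + (scaleC \<i> (R \<i> x) - scaleC (2 * \<i>) (R \<i> x))" by simp
  also have "scaleC \<i> (R \<i> x) - scaleC (2 * \<i>) (R \<i> x) = scaleC (- \<i>) (R \<i> x)"
    by (simp flip: scaleC_diff_left)
  finally show ?thesis .
qed

lemma U'_eq: "U' x = oap T (R (- \<i>) x) + scaleC \<i> (R (- \<i>) x)"
proof -
  have "oap T (R (- \<i>) x) + scaleC (- \<i>) (R (- \<i>) x) = x" by (rule R(2)) simp
  then have "U' x = oap T (R (- \<i>) x) + scaleC (- \<i>) (R (- \<i>) x) + scaleC (2 * \<i>) (R (- \<i>) x)"
    by (simp add: U'_def)
  also have "\<dots> = oap T (R (- \<i>) x) + (scaleC (- \<i>) (R (- \<i>) x) + scaleC (2 * \<i>) (R (- \<i>) x))" by simp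
  also have "scaleC (- \<i>) (R (- \<i>) x) + scaleC (2 * \<i>) (R (- \<i>) x) = scaleC \<i> (R (- \<i>) x)"
    by (simp flip: scaleC_add_left)
  finally show ?thesis .
qed

lemma UU': "U (U' x) = x"
proof -
  have Rx: "R (- \<i>) x \<in> odom T" "oap T (R (- \<i>) x) + scaleC (- \<i>) (R (- \<i>) x) = x"
    by (rule R; simp)+
  have "R \<i> (U' x) = R (- \<i>) x"
    unfolding U'_eq by (rule R(3)[OF _ Rx(1)]) simp
  then show ?thesis unfolding U_eq[of "U' x"] using Rx(2) by simp
qed

lemma U'U: "U' (U x) = x"
proof -
  have Rx: "R \<i> x \<in> odom T" "oap T (R \<i> x) + scaleC \<i> (R \<i> x) = x"
    by (rule R; simp)+
  have "R (- \<i>) (U x) = R \<i> x"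
    unfolding U_eq by (rule R(3)[OF _ Rx(1)]) simp
  then show ?thesis unfolding U'_eq[of "U x"] using Rx(2) by simp
qed

text \<open>1 - U is 2 \<i> times the resolvent, so its range contains the dense domain. This will
  exclude mass at 1, the one point of the circle not reached by \<open>cay\<close>.\<close>

lemma range_one_minus_U_dense: "closure (range (\<lambda>y. y - U y)) = UNIV"
proof -
  have "odom T \<subseteq> range (\<lambda>y. y - U y)"
  proof
    fix x assume x: "x \<in> odom T"
    define v where "v = scaleC (1 / (2 * \<i>)) x"
    have v: "v \<in> odom T" unfolding v_def by (rule csubspaceD(3)[OF dom_sub x])
    have "R \<i> (oap T v + scaleC \<i> v) = v" by (rule R(3)[OF _ v]) simp
    then have "(oap T v + scaleC \<i> v) - U (oap T v + scaleC \<i> v) = scaleC (2 * \<i>) v"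
      by (simp add: U_def)
    also have "\<dots> = x" by (simp add: v_def scaleC_scaleC scaleC_one)
    finally show "x \<in> range (\<lambda>y. y - U y)" by (intro range_eqI[of _ _ "oap T v + scaleC \<i> v"]) simp
  qed
  then show ?thesis using closure_mono self_adjoint_dense[OF sa] by blast
qed

end

section \<open>The spectral theorem\<close>

lemma integral_cis_period:
  "(\<integral>\<theta>. indicator {0..2 * pi} \<theta> *\<^sub>R cis (of_int l * \<theta>) \<partial>lborel) = (if l = 0 then complex_of_real (2 * pi) else 0)"
proof (cases "l = 0")
  case True
  have "(\<integral>\<theta>. indicator {0..2 * pi} \<theta> *\<^sub>R (1::complex) \<partial>lborel) = complex_of_real (2 * pi) - complex_of_real 0"
    by (rule integral_FTC_atLeastAtMost) (auto intro!: derivative_eq_intros simp: has_vector_derivative_of_real)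
  then show ?thesis using True by simp
next
  case False
  have "(\<integral>\<theta>. indicator {0..2 * pi} \<theta> *\<^sub>R cis (of_int l * \<theta>) \<partial>lborel)
      = cis (of_int l * (2 * pi)) / (\<i> * of_int l) - cis (of_int l * 0) / (\<i> * of_int l)"
  proof (rule integral_FTC_atLeastAtMost)
    fix x :: real
    have "((\<lambda>z. exp (\<i> * of_int l * z) / (\<i> * of_int l)) has_field_derivative exp (\<i> * of_int l * complex_of_real x))
        (at (complex_of_real x))"
      using False by (auto intro!: derivative_eq_intros)
    from has_vector_derivative_real_field[OF this]
    show "((\<lambda>x. cis (of_int l * x) / (\<i> * of_int l)) has_vector_derivative cis (of_int l * x)) (at x within {0..2 * pi})"
      by (simp add: cis_conv_exp mult_ac has_vector_derivative_at_within)
  qed (auto intro!: continuous_intros)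
  also have "cis (of_int l * (2 * pi)) = 1"
    using cis_multiple_2pi[of "of_int l"] by (simp add: mult_ac)
  finally show ?thesis using False by simp
qed

locale unitary =
  fixes U U' :: "'a::complex_hilbert \<Rightarrow> 'a"
  assumes bop_U: "bop U" and adj_U: "adj U U'" and U'U: "U' (U x) = x" and UU': "U (U' x) = x"
begin

lemma cinner_U: "cinner (U x) (U y) = cinner x y"
  using adjD[OF adj_U] by (simp add: U'U)

lemma cinner_pow: "cinner ((U ^^ n) x) ((U ^^ n) y) = cinner x y"
  by (induction n) (simp_all add: cinner_U)

lemma norm_pow: "norm ((U ^^ n) x) = norm x"
proof -
  have "(norm ((U ^^ n) x))\<^sup>2 = (norm x)\<^sup>2" by (simp add: norm_sq_eq_cinner cinner_pow)
  then show ?thesis by (rule power2_eq_imp_eq) simp_all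
qed

text \<open>The Fejer kernel turns the moments \<open>cinner x ((U ^^ m) x)\<close> into a nonnegative density.\<close>

definition fejer :: "nat \<Rightarrow> 'a \<Rightarrow> real \<Rightarrow> real" where
  "fejer n x \<theta> = (norm (\<Sum>k<n. scaleC (cis (- real k * \<theta>)) ((U ^^ k) x)))\<^sup>2 / (2 * pi * real n)"

lemma fejer_nonneg: "0 \<le> fejer n x \<theta>"
  unfolding fejer_def by simp

lemma fejer_expand:
  "complex_of_real (fejer n x \<theta>) =
     (\<Sum>j<n. \<Sum>k<n. cis (of_int (int j - int k) * \<theta>) * cinner ((U ^^ j) x) ((U ^^ k) x)) / complex_of_real (2 * pi * real n)"
proof -
  have "cnj (cis (- real j * \<theta>)) * cis (- real k * \<theta>) = cis (of_int (int j - int k) * \<theta>)" for j k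
    by (simp add: cis_cnj cis_mult algebra_simps)
  then show ?thesis
    unfolding fejer_def of_real_divide cinner_self_norm[symmetric]
    by (simp add: cinner_sum_left cinner_sum_right cinner_simps sum_distrib_left flip: mult.assoc)
       (auto simp: mult.commute mult.left_commute intro: sum.swap)
qed

lemma continuous_fejer: "continuous_on A (fejer n x)"
proof -
  have "continuous_on A (\<lambda>\<theta>. Re (complex_of_real (fejer n x \<theta>)))"
    unfolding fejer_expand by (cases "n = 0") (auto intro!: continuous_intros)
  then show ?thesis by simp
qed

lemma fejer_measurable [measurable]: "fejer n x \<in> borel_measurable borel"
  by (rule borel_measurable_continuous_onI[OF continuous_fejer])

text \<open>Orthogonality of the characters keeps the index pairs with k = j + m. There are
  \<open>n - m\<close> of them; truncated subtraction covers m \<ge> n.\<close>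

lemma integral_fejer:
  assumes n: "n > 0"
  shows "(\<integral>\<theta>. indicator {0..2 * pi} \<theta> *\<^sub>R (complex_of_real (fejer n x \<theta>) * cis (real m * \<theta>)) \<partial>lborel)
    = (real (n - m) / real n) * cinner x ((U ^^ m) x)"
proof -
  let ?c = "\<lambda>j k. cinner ((U ^^ j) x) ((U ^^ k) x)"
  let ?l = "\<lambda>j k. int j - int k + int m"
  have int: "integrable lborel (\<lambda>\<theta>. indicator {0..2 * pi} \<theta> *\<^sub>R cis (of_int l * \<theta>))" for l
    by (rule borel_integrable_compact) (auto intro!: continuous_intros)
  have "(\<integral>\<theta>. indicator {0..2 * pi} \<theta> *\<^sub>R (complex_of_real (fejer n x \<theta>) * cis (real m * \<theta>)) \<partial>lborel)
     = (\<integral>\<theta>. (\<Sum>j<n. \<Sum>k<n. (?c j k / complex_of_real (2 * pi * real n)) *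
          (indicator {0..2 * pi} \<theta> *\<^sub>R cis (of_int (?l j k) * \<theta>))) \<partial>lborel)"
  proof (rule Bochner_Integration.integral_cong[OF refl])
    fix \<theta> :: real
    have c: "cis (of_int (int j - int k) * \<theta>) * cis (real m * \<theta>) = cis (of_int (?l j k) * \<theta>)" for j k
      by (simp add: cis_mult algebra_simps)
    show "indicator {0..2 * pi} \<theta> *\<^sub>R (complex_of_real (fejer n x \<theta>) * cis (real m * \<theta>))
      = (\<Sum>j<n. \<Sum>k<n. (?c j k / complex_of_real (2 * pi * real n)) *
          (indicator {0..2 * pi} \<theta> *\<^sub>R cis (of_int (?l j k) * \<theta>)))"
      unfolding fejer_expand c[symmetric] scaleR_conv_of_real
      by (simp only: sum_divide_distrib sum_distrib_left sum_distrib_right times_divide_eq_left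
          times_divide_eq_right mult_ac)
  qed
  also have "\<dots> = (\<Sum>j<n. \<Sum>k<n. (?c j k / complex_of_real (2 * pi * real n)) *
          (if ?l j k = 0 then complex_of_real (2 * pi) else 0))"
    by (simp only: Bochner_Integration.integral_sum Bochner_Integration.integrable_sum
        integrable_mult_right integral_mult_right_zero integral_cis_period int)
  also have "\<dots> = (\<Sum>j<n. \<Sum>k<n. if k = j + m then cinner x ((U ^^ m) x) / of_nat n else 0)"
  proof (intro sum.cong refl)
    fix j k
    have "?c j (j + m) = cinner x ((U ^^ m) x)"
      by (simp add: funpow_add cinner_pow)
    then show "(?c j k / complex_of_real (2 * pi * real n)) * (if ?l j k = 0 then complex_of_real (2 * pi) else 0)
      = (if k = j + m then cinner x ((U ^^ m) x) / of_nat n else 0)"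
      by auto
  qed
  also have "\<dots> = (\<Sum>j<n. if j + m < n then cinner x ((U ^^ m) x) / of_nat n else 0)"
    by (simp add: sum.delta')
  also have "\<dots> = (\<Sum>j\<in>{..<n - m}. cinner x ((U ^^ m) x) / of_nat n)"
    by (rule sum.mono_neutral_cong_right) auto
  also have "\<dots> = (real (n - m) / real n) * cinner x ((U ^^ m) x)"
    by simp
  finally show ?thesis .
qed

definition fejer_measure :: "nat \<Rightarrow> 'a \<Rightarrow> real measure" where
  "fejer_measure n x = density lborel (\<lambda>\<theta>. ennreal (indicator {0..2 * pi} \<theta> * fejer n x \<theta>))"

text \<open>The zeroth moment is the mass, which is why the vector is normalized: only then are
  these probability measures, to which tightness applies.\<close>

lemma emeasure_fejer_measure:
  assumes n: "n > 0" and x: "norm x = 1" and S: "S \<in> sets borel" "{0..2 * pi} \<subseteq> S"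
  shows "emeasure (fejer_measure n x) S = 1"
proof -
  have int: "integrable lborel (\<lambda>\<theta>. indicator {0..2 * pi} \<theta> *\<^sub>R fejer n x \<theta>)"
    by (rule borel_integrable_compact) (auto intro!: continuous_fejer)
  have "complex_of_real (\<integral>\<theta>. indicator {0..2 * pi} \<theta> * fejer n x \<theta> \<partial>lborel)
     = (\<integral>\<theta>. indicator {0..2 * pi} \<theta> *\<^sub>R (complex_of_real (fejer n x \<theta>) * cis (real 0 * \<theta>)) \<partial>lborel)"
    by (subst integral_complex_of_real[symmetric]) (simp add: scaleR_conv_of_real)
  also have "\<dots> = 1"
    unfolding integral_fejer[OF n] using n x by (simp add: cinner_self_norm)
  finally have one: "(\<integral>\<theta>. indicator {0..2 * pi} \<theta> * fejer n x \<theta> \<partial>lborel) = 1"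
    by (simp only: of_real_eq_1_iff)
  have "emeasure (fejer_measure n x) S
      = (\<integral>\<^sup>+\<theta>. ennreal (indicator {0..2 * pi} \<theta> * fejer n x \<theta>) * indicator S \<theta> \<partial>lborel)"
    unfolding fejer_measure_def using S by (subst emeasure_density) auto
  also have "\<dots> = (\<integral>\<^sup>+\<theta>. ennreal (indicator {0..2 * pi} \<theta> * fejer n x \<theta>) \<partial>lborel)"
    using S(2) by (intro nn_integral_cong) (auto simp: indicator_def)
  also have "\<dots> = ennreal (\<integral>\<theta>. indicator {0..2 * pi} \<theta> * fejer n x \<theta> \<partial>lborel)"
    using int by (intro nn_integral_eq_integral) (auto simp: fejer_nonneg)
  finally show ?thesis by (simp add: one)
qed

lemma real_distribution_fejer_measure:
  assumes "n > 0" "norm x = 1"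
  shows "real_distribution (fejer_measure n x)"
proof -
  have "prob_space (fejer_measure n x)"
    by (rule prob_spaceI) (use emeasure_fejer_measure[OF assms, of UNIV] in \<open>simp add: fejer_measure_def\<close>)
  then show ?thesis
    unfolding real_distribution_def real_distribution_axioms_def by (simp add: fejer_measure_def)
qed

lemma char_fejer_measure:
  assumes "n > 0" "norm x = 1"
  shows "char (fejer_measure n x) (real m) = (real (n - m) / real n) * cinner x ((U ^^ m) x)"
proof -
  have "char (fejer_measure n x) (real m)
      = (\<integral>\<theta>. (indicator {0..2 * pi} \<theta> * fejer n x \<theta>) *\<^sub>R iexp (real m * \<theta>) \<partial>lborel)"
    unfolding char_def fejer_measure_def by (subst integral_density) (auto simp: fejer_nonneg)
  also have "\<dots> = (\<integral>\<theta>. indicator {0..2 * pi} \<theta> *\<^sub>R (complex_of_real (fejer n x \<theta>) * cis (real m * \<theta>)) \<partial>lborel)"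
    by (simp add: cis_conv_exp scaleR_conv_of_real mult_ac)
  finally show ?thesis using integral_fejer[OF assms(1)] by simp
qed

text \<open>All densities live on one period, so the sequence is tight. Along a weakly convergent
  subsequence the characteristic functions converge, and the Fejer weights (n - m) / n tend to
  1.\<close>

lemma herglotz:
  assumes x: "norm x = 1"
  obtains M where "real_distribution M" "\<And>m. char M (real m) = cinner x ((U ^^ m) x)"
proof -
  let ?M = "\<lambda>n. fejer_measure (Suc n) x"
  have rd: "real_distribution (?M n)" for n
    by (rule real_distribution_fejer_measure) (use x in auto)
  have "tight ?M"
    unfolding tight_def
  proof (intro conjI allI impI rd)
    fix \<epsilon> :: real assume e: "\<epsilon> > 0"
    have "measure (?M n) {-1<..8} > 1 - \<epsilon>" for n
    proof -
      \<comment> \<open>Tightness is phrased with half-open intervals, so the left end lies below 0;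
        8 suffices because pi < 4.\<close>
      have "{0..2 * pi} \<subseteq> {-1<..8}" using pi_less_4 by auto
      then have "emeasure (?M n) {-1<..8} = 1" by (intro emeasure_fejer_measure x) auto
      then show ?thesis using e by (simp add: measure_def)
    qed
    then show "\<exists>a b. a < b \<and> (\<forall>n. 1 - \<epsilon> < measure (?M n) {a<..b})"
      by (intro exI[of _ "-1"] exI[of _ 8]) auto
  qed
  from tight_imp_convergent_subsubsequence[OF this strict_mono_id]
  obtain r M where r: "strict_mono r" and M: "real_distribution M" and w: "weak_conv_m (?M \<circ> r) M"
    by (auto simp: comp_def)
  have "char M (real m) = cinner x ((U ^^ m) x)" for m
  proof (rule LIMSEQ_unique)
    have "(\<lambda>n. char ((?M \<circ> r) n) (real m)) \<longlonglongrightarrow> char M (real m)"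
      using rd by (intro levy_continuity1 M w) auto
    then show "(\<lambda>n. char (?M (r n)) (real m)) \<longlonglongrightarrow> char M (real m)" by simp
    have "(\<lambda>n. real (Suc n - m) / real (Suc n)) \<longlonglongrightarrow> 1"
    proof (rule Lim_transform_eventually)
      have "(\<lambda>n. 1 - real m * (1 / real (Suc n))) \<longlonglongrightarrow> 1 - real m * 0"
        by (intro tendsto_intros LIMSEQ_inverse_real_of_nat[unfolded inverse_eq_divide])
      then show "(\<lambda>n. 1 - real m * (1 / real (Suc n))) \<longlonglongrightarrow> 1" by simp
      show "\<forall>\<^sub>F n in sequentially. 1 - real m * (1 / real (Suc n)) = real (Suc n - m) / real (Suc n)"
        by (intro eventually_sequentiallyI[of m]) (simp add: of_nat_diff field_simps)
    qed
    then have "(\<lambda>n. complex_of_real (real (Suc n - m) / real (Suc n)) * cinner x ((U ^^ m) x))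
        \<longlonglongrightarrow> complex_of_real 1 * cinner x ((U ^^ m) x)"
      by (intro tendsto_intros)
    then have "(\<lambda>n. char (?M n) (real m)) \<longlonglongrightarrow> cinner x ((U ^^ m) x)"
      by (subst char_fejer_measure) (simp_all add: x)
    from LIMSEQ_subseq_LIMSEQ[OF this r]
    show "(\<lambda>n. char (?M (r n)) (real m)) \<longlonglongrightarrow> cinner x ((U ^^ m) x)" by (simp add: comp_def)
  qed
  then show thesis using that M by blast
qed

section \<open>Absence of mass at the point 1 of the circle\<close>

definition mean :: "nat \<Rightarrow> 'a \<Rightarrow> 'a" where
  "mean n x = scaleR (1 / real (Suc n)) (\<Sum>k<Suc n. (U ^^ k) x)"

lemma norm_mean_le: "norm (mean n x) \<le> norm x"
proof -
  have "norm (\<Sum>k<Suc n. (U ^^ k) x) \<le> (\<Sum>k<Suc n. norm x)"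
    by (rule sum_norm_le) (simp add: norm_pow)
  then show ?thesis
    unfolding mean_def by (simp add: divide_le_eq mult.commute)
qed

lemma mean_diff: "mean n (x - y) = mean n x - mean n y"
  unfolding mean_def by (simp add: bop_diff[OF bop_pow[OF bop_U]] sum_subtractf scaleR_diff_right)

text \<open>The mean ergodic argument: on vectors \<open>y - U y\<close> the averages telescope and
  tend to 0, and since averaging is contractive this extends to the closure.\<close>

lemma mean_ergodic:
  assumes dense: "closure (range (\<lambda>y. y - U y)) = UNIV"
  shows "(\<lambda>n. mean n x) \<longlonglongrightarrow> 0"
proof (rule metric_LIMSEQ_I)
  fix \<epsilon> :: real assume e: "\<epsilon> > 0"
  obtain y where y: "dist (y - U y) x < \<epsilon> / 2"
    using dense e closure_approachable[of x "range (\<lambda>y. y - U y)"] by (auto dest!: spec[of _ "\<epsilon> / 2"])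
  have tele: "(\<Sum>k<n. (U ^^ k) (y - U y)) = y - (U ^^ n) y" for n
    by (induction n) (simp_all add: bop_diff[OF bop_pow[OF bop_U]] bop_diff[OF bop_U] funpow_swap1)
  obtain N where N: "4 * norm y / \<epsilon> < real N" using reals_Archimedean2 by blast
  have "dist (mean n x) 0 < \<epsilon>" if n: "n \<ge> N" for n
  proof -
    have "norm (mean n (y - U y)) = norm (y - (U ^^ Suc n) y) / real (Suc n)"
      unfolding mean_def tele by simp
    also have "\<dots> \<le> (2 * norm y) / real (Suc n)"
      using norm_triangle_ineq4[of y "(U ^^ Suc n) y"] unfolding norm_pow by (intro divide_right_mono) auto
    also have "\<dots> < \<epsilon> / 2"
    proof -
      have "4 * norm y < \<epsilon> * real N" using N e by (simp add: divide_less_eq mult.commute)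
      also have "\<dots> \<le> \<epsilon> * real (Suc n)" using n e by (intro mult_left_mono) auto
      finally show ?thesis by (simp add: divide_less_eq)
    qed
    finally have 1: "norm (mean n (y - U y)) < \<epsilon> / 2" .
    have "norm (mean n x - mean n (y - U y)) \<le> norm (x - (y - U y))"
      unfolding mean_diff[symmetric] by (rule norm_mean_le)
    also have "\<dots> < \<epsilon> / 2" using y by (simp add: dist_norm norm_minus_commute)
    finally have 2: "norm (mean n x - mean n (y - U y)) < \<epsilon> / 2" .
    have "norm (mean n x) \<le> norm (mean n x - mean n (y - U y)) + norm (mean n (y - U y))"
      using norm_triangle_sub[of "mean n x" "mean n (y - U y)"] by simp
    with 1 2 show ?thesis by simp
  qed
  then show "\<exists>N. \<forall>n\<ge>N. dist (mean n x) 0 < \<epsilon>" by blast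
qed

lemma iexp_eq_cis_power: "iexp (real k * \<theta>) = cis \<theta> ^ k"
  by (simp add: cis_conv_exp mult_ac flip: exp_of_nat_mult)

text \<open>The averages of the powers of \<open>cis \<theta>\<close> are bounded by 1 and converge
  to the indicator of \<open>cis \<theta> = 1\<close>, while their integrals are
  \<open>cinner x (mean n x)\<close> and tend to 0.\<close>

lemma AE_cis_neq_one:
  assumes M: "real_distribution M" and char: "\<And>m. char M (real m) = cinner x ((U ^^ m) x)"
    and dense: "closure (range (\<lambda>y. y - U y)) = UNIV"
  shows "AE \<theta> in M. cis \<theta> \<noteq> 1"
proof -
  interpret M: real_distribution M by fact
  define h where "h n \<theta> = (\<Sum>k<Suc n. cis \<theta> ^ k) / of_nat (Suc n)" for n \<theta>
  define Z where "Z = {\<theta>. cis \<theta> = 1}"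
  have Z: "Z \<in> sets borel" unfolding Z_def by (intro borel_closed closed_Collect_eq continuous_intros)
  have hb: "cmod (h n \<theta>) \<le> 1" for n \<theta>
  proof -
    have "cmod (\<Sum>k<Suc n. cis \<theta> ^ k) \<le> (\<Sum>k<Suc n. 1)"
      by (rule sum_norm_le) (simp add: norm_power)
    then show ?thesis unfolding h_def norm_divide by (simp add: divide_le_eq del: of_nat_Suc)
  qed
  have hm: "h n \<in> borel_measurable borel" for n
    unfolding h_def by (intro borel_measurable_continuous_onI continuous_intros) (simp del: of_nat_Suc)
  have lim: "(\<lambda>n. h n \<theta>) \<longlonglongrightarrow> indicator Z \<theta>" for \<theta>
  proof (cases "\<theta> \<in> Z")
    case True
    then have e: "(\<Sum>k<Suc n. cis \<theta> ^ k) = of_nat (Suc n)" for n by (simp add: Z_def)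
    have "h n \<theta> = 1" for n unfolding h_def e by (rule divide_self[OF of_nat_neq_0])
    then show ?thesis using True by simp
  next
    case False
    then have ne: "cis \<theta> \<noteq> 1" by (simp add: Z_def)
    have "(\<lambda>n. h n \<theta>) \<longlonglongrightarrow> 0"
    proof (rule tendsto_norm_zero_cancel, rule tendsto_sandwich[OF _ _ tendsto_const])
      have "(\<lambda>n. 2 / cmod (cis \<theta> - 1) * inverse (real (Suc n))) \<longlonglongrightarrow> 2 / cmod (cis \<theta> - 1) * 0"
        by (intro tendsto_intros LIMSEQ_inverse_real_of_nat)
      then show "(\<lambda>n. 2 / cmod (cis \<theta> - 1) * inverse (real (Suc n))) \<longlonglongrightarrow> 0" by simp
      have "cmod (h n \<theta>) \<le> 2 / cmod (cis \<theta> - 1) * inverse (real (Suc n))" for n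
      proof -
        have "(\<Sum>k<Suc n. cis \<theta> ^ k) = (cis \<theta> ^ Suc n - 1) / (cis \<theta> - 1)"
          using geometric_sum[OF ne, of "Suc n"] .
        moreover have "cmod (cis \<theta> ^ Suc n - 1) \<le> 2"
          using norm_triangle_ineq4[of "cis \<theta> ^ Suc n" 1] by (simp add: norm_power norm_mult)
        ultimately show ?thesis
          unfolding h_def norm_divide by (simp add: divide_right_mono field_simps del: of_nat_Suc)
             (simp add: norm_divide divide_right_mono)
      qed
      then show "\<forall>\<^sub>F n in sequentially. cmod (h n \<theta>) \<le> 2 / cmod (cis \<theta> - 1) * inverse (real (Suc n))" by simp
    qed simp
    then show ?thesis using False by simp
  qed
  have int_h: "(\<integral>\<theta>. h n \<theta> \<partial>M) = cinner x (mean n x)" for n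
  proof -
    have c: "(\<integral>\<theta>. cis \<theta> ^ k \<partial>M) = cinner x ((U ^^ k) x)" for k
      using char[of k] unfolding char_def iexp_eq_cis_power .
    have i: "integrable M (\<lambda>\<theta>. cis \<theta> ^ k)" for k
    proof (rule M.integrable_const_bound[of _ 1])
      show "(\<lambda>\<theta>. cis \<theta> ^ k) \<in> borel_measurable M"
        by (simp add: measurable_cong_sets[OF M.events_eq_borel refl])
           (intro borel_measurable_continuous_onI continuous_intros)
    qed (simp add: norm_power)
    have "(\<integral>\<theta>. h n \<theta> \<partial>M) = (\<Sum>k<Suc n. cinner x ((U ^^ k) x)) / of_nat (Suc n)"
      unfolding h_def using i by (simp add: c del: of_nat_Suc sum.lessThan_Suc)
    also have "\<dots> = cinner x (mean n x)"
      unfolding mean_def scaleR_scaleC by (simp add: cinner_scaleC_right cinner_sum_right del: of_nat_Suc sum.lessThan_Suc)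
    finally show ?thesis .
  qed
  have "(\<lambda>n. \<integral>\<theta>. h n \<theta> \<partial>M) \<longlonglongrightarrow> (\<integral>\<theta>. indicator Z \<theta> \<partial>M)"
    by (rule bounded_borel_integral_tendsto(1)[OF M.finite_measure_axioms M.events_eq_borel _ hb lim])
       (rule bounded_borelI[OF hm hb])
  moreover have "(\<lambda>n. \<integral>\<theta>. h n \<theta> \<partial>M) \<longlonglongrightarrow> cinner x 0"
    unfolding int_h by (intro tendsto_intros mean_ergodic[OF dense])
  ultimately have "(\<integral>\<theta>. indicator Z \<theta> \<partial>M) = (0::complex)"
    using LIMSEQ_unique by fastforce
  moreover have "(\<integral>\<theta>. indicator Z \<theta> \<partial>M) = complex_of_real (measure M Z)"
  proof -
    have "(\<integral>\<theta>. indicator Z \<theta> \<partial>M) = (\<integral>\<theta>. complex_of_real (indicator Z \<theta>) \<partial>M)"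
      by (simp add: of_real_indicator)
    also have "\<dots> = complex_of_real (measure M Z)"
      using Z by (subst integral_complex_of_real) simp
    finally show ?thesis .
  qed
  ultimately have "M.prob Z = 0" by simp
  then have "Z \<in> null_sets M"
    using Z by (auto simp: null_sets_def M.emeasure_eq_measure)
  then show ?thesis
    by (rule AE_I') (auto simp: Z_def)
qed

end

section \<open>Transport from the circle to the line and the spectral theorem\<close>

text \<open>The inverse Cayley transform in the angle variable; away from
  \<open>cis \<theta> = 1\<close> it equals -cot (\<theta> / 2), already real before
  \<open>Re\<close> is taken. The points where it divides by zero are null by
  \<open>AE_cis_neq_one\<close>.\<close>

definition cot_half :: "real \<Rightarrow> real" where
  "cot_half \<theta> = Re (\<i> * (1 + cis \<theta>) / (1 - cis \<theta>))"

lemma cay_cot_half: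
  assumes "cis \<theta> \<noteq> 1"
  shows "cay (cot_half \<theta>) = cis \<theta>"
proof -
  define w where "w = cis \<theta>"
  have w: "w \<noteq> 1" "w * cnj w = 1" "w \<noteq> 0"
    using assms by (auto simp: w_def cis_cnj cis_mult)
  define z where "z = \<i> * (1 + w) / (1 - w)"
  have "cnj w = 1 / w" using w by (simp add: field_simps)
  then have "cnj z = - \<i> * (1 + 1 / w) / (1 - 1 / w)"
    by (simp add: z_def)
  also have "\<dots> = z" using w by (simp add: z_def divide_simps) (simp add: algebra_simps)
  finally have "complex_of_real (Re z) = z"
    by (metis Reals_cnj_iff of_real_Re)
  then have "complex_of_real (cot_half \<theta>) = z"
    by (simp add: cot_half_def z_def w_def)
  moreover have "(z - \<i>) / (z + \<i>) = w"
  proof -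
    have "z - \<i> = 2 * \<i> * w / (1 - w)" "z + \<i> = 2 * \<i> / (1 - w)"
      using w by (auto simp: z_def field_simps)
    then show ?thesis using w by simp
  qed
  ultimately show ?thesis by (simp add: cay_def w_def)
qed

lemma cot_half_measurable [measurable]: "cot_half \<in> borel_measurable borel"
proof -
  have [measurable]: "cis \<in> borel_measurable borel"
    by (intro borel_measurable_continuous_onI continuous_intros)
  show ?thesis unfolding cot_half_def[abs_def] by measurable
qed

text \<open>Push the circle measure forward along \<open>cot_half\<close>: \<open>cay\<close> then
  pulls back to \<open>cis\<close> almost everywhere, so the moments transfer.\<close>

lemma (in unitary) cay_measures_unit:
  assumes x: "norm x = 1" and dense: "closure (range (\<lambda>y. y - U y)) = UNIV"
  shows "\<exists>N. prob_space N \<and> sets N = sets borel \<and>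
    (\<forall>m n. (\<integral>s. cay s ^ m * cnj (cay s) ^ n \<partial>N) = cinner x ((U ^^ m) ((U' ^^ n) x)))"
proof -
  obtain M where M: "real_distribution M" and char: "\<And>m. char M (real m) = cinner x ((U ^^ m) x)"
    using herglotz[OF x] by blast
  interpret M: real_distribution M by fact
  define N where "N = distr M borel cot_half"
  have ae: "AE \<theta> in M. cis \<theta> \<noteq> 1" by (rule AE_cis_neq_one[OF M char dense])
  have [measurable]: "cay \<in> borel_measurable borel" "(\<lambda>s. cnj (cay s)) \<in> borel_measurable borel"
    by (intro bounded_borel_measurable bounded_borel_cnj bounded_borel_cay)+
  have [measurable]: "cis \<in> borel_measurable M" "(\<lambda>\<theta>. cis (- \<theta>)) \<in> borel_measurable M"
    unfolding measurable_cong_sets[OF M.events_eq_borel refl]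
    by (intro borel_measurable_continuous_onI continuous_intros)+
  have mom: "(\<integral>\<theta>. cis \<theta> ^ k \<partial>M) = cinner x ((U ^^ k) x)" for k
    using char[of k] unfolding char_def iexp_eq_cis_power .
  have adjn: "adj (U ^^ k) (U' ^^ k)" for k by (rule adj_pow[OF adj_U])
  have mom': "(\<integral>\<theta>. cis (- \<theta>) ^ k \<partial>M) = cinner x ((U' ^^ k) x)" for k
  proof -
    have "(\<integral>\<theta>. cis (- \<theta>) ^ k \<partial>M) = (\<integral>\<theta>. cnj (cis \<theta> ^ k) \<partial>M)"
      by (simp add: cis_cnj)
    also have "\<dots> = cnj (cinner x ((U ^^ k) x))" by (simp only: mom[symmetric] Bochner_Integration.integral_cnj)
    also have "\<dots> = cinner x ((U' ^^ k) x)"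
      using adjD[OF adjn, of k x x] by (simp flip: cinner_commute)
    finally show ?thesis .
  qed
  have cancel: "(U' ^^ k) ((U ^^ k) y) = y" "(U ^^ k) ((U' ^^ k) y) = y" for k y
  proof (induction k)
    case (Suc k)
    have "(U' ^^ Suc k) ((U ^^ Suc k) y) = (U' ^^ k) (U' (U ((U ^^ k) y)))"
      "(U ^^ Suc k) ((U' ^^ Suc k) y) = (U ^^ k) (U (U' ((U' ^^ k) y)))"
      by (simp_all only: funpow_Suc_right[of k U] funpow_Suc_right[of k U'] o_apply funpow_swap1)
    then show "(U' ^^ Suc k) ((U ^^ Suc k) y) = y" "(U ^^ Suc k) ((U' ^^ Suc k) y) = y"
      using Suc by (simp_all only: U'U UU')
  qed simp_all
  have "(\<integral>s. cay s ^ m * cnj (cay s) ^ n \<partial>N) = cinner x ((U ^^ m) ((U' ^^ n) x))" for m n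
  proof -
    have "(\<integral>s. cay s ^ m * cnj (cay s) ^ n \<partial>N)
        = (\<integral>\<theta>. cay (cot_half \<theta>) ^ m * cnj (cay (cot_half \<theta>)) ^ n \<partial>M)"
      unfolding N_def by (rule integral_distr) auto
    also have "\<dots> = (\<integral>\<theta>. cis \<theta> ^ m * cis (- \<theta>) ^ n \<partial>M)"
    proof (rule integral_cong_AE)
      show "AE \<theta> in M. cay (cot_half \<theta>) ^ m * cnj (cay (cot_half \<theta>)) ^ n = cis \<theta> ^ m * cis (- \<theta>) ^ n"
        using ae by eventually_elim (simp add: cay_cot_half cis_cnj)
    qed auto
    also have "\<dots> = cinner x ((U ^^ m) ((U' ^^ n) x))"
    \<comment> \<open>On the circle the conjugate is the inverse, and \<open>U'\<close> inverts
      \<open>U\<close>, so the mixed moment reduces to a pure power of one kind, already known from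
      \<open>mom\<close> or \<open>mom'\<close>.\<close>
    proof (cases "n \<le> m")
      case True
      then obtain d where d: "m = n + d" using le_Suc_ex by blast
      have "cis \<theta> ^ m * cis (- \<theta>) ^ n = cis \<theta> ^ d" for \<theta>
        by (simp add: d power_add cis_mult mult_ac flip: power_mult_distrib mult.assoc)
      moreover have "(U ^^ m) ((U' ^^ n) x) = (U ^^ d) x"
        by (simp add: d add.commute[of n] funpow_add cancel)
      ultimately show ?thesis by (simp add: mom)
    next
      case False
      then obtain d where d: "n = m + d" using le_Suc_ex nat_le_linear by blast
      have "cis \<theta> ^ m * cis (- \<theta>) ^ n = cis (- \<theta>) ^ d" for \<theta>
        by (simp add: d power_add cis_mult flip: power_mult_distrib mult.assoc)
      moreover have "(U ^^ m) ((U' ^^ n) x) = (U' ^^ d) x"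
        by (simp add: d funpow_add cancel)
      ultimately show ?thesis by (simp add: mom')
    qed
    finally show ?thesis .
  qed
  moreover have "prob_space N" unfolding N_def by (rule M.prob_space_distr) simp
  ultimately show ?thesis by (intro exI[of _ N]) (simp add: N_def)
qed

lemma (in unitary) cay_measures_nonempty:
  assumes dense: "closure (range (\<lambda>y. y - U y)) = UNIV" and "bop U'"
  shows "cay_measures U U' x \<noteq> {}"
proof -
  \<comment> \<open>Total mass of the wanted measure. With the mass factored out, the vector 0 can
    use any probability measure.\<close>
  define r where "r = (norm x)\<^sup>2"
  have "\<exists>N. prob_space N \<and> sets N = sets borel \<and>
    (\<forall>m n. of_real r * (\<integral>s. cay s ^ m * cnj (cay s) ^ n \<partial>N) = cinner x ((U ^^ m) ((U' ^^ n) x)))"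
  proof (cases "x = 0")
    case True
    have "prob_space (return borel (0::real))" by (rule prob_space_return) simp
    then show ?thesis using True by (intro exI[of _ "return borel 0"]) (simp add: r_def)
  next
    case False
    define u where "u = scaleC (1 / complex_of_real (norm x)) x"
    have nu: "norm u = 1" using False by (simp add: u_def norm_scaleC norm_divide)
    have xu: "x = scaleC (complex_of_real (norm x)) u"
      using False by (simp add: u_def scaleC_scaleC scaleC_one)
    obtain N where N: "prob_space N" "sets N = sets borel"
      "\<And>m n. (\<integral>s. cay s ^ m * cnj (cay s) ^ n \<partial>N) = cinner u ((U ^^ m) ((U' ^^ n) u))"
      using cay_measures_unit[OF nu dense] by blast
    have "cinner x ((U ^^ m) ((U' ^^ n) x)) = of_real r * cinner u ((U ^^ m) ((U' ^^ n) u))" for m n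
      by (subst (1 2) xu)
         (simp add: bop_scaleC[OF bop_pow[OF bop_U]] bop_scaleC[OF bop_pow[OF \<open>bop U'\<close>]]
           cinner_simps r_def power2_eq_square)
    then show ?thesis using N by (intro exI[of _ N]) simp
  qed
  then obtain N where N: "prob_space N" "sets N = sets borel"
    "\<And>m n. of_real r * (\<integral>s. cay s ^ m * cnj (cay s) ^ n \<partial>N) = cinner x ((U ^^ m) ((U' ^^ n) x))"
    by blast
  interpret N: prob_space N by fact
  define L where "L = density N (\<lambda>_. ennreal r)"
  have r0: "r \<ge> 0" by (simp add: r_def)
  have "finite_measure L"
    by (rule finite_measureI) (simp add: L_def emeasure_density N.emeasure_space_1 ennreal_mult_eq_top_iff)
  moreover have "(\<integral>s. cay s ^ m * cnj (cay s) ^ n \<partial>L) = cinner x ((U ^^ m) ((U' ^^ n) x))" for m n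
  proof -
    have "(\<lambda>s. cay s ^ m * cnj (cay s) ^ n) \<in> borel_measurable N"
      unfolding measurable_cong_sets[OF N(2) refl]
      by (intro borel_measurable_times borel_measurable_power bounded_borel_measurable
          bounded_borel_cnj bounded_borel_cay)
    then have "(\<integral>s. cay s ^ m * cnj (cay s) ^ n \<partial>L) = (\<integral>s. r *\<^sub>R (cay s ^ m * cnj (cay s) ^ n) \<partial>N)"
      unfolding L_def using r0 by (subst integral_density) auto
    also have "\<dots> = of_real r * (\<integral>s. cay s ^ m * cnj (cay s) ^ n \<partial>N)"
      by (simp add: scaleR_conv_of_real)
    finally show ?thesis using N(3) by simp
  qed
  ultimately have "L \<in> cay_measures U U' x"
    unfolding cay_measures_def using N(2) by (simp add: L_def)
  then show ?thesis by blast
qed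

text \<open>The constructed measure satisfies \<open>Phi cay = U\<close>, so its resolvent function
  gives the resolvent of \<open>T\<close>. Resolvents at the same point with equal values have the
  same range as domain and the same inverse, which identifies \<open>T\<close> with the spectral
  integral.\<close>

theorem spectral_theorem:
  assumes "self_adjoint T"
  shows "\<exists>E. is_pvm E \<and> represents E complex_of_real T"
proof -
  interpret T: self_adjoint_op T by (rule self_adjoint_op.intro) fact
  interpret V: unitary T.U T.U'
    by (rule unitary.intro) (rule T.bop_U T.adj_U T.U'U T.UU')+
  interpret C: cayley T.U T.U'
    by (rule cayley.intro)
       (rule T.bop_U T.bop_U' T.adj_U T.U'U T.UU' V.cay_measures_nonempty[OF T.range_one_minus_U_dense T.bop_U'])+
  interpret P: pvm C.E by (rule C.pvm_E)
  have R: "P.Phi res_i x = T.R \<i> x" for x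
  proof -
    have "x - scaleC (2 * \<i>) (P.Phi res_i x) = x - scaleC (2 * \<i>) (T.R \<i> x)"
      using P.Phi_cay_eq[of x] unfolding C.Phi_E_cay T.U_def by simp
    then have "scaleC (1 / (2 * \<i>)) (scaleC (2 * \<i>) (P.Phi res_i x))
        = scaleC (1 / (2 * \<i>)) (scaleC (2 * \<i>) (T.R \<i> x))" by simp
    then show ?thesis by (simp add: scaleC_scaleC scaleC_one)
  qed
  define S where "S = (P.sdom complex_of_real, P.sint complex_of_real)"
  have S: "represents C.E complex_of_real S"
    by (rule P.representsI) (auto simp: S_def odom_def oap_def)
  have "represents C.E complex_of_real T"
  proof (rule P.representsI)
    show dom: "odom T = P.sdom complex_of_real"
    proof (intro equalityI subsetI)
      fix x assume "x \<in> odom T"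
      then have "x = P.Phi res_i (oap T x + scaleC \<i> x)" unfolding R by (simp add: T.R(3))
      then show "x \<in> P.sdom complex_of_real"
        using P.res_i_inverse(1)[OF S] by (metis S_def fst_conv odom_def)
    next
      fix x assume "x \<in> P.sdom complex_of_real"
      then have "x = T.R \<i> (oap S x + scaleC \<i> x)"
        using P.res_i_inverse(3)[OF S, of x] unfolding R by (simp add: S_def odom_def)
      then show "x \<in> odom T" using T.R(1)[of \<i>] by metis
    qed
    fix x assume x: "x \<in> P.sdom complex_of_real"
    define y where "y = oap S x + scaleC \<i> x"
    have xy: "x = T.R \<i> y"
      using P.res_i_inverse(3)[OF S, of x] x unfolding R y_def by (simp add: S_def odom_def)
    have "oap T x + scaleC \<i> x = oap S x + scaleC \<i> x"
      using T.R(2)[of \<i> y] unfolding xy[symmetric] by (simp add: y_def)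
    then show "oap T x = P.sint complex_of_real x" by (simp add: S_def oap_def)
  qed simp
  then show ?thesis using C.is_pvm_E by blast
qed

section \<open>Polar decomposition and resolvents of the modulus\<close>

text \<open>The case distinction cannot be left to \<open>E\<close>, since the preimage of a
  non-Borel set may well be Borel.\<close>

definition pvm_map :: "(real \<Rightarrow> real) \<Rightarrow> (real set \<Rightarrow> 'a::complex_hilbert \<Rightarrow> 'a) \<Rightarrow> real set \<Rightarrow> 'a \<Rightarrow> 'a" where
  "pvm_map g E S = (if S \<in> sets borel then E (g -` S) else (\<lambda>_. 0))"

lemma vimage_borel: "g \<in> borel_measurable borel \<Longrightarrow> S \<in> sets borel \<Longrightarrow> g -` S \<in> sets borel"
  using measurable_sets[of g borel borel S] by simp

lemma (in pvm) is_pvm_map: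
  assumes g: "g \<in> borel_measurable borel"
  shows "is_pvm (pvm_map g E)"
  unfolding is_pvm_def
proof (intro conjI allI ballI impI)
  fix S :: "real set" assume "S \<notin> sets borel"
  then show "pvm_map g E S = (\<lambda>_. 0)" by (simp add: pvm_map_def)
next
  fix S :: "real set" and x y c assume S: "S \<in> sets borel"
  note gS = vimage_borel[OF g S]
  show "pvm_map g E S (x + y) = pvm_map g E S x + pvm_map g E S y"
    "pvm_map g E S (scaleC c x) = scaleC c (pvm_map g E S x)"
    "cinner (pvm_map g E S x) y = cinner x (pvm_map g E S y)"
    "pvm_map g E S (pvm_map g E S x) = pvm_map g E S x"
    using S gS by (simp_all add: pvm_map_def E_add E_scaleC E_sym E_idem)
next
  show "pvm_map g E UNIV = id" by (simp add: pvm_map_def E_UNIV)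
next
  fix S T :: "real set" assume "S \<in> sets borel" "T \<in> sets borel"
  then show "pvm_map g E (S \<inter> T) = pvm_map g E S \<circ> pvm_map g E T"
    using vimage_borel[OF g] by (simp add: pvm_map_def E_Int fun_eq_iff)
next
  fix F :: "nat \<Rightarrow> real set" and x assume F: "range F \<subseteq> sets borel" "disjoint_family F"
  have "(\<lambda>n. \<Sum>k<n. E (g -` F k) x) \<longlonglongrightarrow> E (\<Union>n. g -` F n) x"
  proof (rule E_sums)
    show "range (\<lambda>n. g -` F n) \<subseteq> sets borel" using F(1) vimage_borel[OF g] by auto
    show "disjoint_family (\<lambda>n. g -` F n)" using F(2) unfolding disjoint_family_on_def by auto
  qed
  moreover have "F n \<in> sets borel" for n using F(1) by auto
  ultimately show "(\<lambda>n. \<Sum>k<n. pvm_map g E (F k) x) \<longlonglongrightarrow> pvm_map g E (\<Union>n. F n) x"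
    by (simp add: pvm_map_def vimage_UN)
qed

lemma (in pvm) smeas_pvm_map:
  assumes g: "g \<in> borel_measurable borel"
  shows "smeas (pvm_map g E) x = distr (smeas E x) borel g"
proof (rule measure_eqI)
  have P: "pvm (pvm_map g E)" by (rule pvm.intro[OF is_pvm_map[OF g]])
  show "sets (smeas (pvm_map g E) x) = sets (distr (smeas E x) borel g)"
    by (simp add: pvm.sets_smeas[OF P])
  fix S assume "S \<in> sets (smeas (pvm_map g E) x)"
  then have S: "S \<in> sets borel" by (simp add: pvm.sets_smeas[OF P])
  have g': "g \<in> measurable (smeas E x) borel"
    using g by (simp add: measurable_cong_sets[OF sets_smeas refl])
  show "emeasure (smeas (pvm_map g E) x) S = emeasure (distr (smeas E x) borel g) S"
    using S by (simp add: pvm.emeasure_smeas[OF P S] emeasure_distr[OF g' S] emeasure_smeas vimage_borel[OF g] pvm_map_def)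
qed

lemma (in pvm) represents_pvm_map:
  assumes g: "g \<in> borel_measurable borel" and \<phi>: "\<phi> \<in> borel_measurable borel"
    and T: "represents E (\<lambda>s. \<phi> (g s)) T"
  shows "represents (pvm_map g E) \<phi> T"
proof -
  have g': "g \<in> measurable (smeas E x) borel" for x
    using g by (simp add: measurable_cong_sets[OF sets_smeas refl])
  have "(\<integral>\<^sup>+ s. ennreal ((cmod (\<phi> s))\<^sup>2) \<partial>smeas (pvm_map g E) x)
      = (\<integral>\<^sup>+ s. ennreal ((cmod (\<phi> (g s)))\<^sup>2) \<partial>smeas E x)" for x
    unfolding smeas_pvm_map[OF g] using \<phi> by (intro nn_integral_distr g') auto
  moreover have "(\<integral>s. \<phi> s \<partial>smeas (pvm_map g E) x) = (\<integral>s. \<phi> (g s) \<partial>smeas E x)" for x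
    unfolding smeas_pvm_map[OF g] by (rule integral_distr[OF g' \<phi>])
  ultimately show ?thesis using T unfolding represents_def by simp
qed

lemma (in pvm) Phi_pvm_map:
  assumes g: "g \<in> borel_measurable borel" and f: "bounded_borel f"
  shows "bounded_borel (\<lambda>s. f (g s))" "pvm.Phi (pvm_map g E) f = Phi (\<lambda>s. f (g s))"
proof -
  have P: "pvm (pvm_map g E)" by (rule pvm.intro[OF is_pvm_map[OF g]])
  show fg: "bounded_borel (\<lambda>s. f (g s))"
    using f g measurable_compose[OF g, of f borel] unfolding bounded_borel_def by auto
  show "pvm.Phi (pvm_map g E) f = Phi (\<lambda>s. f (g s))"
  proof (rule bop_eqI[OF pvm.bop_Phi[OF P f] bop_Phi[OF fg]])
    fix x
    have g': "g \<in> measurable (smeas E x) borel"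
      using g by (simp add: measurable_cong_sets[OF sets_smeas refl])
    have "cinner x (pvm.Phi (pvm_map g E) f x) = (\<integral>s. f (g s) \<partial>smeas E x)"
      unfolding pvm.Phi_repr[OF P f, symmetric] smeas_pvm_map[OF g]
      by (rule integral_distr[OF g' bounded_borel_measurable[OF f]])
    then show "cinner x (pvm.Phi (pvm_map g E) f x) = cinner x (Phi (\<lambda>s. f (g s)) x)"
      by (simp add: Phi_repr[OF fg])
  qed
qed

section \<open>Modulus, sign and polar factor of an injective operator\<close>

definition csgn :: "real \<Rightarrow> complex" where "csgn s = complex_of_real (sgn s)"

lemma bounded_borel_csgn [simp, intro]: "bounded_borel csgn"
  by (rule bounded_borelI[of _ 1]) (auto simp: csgn_def[abs_def] sgn_if)

locale injective_self_adjoint = pvm E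
  for E :: "real set \<Rightarrow> 'a::complex_hilbert \<Rightarrow> 'a" +
  fixes A :: "'a lop"
  assumes rep: "represents E complex_of_real A" and ker: "okernel A = {0}"
begin

lemma res: "spectral_resolution A = E"
  by (rule spectral_resolution_eqI[OF is_pvm rep])

lemmas dom_A = represents_imp(1)[OF borel_measurable_of_real rep]
lemmas ap_A = represents_imp(2)[OF borel_measurable_of_real rep]

text \<open>The range of \<open>E {0}\<close> lies in the kernel of \<open>A\<close>, because s
  vanishes on {0}. Values of symbols at 0 thereby cease to matter for \<open>Phi\<close>.\<close>

lemma E_zero: "E {0} x = 0"
proof -
  have z: "(\<lambda>s. indicator {0::real} s * complex_of_real s) = (\<lambda>_. 0)"
    by (auto simp: indicator_def)
  have ind: "bounded_borel (indicator {0::real})" by (rule bounded_borel_indicator) simp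
  have b: "bounded_borel (\<lambda>s. indicator {0::real} s * complex_of_real s)" unfolding z by simp
  note S = sint_Phi[OF borel_measurable_of_real ind b, of x]
  have "Phi (indicator {0}) x \<in> okernel A"
    unfolding okernel_def dom_A using S ap_A[OF S(1)] by (simp add: z Phi_zero)
  then show ?thesis using ker by (simp add: Phi_indicator)
qed

lemma Phi_cong_nonzero:
  assumes "bounded_borel f" "bounded_borel g" "\<And>s. s \<noteq> 0 \<Longrightarrow> f s = g s"
  shows "Phi f = Phi g"
proof (rule Phi_cong_off_null[OF _ _ assms(1,2)])
  have b: "bounded_borel (indicator {0::real})" by (rule bounded_borel_indicator) simp
  have eq: "(indicator (- {0::real}) :: real \<Rightarrow> complex) = (\<lambda>s. 1 - indicator {0} s)"
    by (auto simp: indicator_def)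
  have "Phi (\<lambda>s. 1 - indicator {0} s) x = x" for x
    by (subst Phi_diff) (simp_all add: b Phi_one Phi_indicator E_zero)
  then show "E (- {0}) = id"
    unfolding Phi_indicator[of "- {0}", symmetric, simplified] eq by auto
qed (use assms(3) in auto)

abbreviation J :: "'a \<Rightarrow> 'a" where "J \<equiv> Phi csgn"

lemma JJ: "J (J x) = x"
proof -
  have "Phi (\<lambda>s. csgn s * csgn s) = Phi (\<lambda>_. 1)"
    by (rule Phi_cong_nonzero[OF bounded_borel_mult[OF bounded_borel_csgn bounded_borel_csgn] bounded_borel_const])
       (auto simp: csgn_def sgn_if)
  then show ?thesis
    using Phi_mult[OF bounded_borel_csgn bounded_borel_csgn, of x] by (simp add: Phi_one)
qed

lemma adj_J: "adj J J"
proof -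
  have "(\<lambda>s. cnj (csgn s)) = csgn" by (auto simp: csgn_def)
  then show ?thesis using Phi_adj[OF bounded_borel_csgn] by simp
qed

lemma norm_J: "norm (J x) = norm x"
proof -
  have "(norm (J x))\<^sup>2 = (norm x)\<^sup>2"
    using adjD[OF adj_J, of x "J x"] by (simp add: norm_sq_eq_cinner JJ)
  then show ?thesis by (rule power2_eq_imp_eq) simp_all
qed

abbreviation cabs :: "real \<Rightarrow> complex" where "cabs \<equiv> \<lambda>s. complex_of_real \<bar>s\<bar>"

lemma cabs_measurable: "cabs \<in> borel_measurable borel" by simp

lemma rep_abs: "represents E cabs (absop A)"
  unfolding absop_def by (rule represents_fcalc[OF res cabs_measurable])

lemmas dom_abs = represents_imp(1)[OF cabs_measurable rep_abs]
lemmas ap_abs = represents_imp(2)[OF cabs_measurable rep_abs]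

lemma dom_abs_eq: "odom (absop A) = odom A"
  unfolding dom_abs dom_A sdom_def by simp

text \<open>By uniqueness of resolutions. It lets every function of \<open>absop A\<close> be
  evaluated as a function of |s| against the one measure \<open>E\<close>.\<close>

lemma res_abs: "spectral_resolution (absop A) = pvm_map abs E"
proof (rule spectral_resolution_eqI)
  show "is_pvm (pvm_map abs E)" by (rule is_pvm_map) simp
  show "represents (pvm_map abs E) complex_of_real (absop A)"
    by (rule represents_pvm_map) (simp_all add: rep_abs)
qed

definition pow_it :: "real \<Rightarrow> real \<Rightarrow> complex" where
  "pow_it t s = (if s > 0 then cis (t * ln s) else 0)"

lemma bounded_borel_pow_it: "bounded_borel (pow_it t)"
proof (rule bounded_borelI[of _ 1])
  have [measurable]: "cis \<in> borel_measurable borel"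
    by (intro borel_measurable_continuous_onI continuous_intros)
  show "pow_it t \<in> borel_measurable borel" unfolding pow_it_def[abs_def] by measurable
qed (simp add: pow_it_def)

lemma imag_power_abs:
  "odom (imag_power (absop A) t) = UNIV"
  "oap (imag_power (absop A) t) x = Phi (\<lambda>s. pow_it t \<bar>s\<bar>) x"
proof -
  have P: "pvm (pvm_map abs E)" by (rule pvm.intro[OF is_pvm_map]) simp
  have eq: "imag_power (absop A) t = fcalc (absop A) (pow_it t)"
    unfolding imag_power_def pow_it_def[abs_def] ..
  note fc = pvm.fcalc_eqI[OF P res_abs bounded_borel_measurable[OF bounded_borel_pow_it]]
  note b = pvm.bounded_sint[OF P bounded_borel_pow_it]
  show "odom (imag_power (absop A) t) = UNIV"
    unfolding eq fc by (simp add: odom_def b)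
  show "oap (imag_power (absop A) t) x = Phi (\<lambda>s. pow_it t \<bar>s\<bar>) x"
    unfolding eq fc by (simp add: oap_def b Phi_pvm_map(2)[OF _ bounded_borel_pow_it])
qed

text \<open>Since s and |s| have the same modulus, their truncations cut at the same points and
  differ exactly by the factor \<open>csgn\<close>; then pass to the limit.\<close>

lemma A_eq_J_abs:
  assumes x: "x \<in> odom A"
  shows "oap A x = J (oap (absop A) x)"
proof -
  have xa: "x \<in> sdom cabs" using x dom_abs_eq dom_abs by simp
  have xs: "x \<in> sdom complex_of_real" using x dom_A by simp
  have lim: "(\<lambda>n. J (Phi (trunc cabs n) x)) \<longlonglongrightarrow> J (sint cabs x)"
    by (rule bop_tendsto[OF bop_Phi[OF bounded_borel_csgn] sint_tendsto[OF cabs_measurable xa]])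
  have "J (Phi (trunc cabs n) x) = Phi (trunc complex_of_real n) x" for n
  proof -
    have "(\<lambda>s. csgn s * trunc cabs n s) = trunc complex_of_real n"
      by (auto simp: trunc_def csgn_def sgn_if)
    then show ?thesis
      using Phi_mult[OF bounded_borel_csgn bounded_borel_trunc[OF cabs_measurable], of n x] by simp
  qed
  then have "J (sint cabs x) = sint complex_of_real x"
    using LIMSEQ_unique[OF lim] sint_tendsto[OF borel_measurable_of_real xs] by simp
  then show ?thesis by (simp add: ap_A[OF xs] ap_abs[OF xa])
qed

lemma ker_abs: "okernel (absop A) = {0}"
proof -
  have "x = 0" if x: "x \<in> okernel (absop A)" for x
  proof -
    have d: "x \<in> odom A" "oap (absop A) x = 0" using x dom_abs_eq unfolding okernel_def by auto
    then have "oap A x = 0" using A_eq_J_abs[OF d(1)] bop_zero[OF bop_Phi[OF bounded_borel_csgn]] by simp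
    then show ?thesis using d ker unfolding okernel_def by auto
  qed
  moreover have "0 \<in> okernel (absop A)"
    unfolding okernel_def dom_abs using zero_in_sdom[OF cabs_measurable]
      linear_opD(3)[of "absop A"] rep_abs unfolding represents_def by simp
  ultimately show ?thesis by blast
qed

text \<open>Each \<open>Phi (h n) y\<close> has an explicit preimage, and these vectors tend to
  \<open>y\<close> because nothing sits at 0.\<close>

lemma range_abs_dense: "closure (oap (absop A) ` odom (absop A)) = UNIV"
proof -
  have "y \<in> closure (oap (absop A) ` odom (absop A))" for y
  proof -
    \<comment> \<open>The inverse of |s|, cut off near 0 to stay bounded; \<open>h n\<close> is its
      product with |s|.\<close>
    define g where "g n s = complex_of_real (if 1 / real (Suc n) \<le> \<bar>s\<bar> then 1 / \<bar>s\<bar> else 0)" for n s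
    define h where "h n s = complex_of_real (if 1 / real (Suc n) \<le> \<bar>s\<bar> then 1 else 0)" for n s
    have g: "bounded_borel (g n)" for n
    proof (rule bounded_borelI[of _ "real (Suc n)"])
      show "g n \<in> borel_measurable borel" unfolding g_def by measurable
      fix s
      show "cmod (g n s) \<le> real (Suc n)"
      proof (cases "1 / real (Suc n) \<le> \<bar>s\<bar>")
        case True
        have "0 < 1 / real (Suc n)" by simp
        with True have "\<bar>s\<bar> > 0" by linarith
        have "cmod (g n s) = 1 / \<bar>s\<bar>" unfolding g_def norm_of_real using True by simp
        moreover have "1 / \<bar>s\<bar> \<le> real (Suc n)" using True \<open>\<bar>s\<bar> > 0\<close> by (simp add: field_simps)
        ultimately show ?thesis by simp
      qed (simp add: g_def)
    qed
    have h: "bounded_borel (h n)" for n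
      by (rule bounded_borelI[of _ 1]) (auto simp: h_def[abs_def])
    have gh: "(\<lambda>s. g n s * cabs s) = h n" for n
    proof
      fix s
      have "0 < 1 / real (Suc n)" by simp
      then show "g n s * cabs s = h n s" by (auto simp: g_def h_def simp del: of_nat_Suc)
    qed
    have "Phi (g n) y \<in> sdom cabs" "sint cabs (Phi (g n) y) = Phi (h n) y" for n
      using sint_Phi[OF cabs_measurable g[of n], of y] h[of n] by (simp_all add: gh)
    then have "Phi (h n) y \<in> oap (absop A) ` odom (absop A)" for n
      unfolding dom_abs by (intro image_eqI[of _ _ "Phi (g n) y"]) (simp_all add: ap_abs)
    moreover have "(\<lambda>n. Phi (h n) y) \<longlonglongrightarrow> Phi (\<lambda>s. if s = 0 then 0 else 1) y"
    proof (rule Phi_limit[OF h, where C = 1])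
      fix n s show "cmod (h n s) \<le> 1" by (simp add: h_def)
      show "(\<lambda>n. h n s) \<longlonglongrightarrow> (if s = 0 then 0 else 1)"
      proof (cases "s = 0")
        case True
        have "h n 0 = 0" for n unfolding h_def by (simp del: of_nat_Suc)
        then show ?thesis using True by simp
      next
        case False
        obtain N where N: "inverse (real (Suc N)) < \<bar>s\<bar>" using reals_Archimedean[of "\<bar>s\<bar>"] False by auto
        have "h n s = 1" if "n \<ge> N" for n
        proof -
          have "1 / real (Suc n) \<le> 1 / real (Suc N)" using that by (intro divide_left_mono) auto
          then show ?thesis using N by (simp add: h_def inverse_eq_divide del: of_nat_Suc)
        qed
        then have "\<forall>\<^sub>F n in sequentially. h n s = 1" by (rule eventually_sequentiallyI)
        then show ?thesis using False by (simp add: tendsto_eventually)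
      qed
    qed
    moreover have "Phi (\<lambda>s. if s = 0 then 0 else 1) = Phi (\<lambda>_. 1)"
      by (rule Phi_cong_nonzero) (auto intro!: bounded_borelI[of _ 1])
    ultimately show ?thesis
      unfolding closure_sequential by (intro exI[of _ "\<lambda>n. Phi (h n) y"]) (simp add: Phi_one)
  qed
  then show ?thesis by auto
qed

text \<open>\<open>J\<close> satisfies the description by \<open>A_eq_J_abs\<close> and
  \<open>ker_abs\<close>. Any other candidate agrees with it on the range of \<open>absop A\<close>,
  which is dense, and both are bounded.\<close>

lemma polar_U_eq: "polar_U A = (UNIV, J)"
  unfolding polar_U_def
proof (rule the_equality)
  have b: "bop J" by (rule bop_Phi[OF bounded_borel_csgn])
  have "okernel (UNIV, J) = {0}"
    unfolding okernel_def odom_def oap_def using JJ bop_zero[OF b] by (auto, metis)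
  moreover have "op_eq A (ocomp (UNIV, J) (absop A))"
    unfolding op_eq_def ocomp_def using dom_abs_eq A_eq_J_abs by (simp add: odom_def oap_def)
  moreover have "linear_op (UNIV, J)"
    unfolding linear_op_def odom_def oap_def using bop_add[OF b] bop_scaleC[OF b] by simp
  ultimately show "odom (UNIV, J) = UNIV \<and> linear_op (UNIV, J) \<and> (\<exists>K. \<forall>x. norm (oap (UNIV, J) x) \<le> K * norm x) \<and>
      op_eq A (ocomp (UNIV, J) (absop A)) \<and> okernel (UNIV, J) = okernel (absop A)"
    using norm_J ker_abs by (auto simp: odom_def oap_def intro!: exI[of _ 1])
next
  fix V :: "'a lop"
  assume V: "odom V = UNIV \<and> linear_op V \<and> (\<exists>K. \<forall>x. norm (oap V x) \<le> K * norm x) \<and>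
      op_eq A (ocomp V (absop A)) \<and> okernel V = okernel (absop A)"
  have bV: "bop (oap V)"
    using V unfolding bop_def linear_op_def by auto
  have "oap V y = J y" for y
  proof -
    obtain f where f: "\<And>n. f n \<in> oap (absop A) ` odom (absop A)" "f \<longlonglongrightarrow> y"
      using closure_sequential[of y "oap (absop A) ` odom (absop A)"] unfolding range_abs_dense by blast
    have eq: "oap V (f n) = J (f n)" for n
    proof -
      obtain x where x: "x \<in> odom A" "f n = oap (absop A) x" using f(1)[of n] dom_abs_eq by auto
      have "oap A x = oap V (oap (absop A) x)"
        using V x(1) unfolding op_eq_def ocomp_def by (simp add: oap_def)
      then show ?thesis using A_eq_J_abs[OF x(1)] x(2) by simp
    qed
    have "(\<lambda>n. oap V (f n)) \<longlonglongrightarrow> oap V y" "(\<lambda>n. J (f n)) \<longlonglongrightarrow> J y"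
      by (rule bop_tendsto[OF bV f(2)], rule bop_tendsto[OF bop_Phi[OF bounded_borel_csgn] f(2)])
    then show ?thesis unfolding eq by (rule LIMSEQ_unique)
  qed
  then have "snd V = J" unfolding oap_def by auto
  then show "V = (UNIV, J)" using V unfolding odom_def by (auto simp: prod_eq_iff)
qed

text \<open>A bounded pointwise inverse \<open>g\<close> is enough: from
  \<open>g * cabs = 1 + l * g\<close> the product is bounded too, so \<open>sint_Phi\<close> shows
  that \<open>Phi g y\<close> solves the resolvent equation and \<open>Phi_sint\<close> that nothing
  else does.\<close>

lemma resolvent_abs:
  assumes g: "bounded_borel g" and inv: "\<And>s. g s * (cabs s - l) = 1"
  shows "odom (resolvent l (absop A)) = UNIV" "oap (resolvent l (absop A)) y = Phi g y"
    "bounded_borel (\<lambda>s. g s * cabs s)" "Phi g y \<in> odom (absop A)"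
proof -
  have eq: "g s * cabs s = 1 + l * g s" for s using inv[of s] by (simp add: algebra_simps)
  show gb: "bounded_borel (\<lambda>s. g s * cabs s)"
    unfolding eq by (intro bounded_borel_add bounded_borel_mult bounded_borel_const g)
  have val: "Phi (\<lambda>s. g s * cabs s) x = x + scaleC l (Phi g x)" for x
    unfolding eq by (simp add: Phi_add Phi_scale Phi_one g bounded_borel_mult)
  note S = sint_Phi[OF cabs_measurable g gb]
  show d: "Phi g y \<in> odom (absop A)" for y using S(1) dom_abs by simp
  have a: "oap (absop A) (Phi g y) - scaleC l (Phi g y) = y" for y
    using ap_abs[OF S(1)] S(2) val by simp
  show "odom (resolvent l (absop A)) = UNIV"
    unfolding resolvent_def odom_def fst_conv using d a by (metis (no_types, lifting) UNIV_eq_I image_eqI odom_def)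
  show "oap (resolvent l (absop A)) y = Phi g y"
    unfolding resolvent_def oap_def snd_conv
  proof (rule the_equality)
    show "Phi g y \<in> odom (absop A) \<and> snd (absop A) (Phi g y) - scaleC l (Phi g y) = y"
      using d a unfolding oap_def by simp
    fix f assume f: "f \<in> odom (absop A) \<and> snd (absop A) f - scaleC l f = y"
    then have fs: "f \<in> sdom cabs" using dom_abs by simp
    have "Phi g y = Phi g (oap (absop A) f) - scaleC l (Phi g f)"
      using f unfolding oap_def by (auto simp: bop_diff[OF bop_Phi[OF g]] bop_scaleC[OF bop_Phi[OF g]])
    also have "Phi g (oap (absop A) f) = f + scaleC l (Phi g f)"
      unfolding ap_abs[OF fs] Phi_sint[OF cabs_measurable fs g gb] val ..
    finally show "f = Phi g y" by simp
  qed
qed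

end

section \<open>Intertwining imaginary powers\<close>

text \<open>Both points lie in the same open half-plane or both on the positive axis, so their
  arguments differ by less than pi and no multiple of 2 pi \<i> intervenes. Shifting a ray by
  different real amounts leaves the imaginary part unchanged, which is how the situation
  arises.\<close>

lemma Ln_divide_same_Im:
  assumes ab: "Im a = Im b" "a \<notin> \<real>\<^sub>\<le>\<^sub>0" "b \<notin> \<real>\<^sub>\<le>\<^sub>0"
  shows "Ln (a / b) = Ln a - Ln b"
proof (rule Ln_unique)
  have ne: "a \<noteq> 0" "b \<noteq> 0" using ab by auto
  show "exp (Ln a - Ln b) = a / b" using ne by (simp add: exp_diff)
  have bounds: "- pi < Im (Ln a)" "Im (Ln a) \<le> pi" "- pi < Im (Ln b)" "Im (Ln b) \<le> pi"
    using ne by (simp_all add: mpi_less_Im_Ln Im_Ln_le_pi)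
  have "- pi < Im (Ln a - Ln b) \<and> Im (Ln a - Ln b) < pi"
  proof (cases "Im a" "0::real" rule: linorder_cases)
    case less
    then have "Im (Ln a) < 0" "Im (Ln b) < 0"
      using Im_Ln_pos_le[OF ne(1)] Im_Ln_pos_le[OF ne(2)] bounds ab(1) by linarith+
    then show ?thesis using bounds by simp
  next
    case equal
    then have "Re a > 0" "Re b > 0" using ab by (auto simp: complex_nonpos_Reals_iff)
    then have "Im (Ln a) = 0" "Im (Ln b) = 0"
      using equal ab(1) Im_Ln_eq_0[OF ne(1)] Im_Ln_eq_0[OF ne(2)] by auto
    then show ?thesis by simp
  next
    case greater
    then show ?thesis using Im_Ln_pos_lt_imp[of a] Im_Ln_pos_lt_imp[of b] ab(1) by auto
  qed
  then show "- pi < Im (Ln a - Ln b)" "Im (Ln a - Ln b) \<le> pi" by auto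
qed

text \<open>By the law of cosines the squared modulus is r^2 + l^2 + 2 r l cos \<alpha>. Both angles
  0 and \<theta> get the same lower bounds, so one constant serves both members of an intertwined
  pair.\<close>

lemma ray_plus_pos:
  fixes r l \<theta> \<alpha> :: real
  assumes r: "r \<ge> 0" and l: "l > 0" and \<alpha>: "\<alpha> = 0 \<or> \<alpha> = \<theta>" and \<theta>: "sin \<theta> \<noteq> 0"
  shows "of_real r * cis \<alpha> + of_real l \<notin> \<real>\<^sub>\<le>\<^sub>0"
    and "\<bar>sin \<theta>\<bar> * l \<le> cmod (of_real r * cis \<alpha> + of_real l)"
    and "\<bar>sin \<theta>\<bar> * r \<le> cmod (of_real r * cis \<alpha> + of_real l)"
proof -
  let ?z = "of_real r * cis \<alpha> + of_real l"
  have Re: "Re ?z = r * cos \<alpha> + l" and Im: "Im ?z = r * sin \<alpha>" by auto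
  show "?z \<notin> \<real>\<^sub>\<le>\<^sub>0"
  proof
    assume "?z \<in> \<real>\<^sub>\<le>\<^sub>0"
    then have "r * cos \<alpha> + l \<le> 0" "r * sin \<alpha> = 0" unfolding complex_nonpos_Reals_iff Re Im by auto
    then show False using \<alpha> \<theta> r l by auto
  qed
  have sq: "(cmod ?z)\<^sup>2 = r\<^sup>2 + l\<^sup>2 + 2 * r * l * cos \<alpha>"
  proof -
    have "(cmod ?z)\<^sup>2 = (r * cos \<alpha> + l)\<^sup>2 + (r * sin \<alpha>)\<^sup>2"
      unfolding cmod_power2 Re Im ..
    also have "(r * sin \<alpha>)\<^sup>2 = r\<^sup>2 - (r * cos \<alpha>)\<^sup>2"
      by (simp add: power_mult_distrib sin_squared_eq algebra_simps)
    finally show ?thesis by (simp add: power2_sum)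
  qed
  have both: "(sin \<theta> * x)\<^sup>2 \<le> (cmod ?z)\<^sup>2" if xy: "x = l \<and> y = r \<or> x = r \<and> y = l" for x y
    using \<alpha>
  proof
    assume a: "\<alpha> = 0"
    have "(sin \<theta> * x)\<^sup>2 \<le> 1 * x\<^sup>2"
      unfolding power_mult_distrib by (intro mult_right_mono) (auto simp: sin_squared_eq)
    also have "\<dots> \<le> (cmod ?z)\<^sup>2" unfolding sq using a xy r l by auto
    finally show ?thesis .
  next
    assume a: "\<alpha> = \<theta>"
    \<comment> \<open>Completing the square in \<open>y\<close>; the expression is symmetric in
      \<open>r\<close> and \<open>l\<close>, so either may play the part of
      \<open>x\<close>.\<close>
    have "(cmod ?z)\<^sup>2 = (y + x * cos \<theta>)\<^sup>2 + (sin \<theta> * x)\<^sup>2"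
      unfolding sq using xy a by (auto simp: power2_eq_square algebra_simps sin_squared_eq[unfolded power2_eq_square])
    then show ?thesis by simp
  qed
  have "\<bar>sin \<theta> * x\<bar> \<le> cmod ?z" if "x = l \<or> x = r" for x
  proof -
    have "(sin \<theta> * x)\<^sup>2 \<le> (cmod ?z)\<^sup>2" using that both by auto
    then show ?thesis by (metis abs_le_square_iff abs_norm_cancel)
  qed
  from this[of l] this[of r] show "\<bar>sin \<theta>\<bar> * l \<le> cmod ?z" "\<bar>sin \<theta>\<bar> * r \<le> cmod ?z"
    using r l by (auto simp: abs_mult)
qed

definition ray :: "real \<Rightarrow> real \<Rightarrow> complex" where
  "ray \<alpha> s = complex_of_real \<bar>s\<bar> * cis \<alpha>"

lemma ray_measurable [measurable]: "ray \<alpha> \<in> borel_measurable borel"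
  unfolding ray_def[abs_def] by measurable

lemma (in pvm) bounded_borel_limit:
  assumes "\<And>n. bounded_borel (f n)" "\<And>n s. cmod (f n s) \<le> C" "\<And>s. (\<lambda>n. f n s) \<longlonglongrightarrow> g s"
  shows "bounded_borel g"
  using bounded_borel_integral_tendsto(2)[OF finite_smeas sets_smeas assms] .

section \<open>Pairs of functions intertwined by B\<close>

locale self_adjoint_pair = injective_self_adjoint E A
  for E :: "real set \<Rightarrow> 'a::complex_hilbert \<Rightarrow> 'a" and A :: "'a lop" +
  fixes B :: "'a lop"
  assumes sa_B: "self_adjoint B"
begin

text \<open>The operator inclusion of \<open>Phi g\<close> after \<open>B\<close> in
  \<open>B\<close> after \<open>Phi f\<close>. Two functions are needed because moving
  \<open>B\<close> across rotates the argument of the symbol.\<close>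

definition intertw :: "(real \<Rightarrow> complex) \<Rightarrow> (real \<Rightarrow> complex) \<Rightarrow> bool" where
  "intertw f g \<longleftrightarrow> bounded_borel f \<and> bounded_borel g \<and>
     (\<forall>h\<in>odom B. Phi f h \<in> odom B \<and> oap B (Phi f h) = Phi g (oap B h))"

lemmas lin_B = self_adjoint_linear[OF sa_B]
lemmas sub_B = linear_op_csubspace[OF lin_B]

lemma intertw_one: "intertw (\<lambda>_. 1) (\<lambda>_. 1)"
  unfolding intertw_def by (simp add: Phi_one)

lemma intertw_lin_comb:
  assumes "intertw f g" "intertw f' g'"
  shows "intertw (\<lambda>s. a * f s + b * f' s) (\<lambda>s. a * g s + b * g' s)"
proof -
  have bb: "bounded_borel f" "bounded_borel g" "bounded_borel f'" "bounded_borel g'"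
    using assms unfolding intertw_def by auto
  show ?thesis
    unfolding intertw_def
  proof (intro conjI ballI)
    fix h assume h: "h \<in> odom B"
    have 1: "Phi f h \<in> odom B" "oap B (Phi f h) = Phi g (oap B h)"
      and 2: "Phi f' h \<in> odom B" "oap B (Phi f' h) = Phi g' (oap B h)"
      using assms h unfolding intertw_def by auto
    show "Phi (\<lambda>s. a * f s + b * f' s) h \<in> odom B"
      unfolding Phi_lin_comb[OF bb(1,3)] by (intro csubspaceD(2,3)[OF sub_B] 1 2)
    show "oap B (Phi (\<lambda>s. a * f s + b * f' s) h) = Phi (\<lambda>s. a * g s + b * g' s) (oap B h)"
      unfolding Phi_lin_comb[OF bb(1,3)] Phi_lin_comb[OF bb(2,4)]
      by (simp add: linear_opD[OF lin_B] csubspaceD(3)[OF sub_B] 1 2)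
  qed (intro bounded_borel_add bounded_borel_mult bounded_borel_const bb)+
qed

lemma intertw_mult:
  assumes "intertw f g" "intertw f' g'"
  shows "intertw (\<lambda>s. f s * f' s) (\<lambda>s. g s * g' s)"
  unfolding intertw_def
proof (intro conjI ballI)
  have bb: "bounded_borel f" "bounded_borel g" "bounded_borel f'" "bounded_borel g'"
    using assms unfolding intertw_def by auto
  show "bounded_borel (\<lambda>s. f s * f' s)" "bounded_borel (\<lambda>s. g s * g' s)"
    by (intro bounded_borel_mult bb)+
  fix h assume h: "h \<in> odom B"
  have 2: "Phi f' h \<in> odom B" "oap B (Phi f' h) = Phi g' (oap B h)"
    using assms h unfolding intertw_def by auto
  have 1: "Phi f (Phi f' h) \<in> odom B" "oap B (Phi f (Phi f' h)) = Phi g (oap B (Phi f' h))"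
    using assms 2(1) unfolding intertw_def by auto
  show "Phi (\<lambda>s. f s * f' s) h \<in> odom B"
    using 1 by (simp add: Phi_mult bb)
  show "oap B (Phi (\<lambda>s. f s * f' s) h) = Phi (\<lambda>s. g s * g' s) (oap B h)"
    using 1 2 by (simp add: Phi_mult bb)
qed

lemma intertw_power: "intertw f g \<Longrightarrow> intertw (\<lambda>s. f s ^ n) (\<lambda>s. g s ^ n)"
proof (induction n)
  case 0
  then show ?case using intertw_one by simp
next
  case (Suc n)
  then show ?case using intertw_mult[of f g "\<lambda>s. f s ^ n" "\<lambda>s. g s ^ n"] by simp
qed

text \<open>Closedness of \<open>B\<close> needs convergence of the vectors and of their images,
  hence uniform bounds on both sequences of symbols.\<close>

lemma intertw_limit:
  assumes fg: "\<And>n. intertw (f n) (g n)"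
    and bound: "\<And>n s. cmod (f n s) \<le> C" "\<And>n s. cmod (g n s) \<le> C"
    and lim: "\<And>s. (\<lambda>n. f n s) \<longlonglongrightarrow> f' s" "\<And>s. (\<lambda>n. g n s) \<longlonglongrightarrow> g' s"
  shows "intertw f' g'"
  unfolding intertw_def
proof (intro conjI ballI)
  have bb: "bounded_borel (f n)" "bounded_borel (g n)" for n
    using fg[of n] unfolding intertw_def by auto
  show "bounded_borel f'" "bounded_borel g'"
    using bounded_borel_limit[OF bb(1) bound(1) lim(1)] bounded_borel_limit[OF bb(2) bound(2) lim(2)] .
  fix h assume h: "h \<in> odom B"
  have 1: "Phi (f n) h \<in> odom B" "oap B (Phi (f n) h) = Phi (g n) (oap B h)" for n
    using fg[of n] h unfolding intertw_def by auto
  have 2: "(\<lambda>n. Phi (f n) h) \<longlonglongrightarrow> Phi f' h"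
    by (rule Phi_limit[OF bb(1) bound(1) lim(1)])
  have 3: "(\<lambda>n. oap B (Phi (f n) h)) \<longlonglongrightarrow> Phi g' (oap B h)"
    unfolding 1(2) by (rule Phi_limit[OF bb(2) bound(2) lim(2)])
  from self_adjoint_closed[OF sa_B 1(1) 2 3]
  show "Phi f' h \<in> odom B" "oap B (Phi f' h) = Phi g' (oap B h)" by auto
qed

lemma intertw_sum:
  assumes "\<And>k. intertw (f k) (g k)"
  shows "intertw (\<lambda>s. \<Sum>k<(n::nat). a k * f k s) (\<lambda>s. \<Sum>k<n. a k * g k s)"
proof (induction n)
  case 0
  then show ?case using intertw_lin_comb[OF intertw_one intertw_one, of 0 0] by simp
next
  case (Suc n)
  then show ?case using intertw_lin_comb[OF Suc assms[of n], of 1 "a n"] by simp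
qed

end

text \<open>The resolvents of \<open>absop A\<close> are transported by \<open>B\<close> to resolvents at points of a rotated
  ray. Finite products of powers of quotients of shifted rays telescope to imaginary powers, and
  each factor is a binomial series in a resolvent as soon as the shift ratio \<open>\<kappa>\<close> is near 1.\<close>

locale rotated_resolvents = self_adjoint_pair E A B
  for E :: "real set \<Rightarrow> 'a::complex_hilbert \<Rightarrow> 'a" and A B :: "'a lop" +
  fixes \<theta> :: real
  assumes \<theta>: "- pi < \<theta>" "\<theta> < pi" "sin \<theta> \<noteq> 0"
    and base: "\<And>l. l > 0 \<Longrightarrow>
      intertw (\<lambda>s. 1 / (ray 0 s + complex_of_real l)) (\<lambda>s. 1 / (ray \<theta> s + complex_of_real l))"
begin

definition angle :: "real \<Rightarrow> bool" where "angle \<alpha> \<longleftrightarrow> \<alpha> = 0 \<or> \<alpha> = \<theta>"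

lemma angle [simp]: "angle 0" "angle \<theta>"
  by (simp_all add: angle_def)

definition c :: real where "c = \<bar>sin \<theta>\<bar>"

lemma c: "0 < c" "c \<le> 1"
  using \<theta> unfolding c_def by auto

text \<open>Chosen so that (1 - 1 / \<kappa>) / c = 1 / 2, which keeps the variable
  \<open>vv\<close> of the binomial series inside the disc of radius 1 / 2 for every shift
  \<open>l\<close>.\<close>

definition \<kappa> :: real where "\<kappa> = 1 / (1 - c / 2)"

lemma \<kappa>: "\<kappa> > 1" "1 - 1 / \<kappa> = c / 2"
  using c unfolding \<kappa>_def by (auto simp: field_simps)

lemma ray_bounds:
  assumes "angle \<alpha>" "l > 0"
  shows "ray \<alpha> s + complex_of_real l \<notin> \<real>\<^sub>\<le>\<^sub>0" "c * l \<le> cmod (ray \<alpha> s + complex_of_real l)"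
    "ray \<alpha> s + complex_of_real l \<noteq> 0"
proof -
  have "\<bar>s\<bar> \<ge> 0" by simp
  note b = ray_plus_pos[OF this assms(2) _ \<theta>(3), of \<alpha>]
  show 1: "ray \<alpha> s + complex_of_real l \<notin> \<real>\<^sub>\<le>\<^sub>0" "c * l \<le> cmod (ray \<alpha> s + complex_of_real l)"
    using b assms(1) unfolding angle_def ray_def c_def by auto
  show "ray \<alpha> s + complex_of_real l \<noteq> 0" using 1(1) by auto
qed

text \<open>A multiple of the resolvent symbol at \<kappa> l, made so that
  \<open>1 + vv l \<alpha> s\<close> is the quotient of the two shifted rays
  (\<open>one_plus_vv\<close>).\<close>

definition vv :: "real \<Rightarrow> real \<Rightarrow> real \<Rightarrow> complex" where
  "vv l \<alpha> s = - (complex_of_real ((\<kappa> - 1) * l)) * (1 / (ray \<alpha> s + complex_of_real (\<kappa> * l)))"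

lemma cmod_vv:
  assumes "angle \<alpha>" "l > 0"
  shows "cmod (vv l \<alpha> s) \<le> 1 / 2"
proof -
  have kl: "\<kappa> * l > 0" using \<kappa> assms by simp
  have pos: "c * (\<kappa> * l) > 0" using c kl by simp
  have cpos: "cmod (ray \<alpha> s + complex_of_real (\<kappa> * l)) > 0"
    using pos ray_bounds(2)[OF assms(1) kl] by (rule order.strict_trans2)
  have nn: "0 \<le> (\<kappa> - 1) * l" using \<kappa> assms by simp
  have "cmod (vv l \<alpha> s) = (\<kappa> - 1) * l / cmod (ray \<alpha> s + complex_of_real (\<kappa> * l))"
    unfolding vv_def using \<kappa> assms by (simp add: norm_mult norm_divide del: of_real_mult of_real_diff)
  also have "\<dots> \<le> (\<kappa> - 1) * l / (c * (\<kappa> * l))"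
    by (rule divide_left_mono[OF ray_bounds(2)[OF assms(1) kl] nn mult_pos_pos[OF cpos pos]])
  also have "\<dots> = (1 - 1 / \<kappa>) / c" using \<kappa>(1) assms c by (simp add: field_simps)
  also have "\<dots> = 1 / 2" unfolding \<kappa>(2) using c by simp
  finally show ?thesis .
qed

lemma one_plus_vv:
  assumes "angle \<alpha>" "l > 0"
  shows "1 + vv l \<alpha> s = (ray \<alpha> s + complex_of_real l) / (ray \<alpha> s + complex_of_real (\<kappa> * l))"
proof -
  have "\<kappa> * l > 0" using \<kappa> assms by simp
  from ray_bounds(3)[OF assms(1) this] show ?thesis
    unfolding vv_def by (simp add: field_simps)
qed

lemma intertw_vv: "l > 0 \<Longrightarrow> intertw (vv l 0) (vv l \<theta>)"
proof -
  assume "l > 0"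
  then have "\<kappa> * l > 0" using \<kappa> by simp
  from intertw_lin_comb[OF base[OF this] intertw_one, of "- (complex_of_real ((\<kappa> - 1) * l))" 0]
  show ?thesis by (simp add: vv_def[abs_def])
qed

text \<open>The power \<i> t of the quotient of shifted rays, written with a difference of
  logarithms so that products telescope exactly.\<close>

definition step :: "real \<Rightarrow> real \<Rightarrow> real \<Rightarrow> real \<Rightarrow> complex" where
  "step t l \<alpha> s = exp (\<i> * complex_of_real t *
     (Ln (ray \<alpha> s + complex_of_real l) - Ln (ray \<alpha> s + complex_of_real (\<kappa> * l))))"

lemma step_eq_powr:
  assumes "angle \<alpha>" "l > 0"
  shows "step t l \<alpha> s = (1 + vv l \<alpha> s) powr (\<i> * complex_of_real t)"
proof -
  have kl: "\<kappa> * l > 0" using \<kappa> assms by simp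
  note 1 = ray_bounds[OF assms, of s] and 2 = ray_bounds[OF assms(1) kl, of s]
  have "Ln (1 + vv l \<alpha> s) = Ln (ray \<alpha> s + complex_of_real l) - Ln (ray \<alpha> s + complex_of_real (\<kappa> * l))"
    unfolding one_plus_vv[OF assms] by (rule Ln_divide_same_Im) (use 1 2 in auto)
  moreover have "1 + vv l \<alpha> s \<noteq> 0"
    unfolding one_plus_vv[OF assms] using 1(3) 2(3) by simp
  ultimately show ?thesis by (simp add: step_def powr_def)
qed

text \<open>The binomial series is a limit of polynomials in \<open>vv\<close>. As |vv| \<le> 1 / 2
  for both angles, its partial sums are bounded uniformly in \<open>n\<close> and
  \<open>s\<close>.\<close>

lemma intertw_step:
  assumes l: "l > 0"
  shows "intertw (step t l 0) (step t l \<theta>)"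
proof -
  define a where "a n = (\<i> * complex_of_real t) gchoose n" for n
  \<comment> \<open>Convergence at a point strictly between 1 / 2 and 1 yields absolute convergence
    at 1 / 2.\<close>
  have "summable (\<lambda>n. a n * (3 / 4 :: complex) ^ n)"
    using gen_binomial_complex[of "3 / 4" "\<i> * complex_of_real t"] unfolding a_def by (auto simp: sums_iff)
  from powser_insidea[OF this, of "1 / 2"]
  have sm: "summable (\<lambda>n. cmod (a n) * (1 / 2) ^ n)" by (simp add: norm_mult norm_power)
  define C where "C = (\<Sum>n. cmod (a n) * (1 / 2) ^ n)"
  have bound: "cmod (\<Sum>k<n. a k * vv l \<alpha> s ^ k) \<le> C" if \<alpha>: "angle \<alpha>" for n \<alpha> s
  proof -
    have "cmod (\<Sum>k<n. a k * vv l \<alpha> s ^ k) \<le> (\<Sum>k<n. cmod (a k) * (1 / 2) ^ k)"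
      using cmod_vv[OF \<alpha> l, of s]
      by (intro sum_norm_le) (auto simp: norm_mult norm_power intro!: mult_left_mono power_mono)
    also have "\<dots> \<le> C" unfolding C_def by (rule sum_le_suminf[OF sm]) auto
    finally show ?thesis .
  qed
  have lim: "(\<lambda>n. \<Sum>k<n. a k * vv l \<alpha> s ^ k) \<longlonglongrightarrow> step t l \<alpha> s" if \<alpha>: "angle \<alpha>" for \<alpha> s
  proof -
    have "cmod (vv l \<alpha> s) < 1" using cmod_vv[OF \<alpha> l, of s] by simp
    from gen_binomial_complex[OF this] show ?thesis
      unfolding step_eq_powr[OF \<alpha> l] a_def sums_def .
  qed
  show ?thesis
  proof (rule intertw_limit[OF intertw_sum[OF intertw_power[OF intertw_vv[OF l]], of a]])
    show "cmod (\<Sum>k<n. a k * vv l 0 s ^ k) \<le> C" "cmod (\<Sum>k<n. a k * vv l \<theta> s ^ k) \<le> C" for n s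
      using bound by simp_all
    show "(\<lambda>n. \<Sum>k<n. a k * vv l 0 s ^ k) \<longlonglongrightarrow> step t l 0 s"
      "(\<lambda>n. \<Sum>k<n. a k * vv l \<theta> s ^ k) \<longlonglongrightarrow> step t l \<theta> s" for s
      using lim by simp_all
  qed
qed

definition tele :: "real \<Rightarrow> nat \<Rightarrow> real \<Rightarrow> real \<Rightarrow> complex" where
  "tele t n \<alpha> s = exp (\<i> * complex_of_real t *
     (Ln (ray \<alpha> s + complex_of_real (1 / \<kappa> ^ n)) - Ln (ray \<alpha> s + complex_of_real (\<kappa> ^ n))))"

text \<open>One factor is added at each end, so the range of shifts grows from
  [\<kappa>^-n, \<kappa>^n] to the next power in both directions.\<close>

lemma tele_Suc: "tele t (Suc n) \<alpha> s = step t (1 / \<kappa> ^ Suc n) \<alpha> s * (tele t n \<alpha> s * step t (\<kappa> ^ n) \<alpha> s)"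
proof -
  have "\<kappa> * (1 / \<kappa> ^ Suc n) = 1 / \<kappa> ^ n" using \<kappa>(1) by (simp add: field_simps)
  then show ?thesis
    unfolding tele_def step_def exp_add[symmetric] by (simp add: algebra_simps)
qed

lemma intertw_tele: "intertw (tele t n 0) (tele t n \<theta>)"
proof (induction n)
  case 0
  have "tele t 0 \<alpha> = (\<lambda>_. 1)" for \<alpha> by (simp add: tele_def[abs_def])
  then show ?case using intertw_one by simp
next
  case (Suc n)
  have "1 / \<kappa> ^ Suc n > 0" "\<kappa> ^ n > 0" using \<kappa> by simp_all
  then have "intertw (\<lambda>s. step t (1 / \<kappa> ^ Suc n) 0 s * (tele t n 0 s * step t (\<kappa> ^ n) 0 s))
      (\<lambda>s. step t (1 / \<kappa> ^ Suc n) \<theta> s * (tele t n \<theta> s * step t (\<kappa> ^ n) \<theta> s))"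
    by (intro intertw_mult intertw_step Suc)
  then show ?case unfolding tele_Suc[symmetric] .
qed

text \<open>The exponential compensates the divergent modulus of the shift \<kappa>^n. The indicator
  removes s = 0, where the shift \<kappa>^-n alone remains under the logarithm.\<close>

definition approx :: "real \<Rightarrow> nat \<Rightarrow> real \<Rightarrow> real \<Rightarrow> complex" where
  "approx t n \<alpha> s = indicator (- {0}) s *
     (exp (\<i> * complex_of_real t * complex_of_real (ln (\<kappa> ^ n))) * tele t n \<alpha> s)"

text \<open>As \<open>E {0}\<close> vanishes, this symbol acts as the identity and may be multiplied
  into any intertwined pair.\<close>

lemma intertw_indicator: "intertw (indicator (- {0})) (indicator (- {0}))"
proof -
  have b: "bounded_borel (indicator (- {0::real}))" by (rule bounded_borel_indicator) simp
  have "Phi (indicator (- {0})) = Phi (\<lambda>_. 1)"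
    by (rule Phi_cong_nonzero[OF b]) auto
  then show ?thesis unfolding intertw_def using b by (simp add: Phi_one)
qed

lemma intertw_approx: "intertw (approx t n 0) (approx t n \<theta>)"
proof -
  let ?e = "exp (\<i> * complex_of_real t * complex_of_real (ln (\<kappa> ^ n)))"
  have "intertw (\<lambda>s. ?e * tele t n 0 s) (\<lambda>s. ?e * tele t n \<theta> s)"
    using intertw_lin_comb[OF intertw_tele intertw_one, of ?e t n 0] by simp
  from intertw_mult[OF intertw_indicator this] show ?thesis
    by (simp add: approx_def[abs_def])
qed

lemma cmod_exp_i: "cmod (exp (\<i> * complex_of_real t * z)) = exp (- t * Im z)"
  by (simp add: norm_exp_eq_Re)

text \<open>The modulus of exp (\<i> t z) depends only on Im z, and principal logarithms have
  imaginary part within pi. The divergent compensating phase has modulus 1.\<close>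

lemma cmod_approx:
  assumes \<alpha>: "angle \<alpha>"
  shows "cmod (approx t n \<alpha> s) \<le> exp (\<bar>t\<bar> * (2 * pi))"
proof -
  have pos: "1 / \<kappa> ^ n > 0" "\<kappa> ^ n > 0" using \<kappa> by simp_all
  define a where "a = Ln (ray \<alpha> s + complex_of_real (1 / \<kappa> ^ n))"
  define b where "b = Ln (ray \<alpha> s + complex_of_real (\<kappa> ^ n))"
  have "- pi < Im a" "Im a \<le> pi" "- pi < Im b" "Im b \<le> pi"
    using ray_bounds(3)[OF \<alpha> pos(1), of s] ray_bounds(3)[OF \<alpha> pos(2), of s]
    unfolding a_def b_def by (auto intro: mpi_less_Im_Ln Im_Ln_le_pi)
  then have "\<bar>Im (a - b)\<bar> \<le> 2 * pi" by simp
  then have "\<bar>t\<bar> * \<bar>Im (a - b)\<bar> \<le> \<bar>t\<bar> * (2 * pi)" by (rule mult_left_mono) simp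
  moreover have "- t * Im (a - b) \<le> \<bar>t\<bar> * \<bar>Im (a - b)\<bar>" by (metis abs_ge_self abs_minus_cancel abs_mult)
  ultimately have "cmod (tele t n \<alpha> s) \<le> exp (\<bar>t\<bar> * (2 * pi))"
    unfolding tele_def a_def[symmetric] b_def[symmetric] cmod_exp_i by simp
  moreover have "cmod (approx t n \<alpha> s) \<le> cmod (tele t n \<alpha> s)"
    unfolding approx_def norm_mult cmod_exp_i by (auto simp: indicator_def)
  ultimately show ?thesis by simp
qed

text \<open>The logarithm with the small shift tends to that of the ray, which is ln |s| + \<i>
  \<alpha> because |\<alpha>| < pi; the one with the large shift tends to 0 after its real scale is
  removed.\<close>

lemma approx_tendsto:
  assumes \<alpha>: "angle \<alpha>"
  shows "(\<lambda>n. approx t n \<alpha> s) \<longlonglongrightarrow>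
    (if s = 0 then 0 else exp (\<i> * complex_of_real t * (complex_of_real (ln \<bar>s\<bar>) + \<i> * complex_of_real \<alpha>)))"
proof (cases "s = 0")
  case True
  then show ?thesis by (simp add: approx_def)
next
  case False
  have a_pi: "- pi < \<alpha>" "\<alpha> < pi" using \<alpha> \<theta> pi_gt_zero unfolding angle_def by auto
  have inv: "(\<lambda>n. 1 / \<kappa> ^ n) \<longlonglongrightarrow> 0"
    using LIMSEQ_inverse_realpow_zero[OF \<kappa>(1)] by (simp add: inverse_eq_divide)
  then have invc: "(\<lambda>n. complex_of_real (1 / \<kappa> ^ n)) \<longlonglongrightarrow> complex_of_real 0"
    by (rule tendsto_of_real)
  have Ln_ray: "Ln (ray \<alpha> s) = complex_of_real (ln \<bar>s\<bar>) + \<i> * complex_of_real \<alpha>"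
  proof (rule Ln_unique)
    show "exp (complex_of_real (ln \<bar>s\<bar>) + \<i> * complex_of_real \<alpha>) = ray \<alpha> s"
      unfolding exp_add exp_of_real cis_conv_exp[symmetric] using False by (simp add: ray_def)
  qed (use a_pi in auto)
  have slit: "ray \<alpha> s \<notin> \<real>\<^sub>\<le>\<^sub>0"
  proof
    assume "ray \<alpha> s \<in> \<real>\<^sub>\<le>\<^sub>0"
    then have "\<bar>s\<bar> * cos \<alpha> \<le> 0" "\<bar>s\<bar> * sin \<alpha> = 0" unfolding ray_def complex_nonpos_Reals_iff by auto
    then show False using False \<alpha> \<theta>(3) unfolding angle_def by auto
  qed
  have 1: "(\<lambda>n. Ln (ray \<alpha> s + complex_of_real (1 / \<kappa> ^ n))) \<longlonglongrightarrow> Ln (ray \<alpha> s)"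
    using tendsto_Ln[OF tendsto_add[OF tendsto_const invc], of "ray \<alpha> s"] slit by simp
  have "(\<lambda>n. Ln (ray \<alpha> s * complex_of_real (1 / \<kappa> ^ n) + 1)) \<longlonglongrightarrow> Ln (ray \<alpha> s * complex_of_real 0 + 1)"
    by (intro tendsto_intros invc) simp
  then have 2: "(\<lambda>n. Ln (ray \<alpha> s * complex_of_real (1 / \<kappa> ^ n) + 1)) \<longlonglongrightarrow> 0" by simp
  \<comment> \<open>A positive real factor never moves a number across the branch cut, so the
    divergent part of the logarithm is exactly \<open>ln (\<kappa> ^ n)\<close>, which cancels the
    phase in \<open>approx\<close>.\<close>
  have eq: "Ln (ray \<alpha> s + complex_of_real (\<kappa> ^ n))
      = complex_of_real (ln (\<kappa> ^ n)) + Ln (ray \<alpha> s * complex_of_real (1 / \<kappa> ^ n) + 1)" for n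
  proof -
    have k: "\<kappa> ^ n > 0" using \<kappa> by simp
    have e: "ray \<alpha> s + complex_of_real (\<kappa> ^ n)
        = complex_of_real (\<kappa> ^ n) * (ray \<alpha> s * complex_of_real (1 / \<kappa> ^ n) + 1)"
      using \<kappa>(1) by (simp add: field_simps)
    have "ray \<alpha> s * complex_of_real (1 / \<kappa> ^ n) + 1 \<noteq> 0"
      using e ray_bounds(3)[OF \<alpha> k, of s] by auto
    from Ln_times_of_real[OF k this] show ?thesis unfolding e Ln_of_real[OF k] .
  qed
  have "(\<lambda>n. exp (\<i> * complex_of_real t * (Ln (ray \<alpha> s + complex_of_real (1 / \<kappa> ^ n))
       - Ln (ray \<alpha> s * complex_of_real (1 / \<kappa> ^ n) + 1))))
     \<longlonglongrightarrow> exp (\<i> * complex_of_real t * (Ln (ray \<alpha> s) - 0))"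
    by (intro tendsto_intros 1 2)
  moreover have "approx t n \<alpha> s = exp (\<i> * complex_of_real t * (Ln (ray \<alpha> s + complex_of_real (1 / \<kappa> ^ n))
       - Ln (ray \<alpha> s * complex_of_real (1 / \<kappa> ^ n) + 1)))" for n
    using False unfolding approx_def tele_def eq by (simp add: algebra_simps flip: exp_add)
  ultimately show ?thesis using False by (simp add: Ln_ray)
qed

text \<open>At angle \<theta> the logarithm gains \<i> \<theta>, and multiplication by \<i> t turns
  this into the real exponent -\<theta> t.\<close>

lemma intertw_pow_it:
  "intertw (\<lambda>s. pow_it t \<bar>s\<bar>) (\<lambda>s. complex_of_real (exp (- \<theta> * t)) * pow_it t \<bar>s\<bar>)"
proof -
  have "intertw (\<lambda>s. if s = 0 then 0 else exp (\<i> * complex_of_real t * (complex_of_real (ln \<bar>s\<bar>) + \<i> * complex_of_real 0)))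
     (\<lambda>s. if s = 0 then 0 else exp (\<i> * complex_of_real t * (complex_of_real (ln \<bar>s\<bar>) + \<i> * complex_of_real \<theta>)))"
    by (rule intertw_limit[OF intertw_approx cmod_approx cmod_approx approx_tendsto approx_tendsto]) simp_all
  moreover have "(\<lambda>s. if s = 0 then 0 else exp (\<i> * complex_of_real t * (complex_of_real (ln \<bar>s\<bar>) + \<i> * complex_of_real 0)))
      = (\<lambda>s. pow_it t \<bar>s\<bar>)"
    by (auto simp: pow_it_def cis_conv_exp mult_ac)
  moreover have "(\<lambda>s. if s = 0 then 0 else exp (\<i> * complex_of_real t * (complex_of_real (ln \<bar>s\<bar>) + \<i> * complex_of_real \<theta>)))
      = (\<lambda>s. complex_of_real (exp (- \<theta> * t)) * pow_it t \<bar>s\<bar>)"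
  proof
    fix s :: real
    have "\<i> * complex_of_real t * (complex_of_real (ln \<bar>s\<bar>) + \<i> * complex_of_real \<theta>)
        = complex_of_real (- \<theta> * t) + \<i> * complex_of_real (t * ln \<bar>s\<bar>)"
      by (simp add: complex_eq_iff)
    then show "(if s = 0 then 0 else exp (\<i> * complex_of_real t * (complex_of_real (ln \<bar>s\<bar>) + \<i> * complex_of_real \<theta>)))
      = complex_of_real (exp (- \<theta> * t)) * pow_it t \<bar>s\<bar>"
      by (simp only: exp_add exp_of_real cis_conv_exp[symmetric] pow_it_def) simp
  qed
  ultimately show ?thesis by simp
qed

end

section \<open>Anticommutation of the polar parts\<close>

lemma injective_self_adjointI:
  assumes "self_adjoint A" "okernel A = {0}"
  obtains E where "injective_self_adjoint E A"
proof -
  obtain E where "is_pvm E" "represents E complex_of_real A"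
    using spectral_theorem[OF assms(1)] by blast
  then have "injective_self_adjoint E A"
    using assms(2) by (intro injective_self_adjoint.intro pvm.intro injective_self_adjoint_axioms.intro)
  then show thesis by (rule that)
qed

section \<open>Conjugation of a spectral measure by an involution\<close>

definition pvm_conj :: "('a::complex_hilbert \<Rightarrow> 'a) \<Rightarrow> (real set \<Rightarrow> 'a \<Rightarrow> 'a) \<Rightarrow> real set \<Rightarrow> 'a \<Rightarrow> 'a" where
  "pvm_conj W E S x = W (E S (W x))"

lemma (in pvm) is_pvm_conj:
  assumes W: "bop W" and WW: "\<And>x. W (W x) = x" and adj: "adj W W"
  shows "is_pvm (pvm_conj W E)"
  unfolding is_pvm_def
proof (intro conjI allI ballI impI)
  fix S :: "real set" assume "S \<notin> sets borel"
  then have "E S = (\<lambda>_. 0)" using is_pvm by (simp add: is_pvm_def)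
  then show "pvm_conj W E S = (\<lambda>_. 0)" by (simp add: pvm_conj_def[abs_def] bop_zero[OF W])
next
  fix S :: "real set" and x y c assume S: "S \<in> sets borel"
  show "pvm_conj W E S (x + y) = pvm_conj W E S x + pvm_conj W E S y"
    "pvm_conj W E S (scaleC c x) = scaleC c (pvm_conj W E S x)"
    "cinner (pvm_conj W E S x) y = cinner x (pvm_conj W E S y)"
    "pvm_conj W E S (pvm_conj W E S x) = pvm_conj W E S x"
    using S by (simp_all add: pvm_conj_def E_add E_scaleC E_sym E_idem bop_add[OF W] bop_scaleC[OF W]
        adjD[OF adj] WW)
next
  show "pvm_conj W E UNIV = id" by (auto simp: pvm_conj_def E_UNIV WW)
next
  fix S T :: "real set" assume "S \<in> sets borel" "T \<in> sets borel"
  then show "pvm_conj W E (S \<inter> T) = pvm_conj W E S \<circ> pvm_conj W E T"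
    by (auto simp: pvm_conj_def E_Int WW)
next
  fix F :: "nat \<Rightarrow> real set" and x assume F: "range F \<subseteq> sets borel" "disjoint_family F"
  have "(\<lambda>n. W (\<Sum>k<n. E (F k) (W x))) \<longlonglongrightarrow> W (E (\<Union>n. F n) (W x))"
    by (rule bop_tendsto[OF W E_sums[OF F]])
  then show "(\<lambda>n. \<Sum>k<n. pvm_conj W E (F k) x) \<longlonglongrightarrow> pvm_conj W E (\<Union>n. F n) x"
    by (simp add: pvm_conj_def bop_sum[OF W])
qed

lemma smeas_pvm_conj:
  assumes "\<And>x. norm (W x) = norm x"
  shows "smeas (pvm_conj W E) x = smeas E (W x)"
  unfolding smeas_def pvm_conj_def assms ..

section \<open>From the core relation to the polar parts\<close>

context self_adjoint_pair
begin

definition anti :: bool where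
  "anti \<longleftrightarrow> (\<forall>h\<in>odom B. J h \<in> odom B \<and> oap B (J h) = - J (oap B h))"

lemma core_sequence:
  assumes "is_core D B" "h \<in> odom B"
  obtains f where "\<And>n. f n \<in> D" "f \<longlonglongrightarrow> h" "(\<lambda>n. oap B (f n)) \<longlonglongrightarrow> oap B h"
proof -
  have "(h, oap B h) \<in> closure ((\<lambda>f. (f, oap B f)) ` D)"
    using assms unfolding is_core_def by auto
  then obtain p where p: "\<And>n. p n \<in> (\<lambda>f. (f, oap B f)) ` D" "p \<longlonglongrightarrow> (h, oap B h)"
    unfolding closure_sequential by blast
  have "fst (p n) \<in> D" "oap B (fst (p n)) = snd (p n)" for n using p(1)[of n] by auto
  moreover have "(\<lambda>n. fst (p n)) \<longlonglongrightarrow> h" "(\<lambda>n. snd (p n)) \<longlonglongrightarrow> oap B h"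
    using tendsto_fst[OF p(2)] tendsto_snd[OF p(2)] by simp_all
  ultimately show thesis using that[of "\<lambda>n. fst (p n)"] by simp
qed

text \<open>For \<open>f\<close> in the core and the regularization \<open>h' = (absop A + l)\<inverse> h\<close>, moving \<open>A\<close> and \<open>B\<close>
  across the inner product turns \<open>\<langle>B f, A h'\<rangle>\<close> into \<open>\<langle>f, - J absop A (absop A - l q)\<inverse> B h\<rangle>\<close>; then let
  \<open>l \<rightarrow> 0\<close>.\<close>

lemma anti_if_core:
  assumes q: "q = - cnj (cis \<theta>)" and \<theta>: "sin \<theta> \<noteq> 0"
    and core: "is_core (Dp q A B) B" and sa_A: "self_adjoint A"
    and base: "\<And>l. l > 0 \<Longrightarrow>
      intertw (\<lambda>s. 1 / (ray 0 s + complex_of_real l)) (\<lambda>s. 1 / (ray \<theta> s + complex_of_real l))"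
  shows anti
  unfolding anti_def
proof
  fix h assume h: "h \<in> odom B"
  define l where "l n = 1 / real (Suc n)" for n
  have l0: "l n > 0" for n by (simp add: l_def)
  have llim: "l \<longlonglongrightarrow> 0" unfolding l_def by (rule LIMSEQ_inverse_real_of_nat[unfolded inverse_eq_divide])
  define f where "f \<alpha> n s = 1 / (ray \<alpha> s + complex_of_real (l n))" for \<alpha> n s
  have bb: "bounded_borel (f 0 n)" "bounded_borel (f \<theta> n)" for n
    using base[OF l0[of n]] unfolding intertw_def f_def by auto
  \<comment> \<open>Symbol of \<open>A\<close> applied to the regularization. It is bounded
    uniformly in \<open>n\<close>, and as the shift tends to 0 it becomes the sign times the phase
    \<open>cnj (cis \<alpha>)\<close>.\<close>
  define u where "u \<alpha> n s = complex_of_real s * f \<alpha> n s" for \<alpha> n s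
  define C where "C = 1 / \<bar>sin \<theta>\<bar>"
  have ubound: "cmod (u \<alpha> n s) \<le> C" if \<alpha>: "\<alpha> = 0 \<or> \<alpha> = \<theta>" for \<alpha> n s
  proof -
    have "\<bar>s\<bar> \<ge> 0" by simp
    note b = ray_plus_pos[OF this l0[of n] \<alpha> \<theta>]
    have pos: "cmod (ray \<alpha> s + complex_of_real (l n)) > 0"
      using b(1) unfolding ray_def by (metis zero_less_norm_iff complex_nonpos_Reals_iff order_refl zero_complex.sel)
    have "cmod (u \<alpha> n s) = \<bar>s\<bar> / cmod (ray \<alpha> s + complex_of_real (l n))"
      unfolding u_def f_def by (simp add: norm_mult norm_divide)
    also have "\<dots> \<le> C"
      using b(3) pos \<theta> unfolding ray_def[symmetric] C_def by (simp add: field_simps)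
    finally show ?thesis .
  qed
  have umeas: "bounded_borel (u \<alpha> n)" if \<alpha>: "\<alpha> = 0 \<or> \<alpha> = \<theta>" for \<alpha> n
    by (rule bounded_borelI[OF _ ubound[OF \<alpha>]]) (simp add: u_def[abs_def] f_def)
  have ulim: "(\<lambda>n. u \<alpha> n s) \<longlonglongrightarrow> cnj (cis \<alpha>) * csgn s" for \<alpha> s
  proof (cases "s = 0")
    case True
    then show ?thesis by (simp add: u_def csgn_def)
  next
    case False
    have "(\<lambda>n. complex_of_real s * (1 / (ray \<alpha> s + complex_of_real (l n))))
        \<longlonglongrightarrow> complex_of_real s * (1 / (ray \<alpha> s + complex_of_real 0))"
      using False by (intro tendsto_intros llim) (simp add: ray_def)
    moreover have "complex_of_real s * (1 / (ray \<alpha> s + complex_of_real 0)) = cnj (cis \<alpha>) * csgn s"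
      using False by (auto simp: ray_def csgn_def sgn_if abs_if cis_cnj cis_inverse[symmetric] field_simps)
    ultimately show ?thesis unfolding u_def f_def by simp
  qed
  have key: "cinner (oap B g) (J h) = cinner g (- J (oap B h))" if g: "g \<in> Dp q A B" for g
  proof (rule LIMSEQ_unique)
    have g1: "g \<in> odom A" "oap A g \<in> odom B" "g \<in> odom B" "oap B g \<in> odom A"
      "oap A (oap B g) = scaleC q (oap B (oap A g))"
      using g unfolding Dp_def ocomp_def by (auto simp: odom_def oap_def)
    have uf: "(\<lambda>s. f \<alpha> n s * complex_of_real s) = u \<alpha> n" for \<alpha> n by (rule ext) (simp add: u_def mult.commute)
    have sf: "Phi (f \<alpha> n) y \<in> odom A \<and> oap A (Phi (f \<alpha> n) y) = Phi (u \<alpha> n) y"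
      if \<alpha>: "\<alpha> = 0 \<or> \<alpha> = \<theta>" for \<alpha> n y
    proof -
      have b1: "bounded_borel (f \<alpha> n)" using bb \<alpha> by auto
      have b2: "bounded_borel (\<lambda>s. f \<alpha> n s * complex_of_real s)" unfolding uf by (rule umeas[OF \<alpha>])
      note S = sint_Phi[OF borel_measurable_of_real b1 b2, of y]
      show ?thesis using S ap_A[OF S(1)] dom_A by (simp add: uf)
    qed
    have eq: "cinner (oap B g) (Phi (u 0 n) h) = cinner g (scaleC (cnj q) (Phi (u \<theta> n) (oap B h)))" for n
    proof -
      \<comment> \<open>Regularizing puts \<open>h'\<close> in both domains and also
        \<open>oap B h'\<close> in the domain of \<open>A\<close>, so each of the three transfers
        across the inner product is legitimate.\<close>
      define h' where "h' = Phi (f 0 n) h"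
      have h': "h' \<in> odom B" "oap B h' = Phi (f \<theta> n) (oap B h)"
        using base[OF l0[of n]] h unfolding intertw_def f_def[symmetric] h'_def by auto
      have hA: "h' \<in> odom A" "oap A h' = Phi (u 0 n) h" using sf[of 0 n h] unfolding h'_def by auto
      have hB: "oap B h' \<in> odom A" "oap A (oap B h') = Phi (u \<theta> n) (oap B h)"
        using sf[of \<theta> n "oap B h"] unfolding h'(2) by auto
      have "cinner (oap B g) (Phi (u 0 n) h) = cinner (oap A (oap B g)) h'"
        using self_adjoint_sym[OF sa_A g1(4) hA(1)] hA(2) by simp
      also have "\<dots> = cnj q * cinner (oap B (oap A g)) h'"
        unfolding g1(5) by (simp add: cinner_scaleC_left)
      also have "\<dots> = cnj q * cinner (oap A g) (oap B h')"
        using self_adjoint_sym[OF sa_B g1(2) h'(1)] by simp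
      also have "\<dots> = cnj q * cinner g (oap A (oap B h'))"
        using self_adjoint_sym[OF sa_A g1(1) hB(1)] by simp
      finally show ?thesis unfolding hB(2) by (simp add: cinner_scaleC_right)
    qed
    have "(\<lambda>n. Phi (u 0 n) h) \<longlonglongrightarrow> Phi (\<lambda>s. cnj (cis 0) * csgn s) h"
      by (rule Phi_limit[OF umeas ubound ulim]) simp_all
    then have "(\<lambda>n. Phi (u 0 n) h) \<longlonglongrightarrow> J h" by simp
    then show "(\<lambda>n. cinner (oap B g) (Phi (u 0 n) h)) \<longlonglongrightarrow> cinner (oap B g) (J h)"
      by (intro tendsto_intros)
    have "(\<lambda>n. Phi (u \<theta> n) (oap B h)) \<longlonglongrightarrow> Phi (\<lambda>s. cnj (cis \<theta>) * csgn s) (oap B h)"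
      by (rule Phi_limit[OF umeas ubound ulim]) simp_all
    then have "(\<lambda>n. Phi (u \<theta> n) (oap B h)) \<longlonglongrightarrow> scaleC (cnj (cis \<theta>)) (J (oap B h))"
      by (simp add: Phi_scale)
    then have "(\<lambda>n. cinner g (scaleC (cnj q) (Phi (u \<theta> n) (oap B h))))
        \<longlonglongrightarrow> cinner g (scaleC (cnj q) (scaleC (cnj (cis \<theta>)) (J (oap B h))))"
      by (intro tendsto_intros)
    \<comment> \<open>The two phases multiply to -1 by the choice of \<open>\<theta>\<close>; this
      is where the minus sign of the anticommutation appears.\<close>
    moreover have "scaleC (cnj q) (scaleC (cnj (cis \<theta>)) (J (oap B h))) = - J (oap B h)"
      by (simp add: q scaleC_scaleC cis_cnj cis_mult scaleC_minus_left scaleC_one)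
    ultimately show "(\<lambda>n. cinner (oap B g) (Phi (u 0 n) h)) \<longlonglongrightarrow> cinner g (- J (oap B h))"
      unfolding eq by simp
  qed
  \<comment> \<open>Approximation in the graph norm extends the identity from the core to the whole
    domain, as \<open>self_adjoint_intro\<close> requires.\<close>
  have "cinner (oap B g) (J h) = cinner g (- J (oap B h))" if g: "g \<in> odom B" for g
  proof -
    obtain k where k: "\<And>n. k n \<in> Dp q A B" "k \<longlonglongrightarrow> g" "(\<lambda>n. oap B (k n)) \<longlonglongrightarrow> oap B g"
      using core_sequence[OF core g] by blast
    have "(\<lambda>n. cinner (oap B (k n)) (J h)) \<longlonglongrightarrow> cinner (oap B g) (J h)"
      "(\<lambda>n. cinner (k n) (- J (oap B h))) \<longlonglongrightarrow> cinner g (- J (oap B h))"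
      by (intro tendsto_intros k)+
    then show ?thesis using key[OF k(1)] LIMSEQ_unique by auto
  qed
  from self_adjoint_intro[OF sa_B this]
  show "J h \<in> odom B \<and> oap B (J h) = - J (oap B h)" by simp
qed

text \<open>Conjugating the resolution of \<open>B\<close> by \<open>J\<close> and reflecting the
  line gives a second resolution of \<open>B\<close>. Uniqueness makes it equal to the first, so
  \<open>J\<close> exchanges the positive and negative spectral projections and reverses their
  difference, the sign of \<open>B\<close>.\<close>

lemma polar_anticommute:
  assumes anti: anti and F: "injective_self_adjoint F B"
  shows "oap (polar_U A) (oap (polar_U B) x) = - oap (polar_U B) (oap (polar_U A) x)"
proof -
  interpret F: injective_self_adjoint F B by (rule F)
  have bJ: "bop J" by (rule bop_Phi[OF bounded_borel_csgn])
  have JB: "J h \<in> odom B" "oap B (J h) = - J (oap B h)" if "h \<in> odom B" for h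
    using anti that unfolding anti_def by auto
  \<comment> \<open>\<open>J\<close> is an involution, so invariance of the domain in one direction
    gives the other.\<close>
  have domJ: "J h \<in> odom B \<longleftrightarrow> h \<in> odom B" for h using JB(1)[of h] JB(1)[of "J h"] by (auto simp: JJ)
  define G where "G = pvm_conj J F"
  have G: "pvm G" unfolding G_def by (rule pvm.intro[OF F.is_pvm_conj[OF bJ JJ adj_J]])
  have "represents G (\<lambda>s. complex_of_real (- s)) B"
    unfolding represents_def
  proof (intro conjI ballI)
    show "odom B = {x. (\<integral>\<^sup>+ s. ennreal ((cmod (complex_of_real (- s)))\<^sup>2) \<partial>smeas G x) < \<infinity>}"
      unfolding G_def smeas_pvm_conj[of J, OF norm_J] using domJ F.dom_A unfolding F.sdom_def by auto
    show "linear_op B" by (rule lin_B)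
    fix x assume x: "x \<in> odom B"
    have "cinner (J x) (oap B (J x)) = - cinner x (oap B x)"
      using adjD[OF adj_J, of x "- J (oap B x)"] JB(2)[OF x] by (simp add: cinner_minus_right JJ bop_minus[OF bJ])
    moreover have "cinner (J x) (oap B (J x)) = (\<integral>s. complex_of_real s \<partial>smeas F (J x))"
      using F.rep domJ x unfolding represents_def by blast
    ultimately show "cinner x (oap B x) = (\<integral>s. complex_of_real (- s) \<partial>smeas G x)"
      unfolding G_def smeas_pvm_conj[of J, OF norm_J] by (simp add: minus_equation_iff)
  qed
  then have "represents (pvm_map uminus G) complex_of_real B"
    by (intro pvm.represents_pvm_map[OF G]) auto
  moreover have "is_pvm (pvm_map uminus G)" by (rule pvm.is_pvm_map[OF G]) simp
  ultimately have "pvm_map uminus G = F"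
    using F.is_pvm F.rep by (intro spectral_measure_unique)
  then have FJ: "F S (J x) = J (F (uminus -` S) x)" if "S \<in> sets borel" for S x
  proof -
    have "F S (J x) = pvm_map uminus G S (J x)" using \<open>pvm_map uminus G = F\<close> by simp
    then show ?thesis using that by (simp add: pvm_map_def G_def pvm_conj_def JJ)
  qed
  have JF: "F.J y = F {0<..} y - F {..<0} y" for y
  proof -
    have "csgn = (\<lambda>s. indicator {0<..} s - indicator {..<0} s)"
      by (auto simp: csgn_def sgn_if indicator_def)
    then have "F.J y = F.Phi (\<lambda>s. indicator {0<..} s - indicator {..<0} s) y" by simp
    also have "\<dots> = F {0<..} y - F {..<0} y"
      by (subst F.Phi_diff) (auto simp: F.Phi_indicator)
    finally show ?thesis .
  qed
  have v: "uminus -` {0<..} = {..<(0::real)}" "uminus -` {..<0} = {(0::real)<..}" by auto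
  have "J (F.J x) = - F.J (J x)"
    unfolding JF using FJ[of "{0<..}" x] FJ[of "{..<0}" x] by (simp add: v bop_diff[OF bJ])
  then show ?thesis by (simp add: polar_U_eq F.polar_U_eq oap_def)
qed

end

text \<open>Shifting by pi towards 0 keeps the angle inside (-pi, pi) and negates the phase. The
  nonvanishing sine keeps the rotated ray off the real line and makes the constants of
  \<open>ray_plus_pos\<close> positive.\<close>

lemma theta1_facts:
  assumes "0 < \<bar>\<theta>0\<bar>" "\<bar>\<theta>0\<bar> < pi"
  shows "- pi < theta1 \<theta>0" "theta1 \<theta>0 < pi" "sin (theta1 \<theta>0) \<noteq> 0" "cis (- \<theta>0) = - cnj (cis (theta1 \<theta>0))"
proof -
  show b: "- pi < theta1 \<theta>0" "theta1 \<theta>0 < pi" using assms by (auto simp: theta1_def split: if_splits)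
  have "sin \<theta>0 \<noteq> 0"
    using assms sin_gt_zero[of \<theta>0] sin_gt_zero[of "- \<theta>0"] by (cases "\<theta>0 > 0") auto
  then show "sin (theta1 \<theta>0) \<noteq> 0" by (auto simp: theta1_def sin_diff sin_add)
  show "cis (- \<theta>0) = - cnj (cis (theta1 \<theta>0))"
    by (auto simp: theta1_def complex_eq_iff cos_diff cos_add sin_diff sin_add)
qed

theorem mainTheorem13:
  fixes A B :: "'a::complex_hilbert lop" and \<theta>0 :: real and q :: complex
  assumes "0 < \<bar>\<theta>0\<bar>" and "\<bar>\<theta>0\<bar> < pi"
    and "q = cis (- \<theta>0)"
    and "self_adjoint A" and "self_adjoint B"
    and "okernel A = {0}" and "okernel B = {0}"
    and "is_core (Dp q A B) B"
    and "is_core (Dp (- q) (absop A) B) B"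
    and "\<forall>l::real. l > 0 \<longrightarrow>
           op_sub (oscale (- q) (ocomp (resolvent (complex_of_real l * q) (absop A)) B))
                  (ocomp B (resolvent (complex_of_real (- l)) (absop A)))"
  shows "class_C1 \<theta>0 A B"
proof -
  define \<theta> where "\<theta> = theta1 \<theta>0"
  note th = theta1_facts[OF assms(1,2), folded \<theta>_def]
  have q: "q = - cnj (cis \<theta>)" using assms(3) th(4) by simp
  obtain E where E: "injective_self_adjoint E A" using injective_self_adjointI[OF assms(4,6)] .
  obtain F where F: "injective_self_adjoint F B" using injective_self_adjointI[OF assms(5,7)] .
  interpret self_adjoint_pair E A B
    by (rule self_adjoint_pair.intro[OF E self_adjoint_pair_axioms.intro[OF assms(5)]])
  have base: "intertw (\<lambda>s. 1 / (ray 0 s + complex_of_real l)) (\<lambda>s. 1 / (ray \<theta> s + complex_of_real l))"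
    if l: "l > 0" for l
  proof -
    have rp: "ray \<alpha> s + complex_of_real l \<noteq> 0 \<and> \<bar>sin \<theta>\<bar> * l \<le> cmod (ray \<alpha> s + complex_of_real l)"
      if "\<alpha> = 0 \<or> \<alpha> = \<theta>" for \<alpha> s
      using ray_plus_pos(1,2)[OF abs_ge_zero[of s] l that th(3)] unfolding ray_def by auto
    have bb: "bounded_borel (\<lambda>s. 1 / (ray \<alpha> s + complex_of_real l))" if \<alpha>: "\<alpha> = 0 \<or> \<alpha> = \<theta>" for \<alpha>
    proof (rule bounded_borelI[of _ "1 / (\<bar>sin \<theta>\<bar> * l)"])
      fix s
      have "0 < \<bar>sin \<theta>\<bar> * l" using th(3) l by simp
      then show "cmod (1 / (ray \<alpha> s + complex_of_real l)) \<le> 1 / (\<bar>sin \<theta>\<bar> * l)"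
        using rp[OF \<alpha>, of s] by (simp add: norm_divide frac_le)
    qed simp
    define g0 where "g0 s = 1 / (ray 0 s + complex_of_real l)" for s
    have b0: "bounded_borel g0" unfolding g0_def[abs_def] by (rule bb) simp
    have qq: "cis \<theta> = - cnj q" "cnj q * q = 1" "q * cnj q = 1"
      by (simp_all add: q cis_cnj cis_mult)
    have b1: "bounded_borel (\<lambda>s. cis \<theta> * (1 / (ray \<theta> s + complex_of_real l)))"
      by (intro bounded_borel_mult bounded_borel_const bb) simp
    have inv0: "g0 s * (cabs s - complex_of_real (- l)) = 1" for s
      using rp[of 0 s] by (simp add: g0_def ray_def)
    \<comment> \<open>As \<open>- q\<close> is \<open>cnj (cis \<theta>)\<close>, multiplying |s| -
      l q by \<open>cis \<theta>\<close> gives the shifted ray. The factor \<open>- q\<close> in the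
      hypothesis then removes the extra \<open>cis \<theta>\<close>.\<close>
    have inv1: "cis \<theta> * (1 / (ray \<theta> s + complex_of_real l)) * (cabs s - complex_of_real l * q) = 1" for s
    proof -
      have "cis \<theta> * (cabs s - complex_of_real l * q) = ray \<theta> s + complex_of_real l"
        unfolding qq(1) ray_def using qq(2) by (simp add: algebra_simps)
      then show ?thesis using rp[of \<theta> s] by (simp add: mult.assoc mult.left_commute field_simps)
    qed
    note R0 = resolvent_abs[OF b0 inv0] and R1 = resolvent_abs[OF b1 inv1]
    show ?thesis
      unfolding intertw_def
    proof (intro conjI ballI bb)
      fix h assume h: "h \<in> odom B"
      have op: "op_sub (oscale (- q) (ocomp (resolvent (complex_of_real l * q) (absop A)) B))
                  (ocomp B (resolvent (complex_of_real (- l)) (absop A)))"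
        using assms(10) l by blast
      have hd: "h \<in> odom (oscale (- q) (ocomp (resolvent (complex_of_real l * q) (absop A)) B))"
        using h R1(1) by (simp add: oscale_def ocomp_def odom_def)
      have "h \<in> odom (ocomp B (resolvent (complex_of_real (- l)) (absop A)))"
        using op hd unfolding op_sub_def by blast
      then have 1: "Phi g0 h \<in> odom B"
        unfolding ocomp_def odom_def[of "(_, _)"] fst_conv R0(2) by simp
      have "oap (ocomp B (resolvent (complex_of_real (- l)) (absop A))) h
          = oap (oscale (- q) (ocomp (resolvent (complex_of_real l * q) (absop A)) B)) h"
        using op hd unfolding op_sub_def by simp
      then have "oap B (Phi g0 h) = scaleC (- q) (Phi (\<lambda>s. cis \<theta> * (1 / (ray \<theta> s + complex_of_real l))) (oap B h))"
        unfolding ocomp_def oscale_def oap_def[of "(_, _)"] snd_conv R0(2) R1(2) .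
      also have "\<dots> = Phi (\<lambda>s. 1 / (ray \<theta> s + complex_of_real l)) (oap B h)"
        by (simp only: Phi_scale[OF bb[of \<theta>]] simp_thms scaleC_scaleC) (simp add: qq scaleC_one)
      finally show "oap B (Phi (\<lambda>s. 1 / (ray 0 s + complex_of_real l)) h)
          = Phi (\<lambda>s. 1 / (ray \<theta> s + complex_of_real l)) (oap B h)"
        unfolding g0_def .
      show "Phi (\<lambda>s. 1 / (ray 0 s + complex_of_real l)) h \<in> odom B" using 1 unfolding g0_def .
    qed simp_all
  qed
  interpret rotated_resolvents E A B \<theta>
    by (rule rotated_resolvents.intro[OF self_adjoint_pair_axioms rotated_resolvents_axioms.intro[OF th(1-3) base]])
  have "op_sub (ocomp (imag_power (absop A) t) B)
      (oscale (complex_of_real (exp (\<theta> * t))) (ocomp B (imag_power (absop A) t)))" for t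
  proof -
    let ?V = "Phi (\<lambda>s. pow_it t \<bar>s\<bar>)"
    have V: "?V h \<in> odom B" "oap B (?V h) = scaleC (complex_of_real (exp (- \<theta> * t))) (?V (oap B h))"
      if "h \<in> odom B" for h
      using intertw_pow_it[of t] that Phi_scale[OF Phi_pvm_map(1)[of abs, OF _ bounded_borel_pow_it]]
      unfolding intertw_def by simp_all
    have e: "exp (\<theta> * t) * exp (- \<theta> * t) = 1" by (simp flip: exp_add)
    have "?V (oap B h) = scaleC (complex_of_real (exp (\<theta> * t))) (oap B (?V h))" if "h \<in> odom B" for h
      unfolding V(2)[OF that] scaleC_scaleC of_real_mult[symmetric] e by (simp add: scaleC_one)
    then show ?thesis
      using V(1) imag_power_abs
      unfolding op_sub_def ocomp_def oscale_def by (auto simp: odom_def oap_def)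
  qed
  moreover have anti by (rule anti_if_core[OF q th(3) assms(8) assms(4) base])
  ultimately show ?thesis
    unfolding class_C1_def \<theta>_def by (intro conjI allI assms(6,7) polar_anticommute[OF _ F]) simp_all
qed

end
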